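(* Let $N\ge 1$, $0<p\le 1$, and $\alpha=N(1/p-1)$. Then $$H^p=H^p_{\mathcal{D}}+H^p_{\mathcal{S}_\alpha},$$ where the sum is understood in the sense of quasinormed Banach spaces; that is, the two sides coincide as sets and the quasinorm of $H^p=H^p(\mathbb{R}^N)$ is equivalent to the sum quasinorm $$\|f\|_{H^p_{\mathcal{D}}+H^p_{\mathcal{S}_\alpha}}=\inf\big\{\|f_d\|_{H^p_{\mathcal{D}}}+\|f_s\|_{H^p_{\mathcal{S}_\alpha}}: f=f_d+f_s,\ f_d\in H^p_{\mathcal{D}},\ f_s\in H^p_{\mathcal{S}_\alpha}\big\}.$$
   Context: Notation. $[\alpha]$ is the integer part of $\alpha$; $\mathcal{P}_d$ is the collection of polynomials in $\mathbb{R}^N$ of degree less than or equal to $d$; $|Q|$ is Lebesgue measure. Cubes have sides parallel to the coordinate axes. A function $h$ has vanishing moments up to order $m$ if $\int h(x)\,x^{\beta}\,dx=0$ for all multi-indices $\beta$ with $|\beta|\le m$. Hardy spaces. A compactly supported function $a$ with vanishing moments up to order $[N(1/p-1)]$ is an $L^2$ $p$-atom with defining cube $Q$ if $\operatorname{supp}(a)\subseteq Q$ and $$|Q|^{1/p}\left(\frac1{|Q|}\int_Q|a(x)|^2\,dx\right)^{1/2}\le1.$$ $H^p(\mathbb{R}^N)=H^p$ consists of those distributions $f$ that can be written as $f=\sum\lambda_ja_j$, where the $a_j$ are $L^2$ $p$-atoms, $\sum|\lambda_j|^p<\infty$, and the convergence is in the sense of distributions as well as in $H^p$. It is quasinormed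 by $\|f\|_{H^p}\sim\inf\big(\sum|\lambda_j|^p\big)^{1/p}$, the infimum being over all such atomic decompositions of $f$. Atomic subspaces. For a non-empty family $\mathcal{A}$ of atoms, $H^p_{\mathcal{A}}$ consists of those $\varphi\in H^p$ of the form $\varphi=\sum\lambda_ja_j$ with $a_j\in\mathcal{A}$ and $\sum|\lambda_j|^p<\infty$ (convergence as in $H^p$), with quasinorm $\|\varphi\|_{H^p_{\mathcal{A}}}=\inf\big(\sum|\lambda_j|^p\big)^{1/p}$, the infimum being over all such representations. Dyadic $H^p$. A dyadic cube is a cube $I_{n,k_1}\times\cdots\times I_{n,k_N}$, where $I_{n,k}=[(k-1)2^n,k2^n]$ and $n,k_1,\dots,k_N$ are integers. $H^p_{\mathcal{D}}$ is the space $H^p_{\mathcal{A}}$ when $\mathcal{A}$ is the collection of all $L^2$ $p$-atoms whose defining cube is dyadic. Special atoms. Let $Q_0=[-1,1]^N$; its $2^N$ dyadic subcubes are the products $J_1\times\cdots\times J_N$ with each $J_j$ equal to $[-1,0]$ or $[0,1]$. Let $A$ be the finite-dimensional subspace of $L^2(Q_0)$ of all functions with vanishing moments up to order $[\alpha]$ that coincide with a polynomial in $\mathcal{P}_{[\alpha]}$ on each of the $2^N$ dyadic subcubes of $Q_0$. Fix an orthonormal basis $p^1,\dots,p^M$ of $A$ in $L^2(Q_0)$, extended by $0$ outside $Q_0$. For $n\in\mathbb{Z}$, $k\in\mathbb{Z}^N$, $1\le L\le M$ put $$p^L_{n,k,\alpha}(x)=2^{n(N+\alpha)}\,p^L(2^nx_1+k_1,\dots,2^nx_N+k_N),$$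 and $\mathcal{S}_\alpha=\{p^L_{n,k,\alpha}: n\in\mathbb{Z},\ k\in\mathbb{Z}^N,\ 1\le L\le M\}$. The elements of $\mathcal{S}_\alpha$ are fixed constant multiples of $L^2$ $p$-atoms, and $H^p_{\mathcal{S}_\alpha}$ is the space $H^p_{\mathcal{A}}$ with $\mathcal{A}=\mathcal{S}_\alpha$. *)

theory Defs
  imports "HOL-Analysis.Analysis"
begin

text \<open>The dimension is \<open>N = CARD('n)\<close> and all functions are real-valued.\<close>

definition monomial :: "('n \<Rightarrow> nat) \<Rightarrow> real ^ 'n \<Rightarrow> real" where
  "monomial \<beta> x = (\<Prod>i\<in>UNIV. (x $ i) ^ \<beta> i)"

definition multi_indices :: "nat \<Rightarrow> ('n::finite \<Rightarrow> nat) set" where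
  "multi_indices d = {\<beta>. (\<Sum>i\<in>UNIV. \<beta> i) \<le> d}"

definition polys_upto :: "nat \<Rightarrow> (real ^ 'n \<Rightarrow> real) set" where
  "polys_upto d = {q. \<exists>c. q = (\<lambda>x. \<Sum>\<beta>\<in>multi_indices d. c \<beta> * monomial \<beta> x)}"

text \<open>Bochner integrals of non-integrable functions are 0, so this is only used for
  square-integrable functions vanishing outside a cube.\<close>

definition vanishing_moments :: "nat \<Rightarrow> (real ^ 'n \<Rightarrow> real) \<Rightarrow> bool" where
  "vanishing_moments m h \<longleftrightarrow>
     (\<forall>\<beta>\<in>multi_indices m. (LINT x|lebesgue. h x * monomial \<beta> x) = 0)"

definition L2_on :: "(real ^ 'n) set \<Rightarrow> (real ^ 'n \<Rightarrow> real) \<Rightarrow> bool" where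
  "L2_on Q h \<longleftrightarrow> h \<in> borel_measurable lebesgue \<and> (\<forall>x. x \<notin> Q \<longrightarrow> h x = 0)
     \<and> integrable lebesgue (\<lambda>x. (h x)\<^sup>2)"


subsection \<open>Distributions\<close>

fun iter_partial :: "'n list \<Rightarrow> (real ^ 'n \<Rightarrow> real) \<Rightarrow> real ^ 'n \<Rightarrow> real" where
  "iter_partial [] \<phi> = \<phi>"
| "iter_partial (i # is) \<phi> = (\<lambda>x. frechet_derivative (iter_partial is \<phi>) (at x) (axis i 1))"

definition smooth :: "(real ^ 'n \<Rightarrow> real) \<Rightarrow> bool" where
  "smooth \<phi> \<longleftrightarrow> (\<forall>is x. iter_partial is \<phi> differentiable (at x))"

definition test_funs :: "(real ^ 'n \<Rightarrow> real) set" where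
  "test_funs = {\<phi>. smooth \<phi> \<and> (\<exists>K. compact K \<and> (\<forall>x. x \<notin> K \<longrightarrow> \<phi> x = 0))}"

text \<open>A distribution is represented by a functional on all functions, normalised to be 0 off the
  test functions, so that equality of distributions is equality of functionals. Continuity is the
  usual seminorm estimate on each compact set.\<close>

type_synonym 'n functional = "(real ^ 'n \<Rightarrow> real) \<Rightarrow> real"

definition distributions :: "'n::finite functional set" where
  "distributions = {f.
     (\<forall>\<phi>. \<phi> \<notin> test_funs \<longrightarrow> f \<phi> = 0)
     \<and> (\<forall>\<phi>\<in>test_funs. \<forall>\<psi>\<in>test_funs. f (\<lambda>x. \<phi> x + \<psi> x) = f \<phi> + f \<psi>)
     \<and> (\<forall>\<phi>\<in>test_funs. \<forall>c. f (\<lambda>x. c * \<phi> x) = c * f \<phi>)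
     \<and> (\<forall>K. compact K \<longrightarrow> (\<exists>C m. \<forall>\<phi>\<in>test_funs. (\<forall>x. x \<notin> K \<longrightarrow> \<phi> x = 0) \<longrightarrow>
           (\<forall>B. (\<forall>is x. length is \<le> m \<longrightarrow> \<bar>iter_partial is \<phi> x\<bar> \<le> B) \<longrightarrow> \<bar>f \<phi>\<bar> \<le> C * B)))}"

definition dist_of :: "(real ^ 'n \<Rightarrow> real) \<Rightarrow> 'n::finite functional" where
  "dist_of a \<phi> = (if \<phi> \<in> test_funs then LINT x|lebesgue. a x * \<phi> x else 0)"


subsection \<open>Atoms\<close>

definition is_cube :: "(real ^ 'n) set \<Rightarrow> bool" where
  "is_cube Q \<longleftrightarrow> (\<exists>c l. l > 0 \<and> Q = cbox c (\<chi> i. c $ i + l))"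

definition dyadic_cube :: "int \<Rightarrow> ('n \<Rightarrow> int) \<Rightarrow> (real ^ 'n) set" where
  "dyadic_cube n k =
     cbox (\<chi> i. (of_int (k i) - 1) * 2 powi n) (\<chi> i. of_int (k i) * 2 powi n)"

definition is_atom :: "real \<Rightarrow> (real ^ 'n) set \<Rightarrow> (real ^ 'n \<Rightarrow> real) \<Rightarrow> bool" where
  "is_atom p Q a \<longleftrightarrow> is_cube Q \<and> L2_on Q a
     \<and> vanishing_moments (nat \<lfloor>real CARD('n) * (1 / p - 1)\<rfloor>) a
     \<and> measure lebesgue Q powr (1 / p)
         * sqrt (1 / measure lebesgue Q * (LINT x:Q|lebesgue. \<bar>a x\<bar>\<^sup>2)) \<le> 1"

definition atoms :: "real \<Rightarrow> (real ^ 'n \<Rightarrow> real) set" where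
  "atoms p = {a. \<exists>Q. is_atom p Q a}"

definition dyadic_atoms :: "real \<Rightarrow> (real ^ 'n \<Rightarrow> real) set" where
  "dyadic_atoms p = {a. \<exists>n k. is_atom p (dyadic_cube n k) a}"


subsection \<open>Hardy spaces and atomic subspaces\<close>

definition partial_sum ::
    "(nat \<Rightarrow> real) \<Rightarrow> (nat \<Rightarrow> real ^ 'n \<Rightarrow> real) \<Rightarrow> nat \<Rightarrow> 'n::finite functional" where
  "partial_sum c a n = (\<lambda>\<phi>. \<Sum>j<n. c j * dist_of (a j) \<phi>)"

definition dist_decomp ::
    "real \<Rightarrow> (real ^ 'n \<Rightarrow> real) set \<Rightarrow> 'n::finite functional
      \<Rightarrow> (nat \<Rightarrow> real) \<Rightarrow> (nat \<Rightarrow> real ^ 'n \<Rightarrow> real) \<Rightarrow> bool" where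
  "dist_decomp p A f c a \<longleftrightarrow> (\<forall>j. a j \<in> A) \<and> summable (\<lambda>j. \<bar>c j\<bar> powr p)
     \<and> (\<forall>\<phi>\<in>test_funs. (\<lambda>n. partial_sum c a n \<phi>) \<longlonglongrightarrow> f \<phi>)"

definition coeff_size :: "real \<Rightarrow> (nat \<Rightarrow> real) \<Rightarrow> ennreal" where
  "coeff_size p c = ennreal ((\<Sum>j. \<bar>c j\<bar> powr p) powr (1 / p))"

text \<open>Convergence in \<open>H\<^sup>p\<close> enters the definition of \<open>H\<^sup>p\<close> itself. It is made non-circular by
  measuring it with the atomic gauge taken over decompositions that converge as distributions.
  All gauges are extended-valued, the infimum over no decomposition being \<open>\<infinity>\<close>.\<close>

definition hardy_gauge :: "real \<Rightarrow> 'n::finite functional \<Rightarrow> ennreal" where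
  "hardy_gauge p f = Inf {coeff_size p c | c a. dist_decomp p (atoms p) f c a}"

definition atomic_decomp ::
    "real \<Rightarrow> (real ^ 'n \<Rightarrow> real) set \<Rightarrow> 'n::finite functional
      \<Rightarrow> (nat \<Rightarrow> real) \<Rightarrow> (nat \<Rightarrow> real ^ 'n \<Rightarrow> real) \<Rightarrow> bool" where
  "atomic_decomp p A f c a \<longleftrightarrow> dist_decomp p A f c a
     \<and> (\<lambda>n. hardy_gauge p (\<lambda>\<phi>. f \<phi> - partial_sum c a n \<phi>)) \<longlonglongrightarrow> 0"

definition hardy_space :: "real \<Rightarrow> 'n::finite functional set" where
  "hardy_space p = {f \<in> distributions. \<exists>c a. atomic_decomp p (atoms p) f c a}"

definition atomic_subspace ::
    "real \<Rightarrow> (real ^ 'n \<Rightarrow> real) set \<Rightarrow> 'n::finite functional set" where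
  "atomic_subspace p A = {f \<in> hardy_space p. \<exists>c a. atomic_decomp p A f c a}"

definition atomic_qnorm ::
    "real \<Rightarrow> (real ^ 'n \<Rightarrow> real) set \<Rightarrow> 'n::finite functional \<Rightarrow> ennreal" where
  "atomic_qnorm p A f = Inf {coeff_size p c | c a. atomic_decomp p A f c a}"

definition hardy_qnorm :: "real \<Rightarrow> 'n::finite functional \<Rightarrow> ennreal" where
  "hardy_qnorm p f = atomic_qnorm p (atoms p) f"

definition sum_space ::
    "real \<Rightarrow> (real ^ 'n \<Rightarrow> real) set \<Rightarrow> (real ^ 'n \<Rightarrow> real) set \<Rightarrow> 'n::finite functional set" where
  "sum_space p A B = {(\<lambda>\<phi>. g \<phi> + h \<phi>) | g h. g \<in> atomic_subspace p A \<and> h \<in> atomic_subspace p B}"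

definition sum_qnorm ::
    "real \<Rightarrow> (real ^ 'n \<Rightarrow> real) set \<Rightarrow> (real ^ 'n \<Rightarrow> real) set \<Rightarrow> 'n::finite functional \<Rightarrow> ennreal"
  where
  "sum_qnorm p A B f = Inf {atomic_qnorm p A g + atomic_qnorm p B h | g h.
     g \<in> atomic_subspace p A \<and> h \<in> atomic_subspace p B \<and> f = (\<lambda>\<phi>. g \<phi> + h \<phi>)}"


subsection \<open>Special atoms\<close>

definition Q0 :: "(real ^ 'n) set" where
  "Q0 = cbox (\<chi> i. - 1) (\<chi> i. 1)"

text \<open>The dyadic subcubes of \<open>Q0\<close> are the \<open>dyadic_cube 0 k\<close> with all \<open>k i \<in> {0, 1}\<close>. They overlap
  in null sets, and elements of \<open>L\<^sup>2\<close> are only determined almost everywhere.\<close>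

definition piecewise_polys :: "nat \<Rightarrow> (real ^ 'n \<Rightarrow> real) set" where
  "piecewise_polys d = {h. L2_on Q0 h \<and> vanishing_moments d h
     \<and> (\<forall>k. (\<forall>i. k i \<in> {0, 1}) \<longrightarrow>
          (\<exists>q\<in>polys_upto d. AE x in lebesgue. x \<in> dyadic_cube 0 k \<longrightarrow> h x = q x))}"

definition orthonormal_basis ::
    "(real ^ 'n \<Rightarrow> real) set \<Rightarrow> nat \<Rightarrow> (nat \<Rightarrow> real ^ 'n \<Rightarrow> real) \<Rightarrow> bool" where
  "orthonormal_basis A M P \<longleftrightarrow>
     (\<forall>L\<in>{1..M}. P L \<in> A)
     \<and> (\<forall>K\<in>{1..M}. \<forall>L\<in>{1..M}.
          (LINT x:Q0|lebesgue. P K x * P L x) = (if K = L then 1 else 0))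
     \<and> (\<forall>h\<in>A. \<exists>c. AE x in lebesgue. h x = (\<Sum>L=1..M. c L * P L x))"

definition special_atom ::
    "real \<Rightarrow> (real ^ 'n \<Rightarrow> real) \<Rightarrow> int \<Rightarrow> ('n \<Rightarrow> int) \<Rightarrow> real ^ 'n \<Rightarrow> real" where
  "special_atom \<alpha> q n k x =
     2 powr (of_int n * (real CARD('n) + \<alpha>)) * q (\<chi> i. 2 powi n * x $ i + of_int (k i))"

definition special_atoms ::
    "real \<Rightarrow> nat \<Rightarrow> (nat \<Rightarrow> real ^ 'n \<Rightarrow> real) \<Rightarrow> (real ^ 'n \<Rightarrow> real) set" where
  "special_atoms \<alpha> M P = {special_atom \<alpha> (P L) n k | L n k. L \<in> {1..M}}"

end

theory Submission imports Defs
begin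

text \<open>
  An atom \<open>a\<close> with cube \<open>Q\<close> of side \<open>l\<close> is compared with the dyadic grid of mesh \<open>s = 2\<^sup>n\<close>, where
  \<open>l \<le> s < 2 l\<close>. Then \<open>Q\<close> lies in a block of \<open>2\<^sup>N\<close> dyadic cubes around one lattice point. On each of
  these cubes \<open>a\<close> is split into its \<open>L\<^sup>2\<close>-projection onto the polynomials of degree at most \<open>[\<alpha>]\<close> and
  the rest. The rest has vanishing moments on the dyadic cube, so it is a bounded multiple of a dyadic
  atom. The projections together form a piecewise polynomial \<open>h\<close> on the block; as the difference of
  \<open>a\<close> and functions with vanishing moments, \<open>h\<close> has vanishing moments as well. The affine
  map that takes the block to \<open>Q0\<close> turns \<open>h\<close> into an element of the finite-dimensional space spanned
  by the basis \<open>P\<close>, and therefore \<open>h\<close> is a combination of \<open>M\<close> special atoms of one scale and position.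
  Both kinds of coefficients are bounded by \<open>K = 2 powr (N * (1 / p - 1 / 2))\<close>: orthogonal projections
  do not increase the \<open>L\<^sup>2\<close> norm, and the volumes of \<open>Q\<close> and of a dyadic cube of the block differ at
  most by the factor \<open>2\<^sup>N\<close>. This is \<open>atom_split\<close>.

  Applying the splitting to each term of an atomic decomposition, and rearranging, yields the two
  summands of \<open>f\<close>. The rearrangement is legitimate because atoms are uniformly bounded
  functionals on each test function (\<open>atom_pairing_bound\<close>): for small cubes the vanishing moments allow
  the Taylor polynomial to be subtracted, and for large cubes the size condition alone suffices.
  With \<open>p \<le> 1\<close> the coefficients are absolutely summable, so that every series of atoms with
  \<open>p\<close>-summable coefficients converges to a distribution, and its tails are small in the
  atomic gauge (\<open>dist_decomp_imp_atomic_decomp\<close>). Hence the convergence in \<open>H\<^sup>p\<close> required of the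
  decompositions of the summands is automatic. Conversely, dyadic and special atoms are multiples of
  atoms by a fixed constant, so that two decompositions can be interleaved into one.
\<close>

section \<open>Square-integrable functions\<close>

definition square_integrable :: "'a measure \<Rightarrow> ('a \<Rightarrow> real) \<Rightarrow> bool" where
  "square_integrable \<mu> f \<longleftrightarrow> f \<in> borel_measurable \<mu> \<and> integrable \<mu> (\<lambda>x. (f x)\<^sup>2)"

lemma square_integrableD:
  assumes "square_integrable \<mu> f"
  shows "f \<in> borel_measurable \<mu>" "integrable \<mu> (\<lambda>x. (f x)\<^sup>2)"
  using assms by (auto simp: square_integrable_def)

lemma square_integrable_mult:
  assumes "square_integrable \<mu> f" "square_integrable \<mu> g"
  shows "integrable \<mu> (\<lambda>x. f x * g x)"
proof (rule Bochner_Integration.integrable_bound)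
  show "integrable \<mu> (\<lambda>x. (f x)\<^sup>2 + (g x)\<^sup>2)"
    using assms by (auto simp: square_integrable_def)
  show "(\<lambda>x. f x * g x) \<in> borel_measurable \<mu>"
    using assms by (auto simp: square_integrable_def)
  have "\<bar>u * v\<bar> \<le> u\<^sup>2 + v\<^sup>2" for u v :: real
  proof -
    have "2 * (\<bar>u\<bar> * \<bar>v\<bar>) \<le> u\<^sup>2 + v\<^sup>2"
      using sum_squares_bound[of "\<bar>u\<bar>" "\<bar>v\<bar>"] by simp
    moreover have "0 \<le> \<bar>u\<bar> * \<bar>v\<bar>" by simp
    ultimately show ?thesis unfolding abs_mult by linarith
  qed
  then show "AE x in \<mu>. norm (f x * g x) \<le> norm ((f x)\<^sup>2 + (g x)\<^sup>2)"
    by (simp)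
qed

lemma square_integrable_cmult:
  assumes "square_integrable \<mu> f"
  shows "square_integrable \<mu> (\<lambda>x. c * f x)"
  using assms by (auto simp: square_integrable_def power_mult_distrib)

lemma square_integrable_add:
  assumes "square_integrable \<mu> f" "square_integrable \<mu> g"
  shows "square_integrable \<mu> (\<lambda>x. f x + g x)"
proof -
  have eq: "(\<lambda>x. (f x + g x)\<^sup>2) = (\<lambda>x. (f x)\<^sup>2 + (g x)\<^sup>2 + 2 * (f x * g x))"
    by (auto simp: power2_eq_square algebra_simps)
  have "integrable \<mu> (\<lambda>x. (f x)\<^sup>2 + (g x)\<^sup>2 + 2 * (f x * g x))"
    using assms square_integrable_mult[OF assms]
    by (intro Bochner_Integration.integrable_add integrable_mult_right)
      (auto simp: square_integrable_def)
  then show ?thesis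
    using assms unfolding square_integrable_def eq by auto
qed

lemma square_integrable_diff:
  assumes "square_integrable \<mu> f" "square_integrable \<mu> g"
  shows "square_integrable \<mu> (\<lambda>x. f x - g x)"
  using square_integrable_add[OF assms(1) square_integrable_cmult[OF assms(2), of "-1"]] by simp

lemma square_integrable_sum:
  assumes "\<And>i. i \<in> I \<Longrightarrow> square_integrable \<mu> (f i)"
  shows "square_integrable \<mu> (\<lambda>x. \<Sum>i\<in>I. f i x)"
  using assms
proof (induction I rule: infinite_finite_induct)
  case (insert i I)
  then show ?case using square_integrable_add[of \<mu> "f i" "\<lambda>x. \<Sum>i\<in>I. f i x"] by simp
qed (auto simp: square_integrable_def)

lemma integral_Cauchy_Schwarz:
  assumes f: "square_integrable \<mu> f" and g: "square_integrable \<mu> g"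
  shows "(\<integral>x. f x * g x \<partial>\<mu>)\<^sup>2 \<le> (\<integral>x. (f x)\<^sup>2 \<partial>\<mu>) * (\<integral>x. (g x)\<^sup>2 \<partial>\<mu>)"
proof -
  define F G I where "F = (\<integral>x. (f x)\<^sup>2 \<partial>\<mu>)" and "G = (\<integral>x. (g x)\<^sup>2 \<partial>\<mu>)"
    and "I = (\<integral>x. f x * g x \<partial>\<mu>)"
  have quadratic: "0 \<le> F - 2 * t * I + t\<^sup>2 * G" for t
  proof -
    have "0 \<le> (\<integral>x. (f x - t * g x)\<^sup>2 \<partial>\<mu>)" by simp
    also have "\<dots> = (\<integral>x. (f x)\<^sup>2 - 2 * t * (f x * g x) + t\<^sup>2 * (g x)\<^sup>2 \<partial>\<mu>)"
      by (intro Bochner_Integration.integral_cong)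
        (auto simp: power2_eq_square algebra_simps)
    also have "\<dots> = F - 2 * t * I + t\<^sup>2 * G"
      using square_integrableD[OF f] square_integrableD[OF g] square_integrable_mult[OF f g]
      by (simp add: F_def G_def I_def)
    finally show ?thesis .
  qed
  have "0 \<le> G" by (simp add: G_def)
  show ?thesis
  proof (cases "G = 0")
    case True
    \<comment> \<open>With \<open>G = 0\<close> the quadratic is affine in \<open>t\<close>; at this \<open>t\<close> it equals \<open>-1\<close> unless \<open>I = 0\<close>.\<close>
    then have "0 \<le> F - 2 * ((F + 1) / (2 * I)) * I" using quadratic[of "(F + 1) / (2 * I)"] by simp
    then have "I = 0" by (cases "I = 0") auto
    then show ?thesis using True by (simp add: I_def G_def)
  next
    case False
    then have "0 \<le> F - I\<^sup>2 / G"
      using quadratic[of "I / G"] by (simp add: power2_eq_square field_simps)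
    then have "I\<^sup>2 \<le> F * G" using False \<open>0 \<le> G\<close> by (simp add: field_simps)
    then show ?thesis by (simp add: I_def F_def G_def)
  qed
qed

text \<open>This is Gram-Schmidt, adding one function at a time: the residual of \<open>a\<close> against the old span is
  corrected along the residual \<open>b'\<close> of the new function \<open>b k\<close>.\<close>

lemma orthogonal_projection_exists:
  assumes "finite I" and "\<And>i. i \<in> I \<Longrightarrow> square_integrable \<mu> (b i)"
    and "square_integrable \<mu> a"
  shows "\<exists>c. \<forall>j\<in>I. (\<integral>x. (a x - (\<Sum>i\<in>I. c i * b i x)) * b j x \<partial>\<mu>) = 0"
  using assms
proof (induction I arbitrary: a rule: finite_induct)
  case empty
  then show ?case by simp
next
  case (insert k I)
  obtain c where c: "\<forall>j\<in>I. (\<integral>x. (a x - (\<Sum>i\<in>I. c i * b i x)) * b j x \<partial>\<mu>) = 0"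
    using insert.IH[OF _ insert.prems(2)] insert.prems(1) by blast
  obtain e where e: "\<forall>j\<in>I. (\<integral>x. (b k x - (\<Sum>i\<in>I. e i * b i x)) * b j x \<partial>\<mu>) = 0"
    using insert.IH[of "b k"] insert.prems(1) by blast
  define a' where "a' = (\<lambda>x. a x - (\<Sum>i\<in>I. c i * b i x))"
  define b' where "b' = (\<lambda>x. b k x - (\<Sum>i\<in>I. e i * b i x))"
  define G where "G = (\<integral>x. (b' x)\<^sup>2 \<partial>\<mu>)"
  \<comment> \<open>If \<open>b'\<close> has norm zero then \<open>t = 0\<close> since \<open>x / 0 = 0\<close>; the correction is then
    superfluous, as everything is orthogonal to \<open>b'\<close> by Cauchy-Schwarz.\<close>
  define t where "t = (\<integral>x. a' x * b' x \<partial>\<mu>) / G"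
  have span: "square_integrable \<mu> (\<lambda>x. \<Sum>i\<in>I. w i * b i x)" for w
    by (intro square_integrable_sum square_integrable_cmult insert.prems) auto
  have sq: "square_integrable \<mu> a'" "square_integrable \<mu> b'"
    unfolding a'_def b'_def by (intro square_integrable_diff insert.prems span; simp)+
  have sqb: "square_integrable \<mu> (b j)" if "j \<in> insert k I" for j
    using insert.prems that by auto
  have int_ab: "(\<integral>x. (a' x - t * b' x) * u x \<partial>\<mu>)
      = (\<integral>x. a' x * u x \<partial>\<mu>) - t * (\<integral>x. b' x * u x \<partial>\<mu>)" if "square_integrable \<mu> u" for u
    using square_integrable_mult[OF sq(1) that] square_integrable_mult[OF sq(2) that]
    by (simp add: algebra_simps)
  have orth_I: "(\<integral>x. (a' x - t * b' x) * b j x \<partial>\<mu>) = 0" if "j \<in> I" for j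
    using c e that int_ab[OF sqb, of j] unfolding a'_def b'_def by simp
  have orth_b': "(\<integral>x. (a' x - t * b' x) * b' x \<partial>\<mu>) = 0"
  proof -
    have "(\<integral>x. a' x * b' x \<partial>\<mu>) = t * G"
    proof (cases "G = 0")
      case True
      have "(\<integral>x. a' x * b' x \<partial>\<mu>)\<^sup>2 \<le> 0"
        using integral_Cauchy_Schwarz[OF sq] True by (simp add: G_def)
      then show ?thesis using True by simp
    qed (simp add: t_def)
    moreover have "(\<integral>x. b' x * b' x \<partial>\<mu>) = G" by (simp add: G_def power2_eq_square)
    ultimately show ?thesis using int_ab[OF sq(2)] by simp
  qed
  have sqr: "square_integrable \<mu> (\<lambda>x. a' x - t * b' x)"
    using sq by (intro square_integrable_diff square_integrable_cmult)
  have orth_k: "(\<integral>x. (a' x - t * b' x) * b k x \<partial>\<mu>) = 0"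
  proof -
    have split: "w * b k x = w * b' x + (\<Sum>i\<in>I. e i * (w * b i x))" for w x
    proof -
      have "(\<Sum>i\<in>I. e i * (w * b i x)) = w * (\<Sum>i\<in>I. e i * b i x)"
        unfolding sum_distrib_left by (intro sum.cong) (auto simp: mult_ac)
      then show ?thesis by (simp add: b'_def algebra_simps)
    qed
    have "(\<integral>x. (a' x - t * b' x) * b k x \<partial>\<mu>)
        = (\<integral>x. (a' x - t * b' x) * b' x + (\<Sum>i\<in>I. e i * ((a' x - t * b' x) * b i x)) \<partial>\<mu>)"
      unfolding split ..
    also have "\<dots> = (\<integral>x. (a' x - t * b' x) * b' x \<partial>\<mu>)
        + (\<Sum>i\<in>I. e i * (\<integral>x. (a' x - t * b' x) * b i x \<partial>\<mu>))"
      using square_integrable_mult[OF sqr sq(2)] square_integrable_mult[OF sqr sqb]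
      by (subst Bochner_Integration.integral_add) (auto simp: Bochner_Integration.integral_sum)
    also have "\<dots> = 0" using orth_b' orth_I by simp
    finally show ?thesis .
  qed
  define c' where "c' = (\<lambda>i. if i = k then t else c i - t * e i)"
  have "(\<Sum>i\<in>insert k I. c' i * b i x) = t * b k x + (\<Sum>i\<in>I. (c i - t * e i) * b i x)" for x
    using insert.hyps by (subst sum.insert) (auto simp: c'_def intro!: sum.cong)
  then have "a x - (\<Sum>i\<in>insert k I. c' i * b i x) = a' x - t * b' x" for x
    by (simp add: a'_def b'_def algebra_simps sum_subtractf sum_distrib_left)
  then show ?case using orth_k orth_I by (intro exI[of _ c']) auto
qed

section \<open>Affine changes of variables\<close>

lemma affine_lebesgue:
  fixes t :: "'a::euclidean_space"
  assumes "s \<noteq> 0"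
  shows affine_lebesgue_measurable: "(\<lambda>x. s *\<^sub>R x + t) \<in> lebesgue \<rightarrow>\<^sub>M lebesgue"
    and affine_lebesgue_density: "lebesgue =
      density (distr lebesgue lebesgue (\<lambda>x. s *\<^sub>R x + t)) (\<lambda>_. ennreal (\<bar>s\<bar> ^ DIM('a)))"
proof -
  have eq: "(\<lambda>x. t + (\<Sum>j\<in>Basis. (s * (x \<bullet> j)) *\<^sub>R j)) = (\<lambda>x. s *\<^sub>R x + t)"
    unfolding scaleR_scaleR[symmetric] scaleR_sum_right[symmetric] euclidean_representation
    by (auto simp: ac_simps)
  show "(\<lambda>x. s *\<^sub>R x + t) \<in> lebesgue \<rightarrow>\<^sub>M lebesgue"
    using lebesgue_affine_measurable[of "\<lambda>_. s" t] assms unfolding eq by simp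
  show "lebesgue =
      density (distr lebesgue lebesgue (\<lambda>x. s *\<^sub>R x + t)) (\<lambda>_. ennreal (\<bar>s\<bar> ^ DIM('a)))"
    using lebesgue_affine_euclidean[of "\<lambda>_. s" t] assms unfolding eq by simp
qed

lemma affine_substitution:
  fixes t :: "'a::euclidean_space" and f :: "'a \<Rightarrow> real"
  assumes s: "s \<noteq> 0" and f: "f \<in> borel_measurable lebesgue"
  shows integrable_affine_iff:
      "integrable lebesgue (\<lambda>x. f (s *\<^sub>R x + t)) \<longleftrightarrow> integrable lebesgue f"
    and integral_affine:
      "(LINT x|lebesgue. f x) = \<bar>s\<bar> ^ DIM('a) * (LINT x|lebesgue. f (s *\<^sub>R x + t))"
proof -
  let ?T = "\<lambda>x::'a. s *\<^sub>R x + t"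
  note T = affine_lebesgue_measurable[OF s, of t]
  have fd: "f \<in> borel_measurable (distr lebesgue lebesgue ?T)" using f by simp
  have s': "\<bar>s\<bar> ^ DIM('a) \<noteq> 0" using s by simp
  have "integrable lebesgue f \<longleftrightarrow>
      integrable (density (distr lebesgue lebesgue ?T) (\<lambda>_. ennreal (\<bar>s\<bar> ^ DIM('a)))) f"
    by (rule arg_cong[OF affine_lebesgue_density[OF s, of t], of "\<lambda>\<nu>. integrable \<nu> f"])
  also have "\<dots> \<longleftrightarrow> integrable (distr lebesgue lebesgue ?T) (\<lambda>x. \<bar>s\<bar> ^ DIM('a) * f x)"
    using fd by (subst integrable_density) auto
  also have "\<dots> \<longleftrightarrow> integrable (distr lebesgue lebesgue ?T) f" using s' by simp
  also have "\<dots> \<longleftrightarrow> integrable lebesgue (\<lambda>x. f (?T x))"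
    by (rule integrable_distr_eq[OF T f])
  finally show "integrable lebesgue (\<lambda>x. f (?T x)) \<longleftrightarrow> integrable lebesgue f" ..
  have "(LINT x|lebesgue. f x) =
      (LINT x|density (distr lebesgue lebesgue ?T) (\<lambda>_. ennreal (\<bar>s\<bar> ^ DIM('a))). f x)"
    by (rule arg_cong[OF affine_lebesgue_density[OF s, of t], of "\<lambda>\<nu>. integral\<^sup>L \<nu> f"])
  also have "\<dots> = (LINT x|distr lebesgue lebesgue ?T. \<bar>s\<bar> ^ DIM('a) * f x)"
    using fd by (subst integral_density) auto
  also have "\<dots> = (LINT x|lebesgue. \<bar>s\<bar> ^ DIM('a) * f (?T x))"
    using f by (intro integral_distr[OF T]) auto
  finally show "(LINT x|lebesgue. f x) = \<bar>s\<bar> ^ DIM('a) * (LINT x|lebesgue. f (?T x))" by simp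
qed

lemma square_integrable_affine:
  fixes t :: "'a::euclidean_space"
  assumes s: "s \<noteq> 0" and f: "square_integrable lebesgue f"
  shows "square_integrable lebesgue (\<lambda>x. f (s *\<^sub>R x + t))"
proof -
  have "(\<lambda>x. f (s *\<^sub>R x + t)) \<in> borel_measurable lebesgue"
    using measurable_comp[OF affine_lebesgue_measurable[OF s, of t] square_integrableD(1)[OF f]]
    by (simp add: o_def)
  then show ?thesis
    using integrable_affine_iff[OF s, of "\<lambda>x. (f x)\<^sup>2" t] square_integrableD[OF f]
    by (auto simp: square_integrable_def)
qed

section \<open>Polynomials of bounded degree\<close>

lemma finite_multi_indices [simp]: "finite (multi_indices d :: ('n::finite \<Rightarrow> nat) set)"
proof (rule finite_subset)
  show "multi_indices d \<subseteq> (UNIV :: 'n set) \<rightarrow>\<^sub>E {..d}"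
  proof
    fix \<beta> :: "'n \<Rightarrow> nat"
    assume \<beta>: "\<beta> \<in> multi_indices d"
    have "\<beta> i \<le> (\<Sum>i\<in>UNIV. \<beta> i)" for i by (rule member_le_sum) auto
    then show "\<beta> \<in> UNIV \<rightarrow>\<^sub>E {..d}"
      using \<beta> by (force simp: multi_indices_def PiE_def intro: order_trans)
  qed
  show "finite ((UNIV :: 'n set) \<rightarrow>\<^sub>E {..d})" by (intro finite_PiE) auto
qed

lemma monomial_mem_polys_upto:
  assumes "\<beta> \<in> multi_indices d"
  shows "monomial \<beta> \<in> polys_upto d"
proof -
  have "monomial \<beta> = (\<lambda>x. \<Sum>\<gamma>\<in>multi_indices d. (if \<gamma> = \<beta> then 1 else 0) * monomial \<gamma> x)"
    using assms by (auto simp: if_distrib[of "\<lambda>z. z * _"] sum.delta cong: if_cong)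
  then show ?thesis
    unfolding polys_upto_def by (intro CollectI exI[of _ "\<lambda>\<gamma>. if \<gamma> = \<beta> then 1 else 0"])
qed

lemma polys_upto_add:
  assumes "q \<in> polys_upto d" "r \<in> polys_upto d"
  shows "(\<lambda>x. q x + r x) \<in> polys_upto d"
proof -
  obtain c e where "q = (\<lambda>x. \<Sum>\<beta>\<in>multi_indices d. c \<beta> * monomial \<beta> x)"
    "r = (\<lambda>x. \<Sum>\<beta>\<in>multi_indices d. e \<beta> * monomial \<beta> x)"
    using assms by (auto simp: polys_upto_def)
  then have "(\<lambda>x. q x + r x) = (\<lambda>x. \<Sum>\<beta>\<in>multi_indices d. (c \<beta> + e \<beta>) * monomial \<beta> x)"
    by (simp add: sum.distrib algebra_simps)
  then show ?thesis
    unfolding polys_upto_def by (intro CollectI exI[of _ "\<lambda>\<beta>. c \<beta> + e \<beta>"])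
qed

lemma polys_upto_cmult:
  assumes "q \<in> polys_upto d"
  shows "(\<lambda>x. u * q x) \<in> polys_upto d"
proof -
  obtain c where "q = (\<lambda>x. \<Sum>\<beta>\<in>multi_indices d. c \<beta> * monomial \<beta> x)"
    using assms by (auto simp: polys_upto_def)
  then have "(\<lambda>x. u * q x) = (\<lambda>x. \<Sum>\<beta>\<in>multi_indices d. (u * c \<beta>) * monomial \<beta> x)"
    by (simp add: sum_distrib_left algebra_simps)
  then show ?thesis
    unfolding polys_upto_def by (intro CollectI exI[of _ "\<lambda>\<beta>. u * c \<beta>"])
qed

lemma zero_mem_polys_upto: "(\<lambda>x. 0) \<in> polys_upto d"
  unfolding polys_upto_def by (intro CollectI exI[of _ "\<lambda>\<beta>. 0"]) auto

lemma polys_upto_sum: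
  assumes "\<And>i. i \<in> I \<Longrightarrow> q i \<in> polys_upto d"
  shows "(\<lambda>x. \<Sum>i\<in>I. q i x) \<in> polys_upto d"
  using assms
  by (induction I rule: infinite_finite_induct) (auto simp: zero_mem_polys_upto polys_upto_add)

lemma polys_upto_mono:
  assumes "q \<in> polys_upto d" "d \<le> e"
  shows "q \<in> polys_upto e"
proof -
  obtain c where q: "q = (\<lambda>x. \<Sum>\<beta>\<in>multi_indices d. c \<beta> * monomial \<beta> x)"
    using assms by (auto simp: polys_upto_def)
  show ?thesis unfolding q
    using assms(2)
    by (intro polys_upto_sum polys_upto_cmult monomial_mem_polys_upto)
      (auto simp: multi_indices_def)
qed

lemma one_mem_polys_upto: "(\<lambda>x :: real ^ 'n. 1) \<in> polys_upto d"
proof -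
  have "monomial (\<lambda>_ :: 'n. 0) = (\<lambda>x. 1)" by (auto simp: monomial_def)
  then show ?thesis
    using monomial_mem_polys_upto[of "\<lambda>_ :: 'n. 0" d] by (simp add: multi_indices_def)
qed

text \<open>Taylor polynomials and affine substitutions into monomials are both built from products of affine
  functions of one coordinate, so it is enough to multiply by one such factor at a time.\<close>

lemma polys_upto_mult_linear:
  fixes q :: "real ^ 'n \<Rightarrow> real"
  assumes "q \<in> polys_upto d"
  shows "(\<lambda>x. (s * x $ i + t) * q x) \<in> polys_upto (Suc d)"
proof -
  obtain c where q: "q = (\<lambda>x. \<Sum>\<beta>\<in>multi_indices d. c \<beta> * monomial \<beta> x)"
    using assms by (auto simp: polys_upto_def)
  have inc: "monomial (\<beta>(i := Suc (\<beta> i))) x = x $ i * monomial \<beta> x" for \<beta> and x :: "real ^ 'n"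
    unfolding monomial_def by (simp add: prod.remove[of UNIV i] mult_ac)
  have mem: "\<beta>(i := Suc (\<beta> i)) \<in> multi_indices (Suc d)" if "\<beta> \<in> multi_indices d"
    for \<beta> :: "'n \<Rightarrow> nat"
    using that unfolding multi_indices_def by (simp add: sum.remove[of UNIV i])
  have "(\<lambda>x. (s * x $ i + t) * q x) = (\<lambda>x. \<Sum>\<beta>\<in>multi_indices d.
      c \<beta> * (s * monomial (\<beta>(i := Suc (\<beta> i))) x + t * monomial \<beta> x))"
    unfolding q inc by (simp add: algebra_simps sum_distrib_left sum.distrib)
  also have "\<dots> \<in> polys_upto (Suc d)"
    using mem
    by (intro polys_upto_sum polys_upto_cmult polys_upto_add monomial_mem_polys_upto)
      (auto simp: multi_indices_def)
  finally show ?thesis .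
qed

lemma polys_upto_prod_list_linear:
  "(\<lambda>x :: real ^ 'n. \<Prod>i\<leftarrow>is. (s * x $ i + t i)) \<in> polys_upto (length is)"
proof (induction "is")
  case Nil
  show ?case using one_mem_polys_upto by simp
next
  case (Cons i "is")
  then show ?case using polys_upto_mult_linear[OF Cons, of s i "t i"] by simp
qed

lemma monomial_affine_mem_polys_upto:
  fixes \<beta> :: "'n::finite \<Rightarrow> nat"
  assumes "\<beta> \<in> multi_indices d"
  shows "(\<lambda>x. monomial \<beta> (s *\<^sub>R x + t)) \<in> polys_upto d"
proof -
  have "(\<lambda>x :: real ^ 'n. \<Prod>i\<in>S. (s * x $ i + t $ i) ^ \<beta> i) \<in> polys_upto (\<Sum>i\<in>S. \<beta> i)" for S
  proof (induction S rule: infinite_finite_induct)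
    case (insert j S)
    have "(\<lambda>x. (s * x $ j + t $ j) ^ m * (\<Prod>i\<in>S. (s * x $ i + t $ i) ^ \<beta> i))
        \<in> polys_upto (m + (\<Sum>i\<in>S. \<beta> i))" for m
    proof (induction m)
      case (Suc m)
      then show ?case using polys_upto_mult_linear[OF Suc, of s j "t $ j"] by (simp add: mult_ac)
    qed (use insert.IH in simp)
    then show ?case using insert.hyps by simp
  qed (use one_mem_polys_upto in simp_all)
  from this[of UNIV] show ?thesis
    using assms unfolding monomial_def multi_indices_def by (auto intro: polys_upto_mono)
qed

lemma polys_upto_affine:
  assumes "q \<in> polys_upto d"
  shows "(\<lambda>x. q (s *\<^sub>R x + t)) \<in> polys_upto d"
proof -
  obtain c where q: "q = (\<lambda>x. \<Sum>\<beta>\<in>multi_indices d. c \<beta> * monomial \<beta> x)"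
    using assms by (auto simp: polys_upto_def)
  show ?thesis unfolding q
    by (intro polys_upto_sum polys_upto_cmult monomial_affine_mem_polys_upto)
qed

lemma continuous_on_monomial: "continuous_on S (monomial \<beta>)"
  unfolding monomial_def[abs_def] by (intro continuous_intros)

lemma continuous_on_polys_upto:
  assumes "q \<in> polys_upto d"
  shows "continuous_on S q"
  using assms unfolding polys_upto_def
  by (auto intro!: continuous_intros continuous_on_monomial)

text \<open>On the diagonal \<open>q\<close> is a polynomial in one variable, which has infinitely many roots only if it
  is zero.\<close>

lemma polys_upto_zero_on_diagonal:
  fixes q :: "real ^ 'n \<Rightarrow> real"
  assumes q: "q \<in> polys_upto d" and zero: "\<And>t. 0 < t \<Longrightarrow> t < 1 \<Longrightarrow> q (\<chi> i. t) = 0"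
  shows "q (\<chi> i. t) = 0"
proof -
  obtain c where c: "q = (\<lambda>x. \<Sum>\<beta>\<in>multi_indices d. c \<beta> * monomial \<beta> x)"
    using q by (auto simp: polys_upto_def)
  define Q :: "real poly" where "Q = (\<Sum>\<beta>\<in>multi_indices d. Polynomial.monom (c \<beta>) (\<Sum>i\<in>UNIV. \<beta> i))"
  have Q: "q (\<chi> i. t) = poly Q t" for t
    by (simp add: c Q_def monomial_def poly_sum poly_monom power_sum)
  have "Q = 0"
  proof (rule ccontr)
    assume "Q \<noteq> 0"
    then have "finite {t. poly Q t = 0}" by (rule poly_roots_finite)
    moreover have "{0<..<1} \<subseteq> {t. poly Q t = 0}" using zero Q by auto
    ultimately have "finite {0<..<1::real}" by (rule rev_finite_subset)
    moreover have "infinite {0<..<1::real}" by (rule infinite_Ioo) simp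
    ultimately show False by simp
  qed
  then show ?thesis using Q by simp
qed

section \<open>Functions in \<open>L\<^sup>2\<close> of a bounded set\<close>

lemma L2_on_imp_square_integrable:
  "L2_on Q h \<Longrightarrow> square_integrable lebesgue h"
  by (auto simp: L2_on_def square_integrable_def)

lemma L2_on_iff: "L2_on Q h \<longleftrightarrow> square_integrable lebesgue h \<and> (\<forall>x. x \<notin> Q \<longrightarrow> h x = 0)"
  by (auto simp: L2_on_def square_integrable_def)

lemma L2_on_subset: "L2_on Q h \<Longrightarrow> Q \<subseteq> Q' \<Longrightarrow> L2_on Q' h"
  by (auto simp: L2_on_def)

lemma square_integrable_continuous_indicator:
  fixes f :: "real ^ 'n \<Rightarrow> real"
  assumes "continuous_on UNIV f" "S \<in> sets lebesgue" "bounded S"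
  shows "square_integrable lebesgue (\<lambda>x. indicator S x * f x)"
proof -
  obtain a where a: "S \<subseteq> cbox (-a) a" using bounded_subset_cbox_symmetric[OF assms(3)] by auto
  have m: "f \<in> borel_measurable lebesgue"
    using assms(1) borel_measurable_continuous_onI measurable_completion
    by (metis measurable_lborel2)
  have i: "integrable lebesgue (\<lambda>x. indicator (cbox (-a) a) x * (f x)\<^sup>2)"
    using absolutely_integrable_continuous[of "-a" a "\<lambda>x. (f x)\<^sup>2"] assms(1)
    by (auto simp: set_integrable_def intro!: continuous_intros intro: continuous_on_subset)
  have m': "(\<lambda>x. indicator S x * f x) \<in> borel_measurable lebesgue" using m assms by simp
  have "integrable lebesgue (\<lambda>x. (indicator S x * f x)\<^sup>2)"
    by (rule Bochner_Integration.integrable_bound[OF i])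
      (use m' a in \<open>auto simp: indicator_def\<close>)
  then show ?thesis using m' by (simp add: square_integrable_def)
qed

lemma L2_on_mult_continuous_integrable:
  fixes f :: "real ^ 'n \<Rightarrow> real"
  assumes "L2_on Q h" "bounded Q" "continuous_on UNIV f"
  shows "integrable lebesgue (\<lambda>x. h x * f x)"
proof -
  obtain a where a: "Q \<subseteq> cbox (-a) a" using bounded_subset_cbox_symmetric[OF assms(2)] by auto
  have "integrable lebesgue (\<lambda>x. h x * (indicator (cbox (-a) a) x * f x))"
    by (intro square_integrable_mult L2_on_imp_square_integrable[OF assms(1)]
      square_integrable_continuous_indicator assms) auto
  moreover have "h x * (indicator (cbox (-a) a) x * f x) = h x * f x" for x
    using a assms(1) by (auto simp: L2_on_def indicator_def)
  ultimately show ?thesis by simp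
qed

lemma vanishing_moments_iff_polys:
  fixes h :: "real ^ 'n \<Rightarrow> real"
  assumes "L2_on Q h" "bounded Q"
  shows "vanishing_moments m h \<longleftrightarrow> (\<forall>q\<in>polys_upto m. (LINT x|lebesgue. h x * q x) = 0)"
proof
  assume v: "vanishing_moments m h"
  show "\<forall>q\<in>polys_upto m. (LINT x|lebesgue. h x * q x) = 0"
  proof
    fix q :: "real ^ 'n \<Rightarrow> real" assume "q \<in> polys_upto m"
    then obtain c where q: "q = (\<lambda>x. \<Sum>\<beta>\<in>multi_indices m. c \<beta> * monomial \<beta> x)"
      by (auto simp: polys_upto_def)
    have "(LINT x|lebesgue. h x * q x)
        = (LINT x|lebesgue. (\<Sum>\<beta>\<in>multi_indices m. c \<beta> * (h x * monomial \<beta> x)))"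
      unfolding q by (intro Bochner_Integration.integral_cong) (auto simp: sum_distrib_left mult_ac)
    also have "\<dots> = (\<Sum>\<beta>\<in>multi_indices m. c \<beta> * (LINT x|lebesgue. h x * monomial \<beta> x))"
      using L2_on_mult_continuous_integrable[OF assms continuous_on_monomial]
      by (subst Bochner_Integration.integral_sum) auto
    also have "\<dots> = 0" using v by (auto simp: vanishing_moments_def)
    finally show "(LINT x|lebesgue. h x * q x) = 0" .
  qed
qed (auto simp: vanishing_moments_def monomial_mem_polys_upto)

lemma vanishing_moments_cmult:
  "vanishing_moments m h \<Longrightarrow> vanishing_moments m (\<lambda>x. c * h x)"
  by (simp add: vanishing_moments_def mult.assoc)

section \<open>Taylor approximation of smooth functions\<close>

lemma smooth_has_derivative_along_line:
  fixes \<phi> :: "real ^ 'n \<Rightarrow> real"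
  assumes "smooth \<phi>"
  shows "((\<lambda>t. iter_partial is \<phi> (y + t *\<^sub>R h)) has_real_derivative
    (\<Sum>i\<in>UNIV. h $ i * iter_partial (i # is) \<phi> (y + t *\<^sub>R h))) (at t)"
proof -
  let ?u = "iter_partial is \<phi>" and ?z = "y + t *\<^sub>R h"
  let ?D = "frechet_derivative ?u (at ?z)"
  have D: "(?u has_derivative ?D) (at ?z)"
    using assms by (simp add: smooth_def frechet_derivative_works)
  then interpret D: linear ?D by (rule has_derivative_linear)
  have "((\<lambda>t. y + t *\<^sub>R h) has_derivative (\<lambda>d. d *\<^sub>R h)) (at t)"
    by (auto intro!: derivative_eq_intros)
  from diff_chain_at[OF this D]
  have "((\<lambda>t. ?u (y + t *\<^sub>R h)) has_derivative (\<lambda>d. ?D (d *\<^sub>R h))) (at t)"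
    by (simp add: o_def)
  moreover have "?D (d *\<^sub>R h) = (\<Sum>i\<in>UNIV. h $ i * iter_partial (i # is) \<phi> ?z) * d" for d
  proof -
    have "?D h = ?D (\<Sum>i\<in>UNIV. (h $ i) *\<^sub>R axis i 1)"
      using basis_expansion[of h] by (simp add: scalar_mult_eq_scaleR)
    also have "\<dots> = (\<Sum>i\<in>UNIV. h $ i * iter_partial (i # is) \<phi> ?z)"
      by (simp add: D.sum D.scaleR)
    finally show ?thesis by (simp add: D.scaleR)
  qed
  ultimately show ?thesis by (simp add: has_field_derivative_def mult_commute_abs)
qed

lemma card_lists_of_length: "card {is :: 'n::finite list. length is = k} = CARD('n) ^ k"
  using card_lists_length_eq[of "UNIV :: 'n set" k] by simp

lemma sum_lists_of_length_Suc:
  fixes f :: "'n::finite list \<Rightarrow> 'b::comm_monoid_add"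
  shows "(\<Sum>is | length is = Suc k. f is) = (\<Sum>is | length is = k. \<Sum>i\<in>UNIV. f (i # is))"
proof -
  have "(\<Sum>is | length is = k. \<Sum>i\<in>UNIV. f (i # is))
      = (\<Sum>(is, i)\<in>{is. length is = k} \<times> UNIV. f (i # is))"
    by (rule sum.cartesian_product)
  also have "\<dots> = (\<Sum>is | length is = Suc k. f is)"
    by (rule sum.reindex_bij_witness[of _ "\<lambda>is. (tl is, hd is)" "\<lambda>(is, i). i # is"])
      (auto simp: length_Suc_conv)
  finally show ?thesis ..
qed

text \<open>Along the segment from \<open>y\<close> to \<open>x\<close> the \<open>k\<close>-th derivative is a sum over all lists of \<open>k\<close> coordinate
  directions, one iterated partial derivative for each. The one-variable Taylor formula thus gives a
  polynomial in \<open>x\<close>, with a remainder of \<open>CARD('n) ^ Suc m\<close> terms.\<close>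

lemma taylor_polynomial:
  fixes \<phi> :: "real ^ 'n \<Rightarrow> real"
  assumes smooth: "smooth \<phi>"
    and bound: "\<And>is x. length is \<le> Suc m \<Longrightarrow> \<bar>iter_partial is \<phi> x\<bar> \<le> B"
  obtains q where "q \<in> polys_upto m"
    "\<And>x r. (\<And>i. \<bar>x $ i - y $ i\<bar> \<le> r) \<Longrightarrow>
      \<bar>\<phi> x - q x\<bar> \<le> real CARD('n) ^ Suc m * r ^ Suc m * B"
proof
  define q where "q = (\<lambda>x. \<Sum>k<Suc m. 1 / fact k *
    (\<Sum>is | length is = k. iter_partial is \<phi> y * (\<Prod>i\<leftarrow>is. (1 * x $ i + (- (y $ i))))))"
  show "q \<in> polys_upto m"
    unfolding q_def
    by (intro polys_upto_sum polys_upto_cmult)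
      (rule polys_upto_mono[OF polys_upto_prod_list_linear], auto)
  fix x r assume r: "\<And>i. \<bar>x $ i - y $ i\<bar> \<le> r"
  define h where "h = x - y"
  define D where "D = (\<lambda>k t. \<Sum>is | length is = k.
    (\<Prod>i\<leftarrow>is. h $ i) * iter_partial is \<phi> (y + t *\<^sub>R h))"
  have D: "DERIV (D k) t :> D (Suc k) t" for k t
  proof -
    have "(D k has_real_derivative (\<Sum>is | length is = k. (\<Prod>i\<leftarrow>is. h $ i) *
        (\<Sum>i\<in>UNIV. h $ i * iter_partial (i # is) \<phi> (y + t *\<^sub>R h)))) (at t)"
      unfolding D_def
      by (intro DERIV_sum DERIV_cmult smooth_has_derivative_along_line smooth)
    also have "(\<Sum>is | length is = k. (\<Prod>i\<leftarrow>is. h $ i) *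
        (\<Sum>i\<in>UNIV. h $ i * iter_partial (i # is) \<phi> (y + t *\<^sub>R h))) = D (Suc k) t"
      unfolding D_def sum_lists_of_length_Suc
      by (simp add: sum_distrib_left mult_ac)
    finally show ?thesis .
  qed
  have D0: "D 0 t = \<phi> (y + t *\<^sub>R h)" for t
    by (simp add: D_def)
  have "\<exists>t. (if (1::real) < 0 then 1 < t \<and> t < 0 else 0 < t \<and> t < 1) \<and>
      D 0 1 = (\<Sum>k<Suc m. D k 0 / fact k * (1 - 0) ^ k) + D (Suc m) t / fact (Suc m) * (1 - 0) ^ Suc m"
    by (rule Taylor[where a = 0 and b = 1]) (auto simp: D)
  then obtain t where t: "D 0 1 = (\<Sum>k<Suc m. D k 0 / fact k) + D (Suc m) t / fact (Suc m)"
    by auto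
  have "($) h = (\<lambda>i. x $ i - y $ i)" by (auto simp: h_def)
  then have "(\<Sum>k<Suc m. D k 0 / fact k) = q x"
    unfolding q_def D_def by (intro sum.cong) (auto simp: mult_ac)
  moreover have "D 0 1 = \<phi> x" by (simp add: D0 h_def)
  ultimately have diff: "\<phi> x - q x = D (Suc m) t / fact (Suc m)" using t by simp
  have r0: "0 \<le> r" using r[of undefined] by linarith
  have B0: "0 \<le> B" using bound[of "[]" y] by simp
  have prod: "\<bar>\<Prod>i\<leftarrow>is. h $ i\<bar> \<le> r ^ length is" for "is"
  proof (induction "is")
    case (Cons i "is")
    then show ?case using r[of i] r0 by (auto simp: abs_mult h_def intro!: mult_mono)
  qed simp
  have "\<bar>D (Suc m) t\<bar> \<le> (\<Sum>is :: 'n list | length is = Suc m. r ^ Suc m * B)"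
    unfolding D_def
  proof (intro order_trans[OF sum_abs] sum_mono)
    fix "is" :: "'n list" assume "is \<in> {is. length is = Suc m}"
    then show "\<bar>(\<Prod>i\<leftarrow>is. h $ i) * iter_partial is \<phi> (y + t *\<^sub>R h)\<bar> \<le> r ^ Suc m * B"
      unfolding abs_mult using prod[of "is"] bound[of "is"] r0 by (intro mult_mono) auto
  qed
  also have "\<dots> = real CARD('n) ^ Suc m * r ^ Suc m * B"
    by (simp add: card_lists_of_length)
  finally have D': "\<bar>D (Suc m) t\<bar> \<le> real CARD('n) ^ Suc m * r ^ Suc m * B" .
  have "\<bar>\<phi> x - q x\<bar> \<le> \<bar>D (Suc m) t\<bar> / 1"
    unfolding diff abs_divide by (intro divide_left_mono) (auto simp del: fact_Suc)
  then show "\<bar>\<phi> x - q x\<bar> \<le> real CARD('n) ^ Suc m * r ^ Suc m * B" using D' by simp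
qed

lemma smooth_continuous_on:
  assumes "smooth \<phi>"
  shows "continuous_on S \<phi>"
proof -
  have "\<phi> differentiable (at x)" for x
    using assms unfolding smooth_def by (metis iter_partial.simps(1))
  then show ?thesis
    by (intro differentiable_imp_continuous_on) (auto simp: differentiable_on_def intro: differentiable_at_withinI)
qed

section \<open>Atoms as functionals\<close>

lemma measure_cube:
  fixes c :: "real ^ 'n"
  assumes "l > 0"
  shows "measure lborel (cbox c (\<chi> i. c $ i + l)) = l ^ CARD('n)"
proof -
  have "cbox c (\<chi> i. c $ i + l) \<noteq> {}"
    using assms by (auto simp: interval_ne_empty_cart)
  then show ?thesis by (simp add: content_cbox_cart)
qed

text \<open>The size condition of an atom, solved for the \<open>L\<^sup>2\<close> norm. Only this norm and the volume of the cube
  enter the estimates, and neither is changed by taking absolute values or restricting to the cube.\<close>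

lemma is_atom_iff:
  fixes a :: "real ^ 'n \<Rightarrow> real"
  shows "is_atom p Q a \<longleftrightarrow> is_cube Q \<and> L2_on Q a
    \<and> vanishing_moments (nat \<lfloor>real CARD('n) * (1 / p - 1)\<rfloor>) a
    \<and> (LINT x|lebesgue. (a x)\<^sup>2) \<le> measure lebesgue Q powr (1 - 2 / p)"
proof -
  have "(measure lebesgue Q powr (1 / p)
         * sqrt (1 / measure lebesgue Q * (LINT x:Q|lebesgue. \<bar>a x\<bar>\<^sup>2)) \<le> 1)
      \<longleftrightarrow> (LINT x|lebesgue. (a x)\<^sup>2) \<le> measure lebesgue Q powr (1 - 2 / p)"
    if "is_cube Q" and a: "L2_on Q a"
  proof -
    define V where "V = measure lebesgue Q"
    have V: "V > 0" using that(1) by (auto simp: is_cube_def V_def measure_cube)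
    define I where "I = (LINT x|lebesgue. (a x)\<^sup>2)"
    have "0 \<le> I" by (simp add: I_def)
    have "(LINT x:Q|lebesgue. \<bar>a x\<bar>\<^sup>2) = I"
      unfolding I_def set_lebesgue_integral_def
      using a by (intro Bochner_Integration.integral_cong) (auto simp: L2_on_def indicator_def)
    moreover have "V powr (1 / p) * sqrt (1 / V * I) \<le> 1 \<longleftrightarrow> I \<le> V powr (1 - 2 / p)"
    proof -
      have "V powr (1 / p) * sqrt (1 / V * I) \<le> 1 \<longleftrightarrow> (V powr (1 / p) * sqrt (1 / V * I))\<^sup>2 \<le> 1\<^sup>2"
        using V \<open>0 \<le> I\<close> by (subst power_mono_iff) auto
      also have "(V powr (1 / p) * sqrt (1 / V * I))\<^sup>2 = V powr (2 / p) * (I / V)"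
        using V \<open>0 \<le> I\<close> by (simp add: power_mult_distrib powr_power)
      also have "V powr (2 / p) * (I / V) \<le> 1\<^sup>2 \<longleftrightarrow> I \<le> V powr (1 - 2 / p)"
        using V by (simp add: powr_diff field_simps)
      finally show ?thesis .
    qed
    ultimately show ?thesis by (simp add: V_def I_def)
  qed
  then show ?thesis unfolding is_atom_def by blast
qed

lemma L2_on_integral_bound:
  fixes a f :: "real ^ 'n \<Rightarrow> real"
  assumes a: "L2_on Q a" and Q: "compact Q" and f: "continuous_on UNIV f"
    and U: "\<And>x. x \<in> Q \<Longrightarrow> \<bar>f x\<bar> \<le> U"
  shows "(LINT x|lebesgue. a x * f x)\<^sup>2
    \<le> (LINT x|lebesgue. (a x)\<^sup>2) * (measure lebesgue Q * U\<^sup>2)"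
proof -
  have Q': "Q \<in> sets lebesgue" "bounded Q" "Q \<in> lmeasurable"
    using lmeasurable_compact[OF Q] compact_imp_bounded[OF Q] by auto
  let ?g = "\<lambda>x. indicator Q x * f x"
  have g: "square_integrable lebesgue ?g"
    by (intro square_integrable_continuous_indicator f Q')
  have "(LINT x|lebesgue. a x * f x) = (LINT x|lebesgue. a x * ?g x)"
    using a by (intro Bochner_Integration.integral_cong) (auto simp: L2_on_def indicator_def)
  then have "(LINT x|lebesgue. a x * f x)\<^sup>2
      \<le> (LINT x|lebesgue. (a x)\<^sup>2) * (LINT x|lebesgue. (?g x)\<^sup>2)"
    using integral_Cauchy_Schwarz[OF L2_on_imp_square_integrable[OF a] g] by simp
  moreover have "(LINT x|lebesgue. (?g x)\<^sup>2) \<le> (LINT x|lebesgue. indicator Q x * U\<^sup>2)"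
  proof (rule integral_mono)
    show "integrable lebesgue (\<lambda>x. (?g x)\<^sup>2)" using g by (rule square_integrableD)
    show "integrable lebesgue (\<lambda>x. indicator Q x * U\<^sup>2)"
      using Q'(3) by (intro integrable_mult_left) (simp add: lmeasurable_iff_integrable)
    show "(?g x)\<^sup>2 \<le> indicator Q x * U\<^sup>2" for x
      using power_mono[OF U abs_ge_zero, of x 2] by (auto simp: indicator_def)
  qed
  moreover have "(LINT x|lebesgue. indicator Q x * U\<^sup>2) = measure lebesgue Q * U\<^sup>2" by simp
  ultimately show ?thesis
    using mult_left_mono[of "LINT x|lebesgue. (?g x)\<^sup>2" _ "LINT x|lebesgue. (a x)\<^sup>2"]
    by (auto intro: order_trans)
qed

text \<open>By Cauchy-Schwarz and the size condition, a function is paired with an atom on a cube of side \<open>l\<close>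
  to at most \<open>l powr (- \<alpha>)\<close> times its supremum over the cube. For \<open>l > 1\<close> this factor is at most 1. For
  \<open>l \<le> 1\<close> the Taylor polynomial of degree \<open>m = [\<alpha>]\<close> is subtracted first, which gains \<open>l ^ Suc m\<close>, and
  this compensates \<open>l powr (- \<alpha>)\<close> because \<open>Suc m > \<alpha>\<close>.\<close>

lemma atom_pairing_bound:
  fixes a \<phi> :: "real ^ 'n \<Rightarrow> real"
  assumes p: "0 < p" "p \<le> 1" and a: "is_atom p Q a" and \<phi>: "smooth \<phi>"
    and m: "m = nat \<lfloor>real CARD('n) * (1 / p - 1)\<rfloor>"
    and bound: "\<And>is x. length is \<le> Suc m \<Longrightarrow> \<bar>iter_partial is \<phi> x\<bar> \<le> B"
  shows "\<bar>LINT x|lebesgue. a x * \<phi> x\<bar> \<le> real CARD('n) ^ Suc m * B"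
proof -
  let ?N = "real CARD('n)"
  define \<alpha> where "\<alpha> = ?N * (1 / p - 1)"
  have \<alpha>0: "0 \<le> \<alpha>" using p by (auto simp: \<alpha>_def)
  have \<alpha>m: "\<alpha> < Suc m" unfolding m \<alpha>_def[symmetric] using \<alpha>0 by linarith
  obtain c l where l: "l > 0" and Q: "Q = cbox c (\<chi> i. c $ i + l)"
    using a by (auto simp: is_atom_def is_cube_def)
  have aL: "L2_on Q a" and van: "vanishing_moments m a"
    and size: "(LINT x|lebesgue. (a x)\<^sup>2) \<le> (l ^ CARD('n)) powr (1 - 2 / p)"
    using a l by (auto simp: is_atom_iff m Q measure_cube)
  have N1: "1 \<le> ?N" by simp
  have B0: "0 \<le> B" using bound[of "[]" c] by simp
  have pairing: "\<bar>LINT x|lebesgue. a x * f x\<bar> \<le> l powr (- \<alpha>) * U"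
    if f: "continuous_on UNIV f" and U: "\<And>x. x \<in> Q \<Longrightarrow> \<bar>f x\<bar> \<le> U" "0 \<le> U" for f U
  proof -
    have "(LINT x|lebesgue. a x * f x)\<^sup>2
        \<le> (LINT x|lebesgue. (a x)\<^sup>2) * (l ^ CARD('n) * U\<^sup>2)"
      using L2_on_integral_bound[OF aL _ f U(1)] l by (simp add: Q measure_cube)
    also have "\<dots> \<le> (l ^ CARD('n)) powr (1 - 2 / p) * (l ^ CARD('n) * U\<^sup>2)"
      using size l by (intro mult_right_mono) auto
    also have "\<dots> = (l powr (- \<alpha>) * U)\<^sup>2"
    proof -
      have "(l ^ CARD('n)) powr (1 - 2 / p) * l ^ CARD('n) = l powr (?N * (1 - 2 / p) + ?N)"
        using l by (simp add: powr_add powr_powr flip: powr_realpow)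
      also have "?N * (1 - 2 / p) + ?N = - \<alpha> * 2"
        using p by (simp add: \<alpha>_def field_simps)
      also have "l powr (- \<alpha> * 2) = (l powr (- \<alpha>))\<^sup>2"
        using l by (simp add: powr_power mult.commute)
      finally show ?thesis by (simp add: power_mult_distrib mult_ac)
    qed
    finally show ?thesis using U(2) l by (intro power2_le_imp_le[of "\<bar>_\<bar>"]) auto
  qed
  show ?thesis
  proof (cases "l \<le> 1")
    case True
    obtain q where q: "q \<in> polys_upto m" and approx: "\<And>x r. (\<And>i. \<bar>x $ i - c $ i\<bar> \<le> r) \<Longrightarrow>
        \<bar>\<phi> x - q x\<bar> \<le> ?N ^ Suc m * r ^ Suc m * B"
      using taylor_polynomial[OF \<phi> bound] by blast
    have bQ: "bounded Q" by (simp add: Q)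
    have cont: "continuous_on UNIV \<phi>" "continuous_on UNIV q"
      using \<phi> q by (auto intro: smooth_continuous_on continuous_on_polys_upto)
    have "(LINT x|lebesgue. a x * q x) = 0"
      using van q vanishing_moments_iff_polys[OF aL bQ] by blast
    then have "(LINT x|lebesgue. a x * \<phi> x) = (LINT x|lebesgue. a x * (\<phi> x - q x))"
      using L2_on_mult_continuous_integrable[OF aL bQ cont(1)]
        L2_on_mult_continuous_integrable[OF aL bQ cont(2)]
      by (simp add: right_diff_distrib)
    also have "\<bar>\<dots>\<bar> \<le> l powr (- \<alpha>) * (?N ^ Suc m * l ^ Suc m * B)"
    proof (rule pairing)
      show "continuous_on UNIV (\<lambda>x. \<phi> x - q x)" using cont by (intro continuous_intros)
      show "\<bar>\<phi> x - q x\<bar> \<le> ?N ^ Suc m * l ^ Suc m * B" if "x \<in> Q" for x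
      proof (rule approx)
        show "\<bar>x $ i - c $ i\<bar> \<le> l" for i
          using that unfolding Q mem_box_cart by (auto dest!: spec[of _ i])
      qed
      show "0 \<le> ?N ^ Suc m * l ^ Suc m * B" using l B0 by simp
    qed
    also have "\<dots> = l powr (Suc m - \<alpha>) * (?N ^ Suc m * B)"
    proof -
      have "l ^ Suc m = l powr (Suc m)" by (rule powr_realpow[OF l, symmetric])
      then have "l powr (- \<alpha>) * l ^ Suc m = l powr (Suc m - \<alpha>)"
        by (simp add: powr_add[symmetric] del: power_Suc)
      then show ?thesis by (simp add: mult_ac)
    qed
    also have "\<dots> \<le> 1 * (?N ^ Suc m * B)"
      using True l \<alpha>m B0 by (intro mult_right_mono powr_le1) auto
    finally show ?thesis by simp
  next
    case False
    have "\<bar>LINT x|lebesgue. a x * \<phi> x\<bar> \<le> l powr (- \<alpha>) * B"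
      using bound[of "[]"] B0 by (intro pairing smooth_continuous_on \<phi>) auto
    also have "\<dots> \<le> ?N ^ Suc m * B"
    proof (rule mult_right_mono[OF _ B0])
      have "l powr (- \<alpha>) \<le> l powr 0" using False \<alpha>0 by (intro powr_mono) auto
      also have "\<dots> \<le> ?N ^ Suc m" using l by (simp del: power_Suc)
      finally show "l powr (- \<alpha>) \<le> ?N ^ Suc m" .
    qed
    finally show ?thesis .
  qed
qed

section \<open>Test functions\<close>

lemma iter_partial_add:
  assumes "smooth \<phi>" "smooth \<psi>"
  shows "iter_partial is (\<lambda>x. \<phi> x + \<psi> x) = (\<lambda>x. iter_partial is \<phi> x + iter_partial is \<psi> x)"
proof (induction "is")
  case (Cons i "is")
  have "frechet_derivative (\<lambda>x. iter_partial is \<phi> x + iter_partial is \<psi> x) (at x)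
      = (\<lambda>d. frechet_derivative (iter_partial is \<phi>) (at x) d
          + frechet_derivative (iter_partial is \<psi>) (at x) d)" for x
    using assms
    by (intro frechet_derivative_at[symmetric] has_derivative_add)
      (auto simp: smooth_def frechet_derivative_works[symmetric])
  then show ?case using Cons by simp
qed simp

lemma iter_partial_cmult:
  assumes "smooth \<phi>"
  shows "iter_partial is (\<lambda>x. c * \<phi> x) = (\<lambda>x. c * iter_partial is \<phi> x)"
proof (induction "is")
  case (Cons i "is")
  have "frechet_derivative (\<lambda>x. c * iter_partial is \<phi> x) (at x)
      = (\<lambda>d. c * frechet_derivative (iter_partial is \<phi>) (at x) d)" for x
    using assms
    by (intro frechet_derivative_at[symmetric] has_derivative_mult_right)
      (auto simp: smooth_def frechet_derivative_works[symmetric])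
  then show ?case using Cons by simp
qed simp

lemma test_funs_add:
  assumes "\<phi> \<in> test_funs" "\<psi> \<in> test_funs"
  shows "(\<lambda>x. \<phi> x + \<psi> x) \<in> test_funs"
proof -
  obtain K L where "compact K" "compact L" "\<forall>x. x \<notin> K \<longrightarrow> \<phi> x = 0" "\<forall>x. x \<notin> L \<longrightarrow> \<psi> x = 0"
    and s: "smooth \<phi>" "smooth \<psi>"
    using assms by (auto simp: test_funs_def)
  then have "compact (K \<union> L) \<and> (\<forall>x. x \<notin> K \<union> L \<longrightarrow> \<phi> x + \<psi> x = 0)" by auto
  moreover have "smooth (\<lambda>x. \<phi> x + \<psi> x)"
    using s unfolding smooth_def iter_partial_add[OF s] by auto
  ultimately show ?thesis unfolding test_funs_def by blast
qed

lemma test_funs_cmult: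
  assumes "\<phi> \<in> test_funs"
  shows "(\<lambda>x. c * \<phi> x) \<in> test_funs"
proof -
  obtain K where "compact K" "\<forall>x. x \<notin> K \<longrightarrow> \<phi> x = 0" and s: "smooth \<phi>"
    using assms by (auto simp: test_funs_def)
  then have "compact K \<and> (\<forall>x. x \<notin> K \<longrightarrow> c * \<phi> x = 0)" by auto
  moreover have "smooth (\<lambda>x. c * \<phi> x)"
    using s unfolding smooth_def iter_partial_cmult[OF s] by auto
  ultimately show ?thesis unfolding test_funs_def by blast
qed

lemma iter_partial_zero_off_compact:
  fixes \<phi> :: "real ^ 'n \<Rightarrow> real"
  assumes "compact K" "\<And>x. x \<notin> K \<Longrightarrow> \<phi> x = 0" "x \<notin> K"
  shows "iter_partial is \<phi> x = 0"
  using assms(3)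
proof (induction "is" arbitrary: x)
  case (Cons i "is")
  have "open (- K)" using assms(1) by (simp add: compact_imp_closed open_Compl)
  moreover have "((\<lambda>_. 0 :: real) has_derivative (\<lambda>_. 0)) (at x)" by simp
  ultimately have "(iter_partial is \<phi> has_derivative (\<lambda>_. 0)) (at x)"
    using Cons by (rule_tac has_derivative_transform_within_open[of "\<lambda>_. 0" _ _ _ "- K"]) auto
  from frechet_derivative_at[OF this] show ?case
    by (metis iter_partial.simps(2))
qed (use assms in simp)

lemma test_funs_bounded_partials:
  fixes \<phi> :: "real ^ 'n \<Rightarrow> real"
  assumes "\<phi> \<in> test_funs"
  obtains B where "\<And>is x. length is \<le> m \<Longrightarrow> \<bar>iter_partial is \<phi> x\<bar> \<le> B"
proof -
  obtain K where K: "compact K" "\<And>x. x \<notin> K \<Longrightarrow> \<phi> x = 0" and s: "smooth \<phi>"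
    using assms by (auto simp: test_funs_def)
  have "\<exists>B. \<forall>x. \<bar>iter_partial is \<phi> x\<bar> \<le> B" for "is"
  proof -
    have "continuous_on K (iter_partial is \<phi>)"
      using s by (intro differentiable_imp_continuous_on)
        (auto simp: differentiable_on_def smooth_def intro: differentiable_at_withinI)
    then have "bounded (iter_partial is \<phi> ` K)"
      using K(1) by (intro compact_imp_bounded compact_continuous_image)
    then obtain B where "\<forall>x\<in>K. \<bar>iter_partial is \<phi> x\<bar> \<le> B"
      by (auto simp: bounded_iff)
    then have "\<bar>iter_partial is \<phi> x\<bar> \<le> max B 0" for x
      using iter_partial_zero_off_compact[OF K] by (cases "x \<in> K") (auto simp: le_max_iff_disj)
    then show ?thesis by blast
  qed
  then obtain b where b: "\<And>is x. \<bar>iter_partial is \<phi> x\<bar> \<le> b is" by metis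
  let ?L = "{is :: 'n list. length is \<le> m}"
  have fin: "finite ?L" using finite_lists_length_le[of "UNIV :: 'n set" m] by simp
  show ?thesis
  proof (rule that)
    fix "is" :: "'n list" and x assume "length is \<le> m"
    then have "b is \<le> Max (b ` ?L)" using fin by (intro Max_ge) auto
    then show "\<bar>iter_partial is \<phi> x\<bar> \<le> Max (b ` ?L)" using b[of "is" x] by linarith
  qed
qed

section \<open>Series of atoms\<close>

text \<open>Special atoms satisfy the size condition of atoms only up to a constant, which is recorded as \<open>K\<close>.\<close>

definition atom_multiples :: "real \<Rightarrow> real \<Rightarrow> (real ^ 'n \<Rightarrow> real) set" where
  "atom_multiples p K = {a. (\<lambda>x. a x / K) \<in> atoms p}"

lemma atoms_eq_atom_multiples_1: "atoms p = atom_multiples p 1"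
  by (simp add: atom_multiples_def)

lemma atom_multiples_mono:
  fixes K K' :: real
  assumes K: "0 < K" "K \<le> K'"
  shows "(atom_multiples p K :: (real ^ 'n \<Rightarrow> real) set) \<subseteq> atom_multiples p K'"
proof
  fix a :: "real ^ 'n \<Rightarrow> real" assume "a \<in> atom_multiples p K"
  then obtain Q where Q: "is_atom p Q (\<lambda>x. a x / K)" by (auto simp: atom_multiples_def atoms_def)
  have eq: "a x / K' = (K / K') * (a x / K)" for x using K by simp
  have "is_atom p Q (\<lambda>x. (K / K') * (a x / K))"
    unfolding is_atom_iff
  proof (intro conjI)
    show "is_cube Q" using Q by (simp add: is_atom_iff)
    show "L2_on Q (\<lambda>x. (K / K') * (a x / K))"
      using Q square_integrable_cmult[of lebesgue "\<lambda>x. a x / K" "K / K'"] by (auto simp: is_atom_iff L2_on_iff)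
    show "vanishing_moments (nat \<lfloor>real CARD('n) * (1 / p - 1)\<rfloor>) (\<lambda>x. (K / K') * (a x / K))"
      using Q by (intro vanishing_moments_cmult) (simp add: is_atom_iff)
    have "(LINT x|lebesgue. ((K / K') * (a x / K))\<^sup>2) = (K / K')\<^sup>2 * (LINT x|lebesgue. (a x / K)\<^sup>2)"
      unfolding power_mult_distrib by (rule integral_mult_right_zero)
    also have "\<dots> \<le> 1 * (LINT x|lebesgue. (a x / K)\<^sup>2)"
      using K by (intro mult_right_mono power_le_one) auto
    also have "\<dots> \<le> measure lebesgue Q powr (1 - 2 / p)" using Q by (simp add: is_atom_iff)
    finally show "(LINT x|lebesgue. ((K / K') * (a x / K))\<^sup>2) \<le> measure lebesgue Q powr (1 - 2 / p)" .
  qed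
  then have "is_atom p Q (\<lambda>x. a x / K')" by (simp only: eq)
  then show "a \<in> atom_multiples p K'" by (auto simp: atom_multiples_def atoms_def)
qed

lemma L2_on_mult_test_integrable:
  assumes "L2_on Q h" "bounded Q" "\<phi> \<in> test_funs"
  shows "integrable lebesgue (\<lambda>x. h x * \<phi> x)"
  using assms
  by (intro L2_on_mult_continuous_integrable smooth_continuous_on) (auto simp: test_funs_def)

lemma atom_multiples_mult_test_integrable:
  assumes K: "0 < K" and a: "a \<in> atom_multiples p K" and \<phi>: "\<phi> \<in> test_funs"
  shows "integrable lebesgue (\<lambda>x. a x * \<phi> x)"
proof -
  obtain Q where Q: "is_atom p Q (\<lambda>x. a x / K)"
    using a by (auto simp: atom_multiples_def atoms_def)
  then have "integrable lebesgue (\<lambda>x. (a x / K) * \<phi> x)"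
    by (intro L2_on_mult_test_integrable[of Q, OF _ _ \<phi>]) (auto simp: is_atom_def is_cube_def)
  then show ?thesis
    using K integrable_mult_right[of K lebesgue "\<lambda>x. a x / K * \<phi> x"] by simp
qed

lemma dist_of_cmult: "dist_of (\<lambda>x. c * a x) \<phi> = c * dist_of a \<phi>"
  by (simp add: dist_of_def mult.assoc)

lemma dist_of_sum:
  assumes "\<And>i. i \<in> I \<Longrightarrow> integrable lebesgue (\<lambda>x. b i x * \<phi> x)"
  shows "dist_of (\<lambda>x. \<Sum>i\<in>I. b i x) \<phi> = (\<Sum>i\<in>I. dist_of (b i) \<phi>)"
  using assms by (simp add: dist_of_def sum_distrib_right Bochner_Integration.integral_sum)

lemma dist_of_cong_AE:
  assumes "AE x in lebesgue. a x = b x"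
    and "integrable lebesgue (\<lambda>x. a x * \<phi> x)" "integrable lebesgue (\<lambda>x. b x * \<phi> x)"
  shows "dist_of a \<phi> = dist_of b \<phi>"
proof -
  have "(LINT x|lebesgue. a x * \<phi> x) = (LINT x|lebesgue. b x * \<phi> x)"
    by (rule integral_cong_AE) (use assms in \<open>auto elim: eventually_mono\<close>)
  then show ?thesis by (simp add: dist_of_def)
qed

lemma atom_multiples_pairing_bound:
  fixes a \<phi> :: "real ^ 'n \<Rightarrow> real"
  assumes p: "0 < p" "p \<le> 1" and K: "0 < K" and a: "a \<in> atom_multiples p K"
    and \<phi>: "\<phi> \<in> test_funs" and m: "m = nat \<lfloor>real CARD('n) * (1 / p - 1)\<rfloor>"
    and bound: "\<And>is x. length is \<le> Suc m \<Longrightarrow> \<bar>iter_partial is \<phi> x\<bar> \<le> B"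
  shows "\<bar>dist_of a \<phi>\<bar> \<le> K * real CARD('n) ^ Suc m * B"
proof -
  obtain Q where "is_atom p Q (\<lambda>x. a x / K)"
    using a by (auto simp: atom_multiples_def atoms_def)
  from atom_pairing_bound[OF p this _ m bound]
  have "\<bar>dist_of (\<lambda>x. a x / K) \<phi>\<bar> \<le> real CARD('n) ^ Suc m * B"
    using \<phi> by (simp add: dist_of_def test_funs_def)
  moreover have "dist_of a \<phi> = K * dist_of (\<lambda>x. a x / K) \<phi>"
    using K dist_of_cmult[of K "\<lambda>x. a x / K"] by simp
  ultimately show ?thesis using K by (simp add: abs_mult)
qed

text \<open>The coefficients tend to zero, and \<open>\<bar>c j\<bar> \<le> \<bar>c j\<bar> powr p\<close> as soon as \<open>\<bar>c j\<bar> \<le> 1\<close>, because \<open>p \<le> 1\<close>.\<close>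

lemma summable_abs_of_summable_powr:
  fixes c :: "nat \<Rightarrow> real"
  assumes p: "0 < p" "p \<le> 1" and "summable (\<lambda>j. \<bar>c j\<bar> powr p)"
  shows "summable (\<lambda>j. \<bar>c j\<bar>)"
proof (rule summable_comparison_test_ev[OF _ assms(3)])
  have "eventually (\<lambda>j. \<bar>c j\<bar> powr p < 1) sequentially"
    using summable_LIMSEQ_zero[OF assms(3)] by (intro order_tendstoD) auto
  then show "eventually (\<lambda>j. norm \<bar>c j\<bar> \<le> \<bar>c j\<bar> powr p) sequentially"
  proof eventually_elim
    case (elim j)
    then have "\<bar>c j\<bar> \<le> 1"
      using p ge_one_powr_ge_zero[of "\<bar>c j\<bar>" p] by linarith
    then show ?case
      using p powr_mono'[of p 1 "\<bar>c j\<bar>"] by (cases "c j = 0") auto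
  qed
qed

lemma dist_decomp_iff_sums:
  "dist_decomp p A f c a \<longleftrightarrow> (\<forall>j. a j \<in> A) \<and> summable (\<lambda>j. \<bar>c j\<bar> powr p)
     \<and> (\<forall>\<phi>\<in>test_funs. (\<lambda>j. c j * dist_of (a j) \<phi>) sums f \<phi>)"
  by (simp add: dist_decomp_def partial_sum_def sums_def)

text \<open>The constant in front of \<open>B\<close> is the same for all test functions. This uniformity makes the sum
  of the series continuous.\<close>

lemma atom_series_abs_bound:
  fixes a :: "nat \<Rightarrow> real ^ 'n \<Rightarrow> real"
  assumes p: "0 < p" "p \<le> 1" and K: "0 < K" and a: "\<And>j. a j \<in> atom_multiples p K"
    and c: "summable (\<lambda>j. \<bar>c j\<bar> powr p)"
    and \<phi>: "\<phi> \<in> test_funs" and m: "m = nat \<lfloor>real CARD('n) * (1 / p - 1)\<rfloor>"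
    and bound: "\<And>is x. length is \<le> Suc m \<Longrightarrow> \<bar>iter_partial is \<phi> x\<bar> \<le> B"
  shows "summable (\<lambda>j. c j * dist_of (a j) \<phi>)"
    and "\<bar>\<Sum>j. c j * dist_of (a j) \<phi>\<bar> \<le> (\<Sum>j. \<bar>c j\<bar>) * (K * real CARD('n) ^ Suc m) * B"
proof -
  let ?C = "K * real CARD('n) ^ Suc m"
  have le: "\<bar>c j * dist_of (a j) \<phi>\<bar> \<le> \<bar>c j\<bar> * (?C * B)" for j
    unfolding abs_mult
    using atom_multiples_pairing_bound[OF p K a \<phi> m bound] by (intro mult_left_mono) auto
  have s: "summable (\<lambda>j. \<bar>c j\<bar>)" by (rule summable_abs_of_summable_powr[OF p c])
  have sC: "summable (\<lambda>j. \<bar>c j\<bar> * (?C * B))" using s by (rule summable_mult2)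
  have sabs: "summable (\<lambda>j. \<bar>c j * dist_of (a j) \<phi>\<bar>)"
    by (rule summable_comparison_test'[OF sC]) (use le in auto)
  then show "summable (\<lambda>j. c j * dist_of (a j) \<phi>)" by (rule summable_rabs_cancel)
  have "\<bar>\<Sum>j. c j * dist_of (a j) \<phi>\<bar> \<le> (\<Sum>j. \<bar>c j * dist_of (a j) \<phi>\<bar>)"
    by (rule summable_rabs[OF sabs])
  also have "\<dots> \<le> (\<Sum>j. \<bar>c j\<bar> * (?C * B))" by (rule suminf_le[OF le sabs sC])
  also have "\<dots> = (\<Sum>j. \<bar>c j\<bar>) * ?C * B" using suminf_mult2[OF s, of "?C * B"] by (simp add: mult_ac)
  finally show "\<bar>\<Sum>j. c j * dist_of (a j) \<phi>\<bar> \<le> (\<Sum>j. \<bar>c j\<bar>) * ?C * B" .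
qed

lemma atom_series_sums:
  fixes a :: "nat \<Rightarrow> real ^ 'n \<Rightarrow> real"
  assumes "0 < p" "p \<le> 1" "0 < K" "\<And>j. a j \<in> atom_multiples p K"
    "summable (\<lambda>j. \<bar>c j\<bar> powr p)" and \<phi>: "\<phi> \<in> test_funs"
  shows "(\<lambda>j. c j * dist_of (a j) \<phi>) sums (\<Sum>j. c j * dist_of (a j) \<phi>)"
proof -
  obtain B where "\<And>is x. length is \<le> Suc (nat \<lfloor>real CARD('n) * (1 / p - 1)\<rfloor>) \<Longrightarrow>
      \<bar>iter_partial is \<phi> x\<bar> \<le> B"
    using test_funs_bounded_partials[OF \<phi>] by blast
  from atom_series_abs_bound(1)[OF assms refl this] show ?thesis
    by (rule summable_sums)
qed

lemma dist_decomp_imp_distribution: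
  fixes f :: "'n::finite functional"
  assumes p: "0 < p" "p \<le> 1" and K: "0 < K" and A: "A \<subseteq> atom_multiples p K"
    and f: "dist_decomp p A f c a" and off: "\<And>\<phi>. \<phi> \<notin> test_funs \<Longrightarrow> f \<phi> = 0"
  shows "f \<in> distributions"
proof -
  define m where "m = nat \<lfloor>real CARD('n) * (1 / p - 1)\<rfloor>"
  have a: "\<And>j. a j \<in> atom_multiples p K" and c: "summable (\<lambda>j. \<bar>c j\<bar> powr p)"
    and sums: "\<And>\<phi>. \<phi> \<in> test_funs \<Longrightarrow> (\<lambda>j. c j * dist_of (a j) \<phi>) sums f \<phi>"
    using f A by (auto simp: dist_decomp_iff_sums)
  have int: "integrable lebesgue (\<lambda>x. a j x * \<phi> x)" if "\<phi> \<in> test_funs" for j \<phi>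
    by (rule atom_multiples_mult_test_integrable[OF K a that])
  have add: "f (\<lambda>x. \<phi> x + \<psi> x) = f \<phi> + f \<psi>" if "\<phi> \<in> test_funs" "\<psi> \<in> test_funs" for \<phi> \<psi>
  proof -
    have "dist_of (a j) (\<lambda>x. \<phi> x + \<psi> x) = dist_of (a j) \<phi> + dist_of (a j) \<psi>" for j
      using that test_funs_add[OF that] int by (simp add: dist_of_def distrib_left)
    then have "(\<lambda>j. c j * dist_of (a j) (\<lambda>x. \<phi> x + \<psi> x)) sums (f \<phi> + f \<psi>)"
      using sums_add[OF sums[OF that(1)] sums[OF that(2)]] by (simp add: distrib_left)
    then show ?thesis using sums[OF test_funs_add[OF that]] sums_unique2 by blast
  qed
  have cmult: "f (\<lambda>x. u * \<phi> x) = u * f \<phi>" if "\<phi> \<in> test_funs" for \<phi> u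
  proof -
    have "dist_of (a j) (\<lambda>x. u * \<phi> x) = u * dist_of (a j) \<phi>" for j
      using that test_funs_cmult[OF that] by (simp add: dist_of_def mult.left_commute)
    then have "(\<lambda>j. c j * dist_of (a j) (\<lambda>x. u * \<phi> x)) sums (u * f \<phi>)"
      using sums_mult[OF sums[OF that], of u] by (simp add: mult.left_commute)
    then show ?thesis using sums[OF test_funs_cmult[OF that]] sums_unique2 by blast
  qed
  have cont: "\<bar>f \<phi>\<bar> \<le> (\<Sum>j. \<bar>c j\<bar>) * (K * real CARD('n) ^ Suc m) * B"
    if "\<phi> \<in> test_funs" "\<forall>is x. length is \<le> Suc m \<longrightarrow> \<bar>iter_partial is \<phi> x\<bar> \<le> B" for \<phi> B
    using atom_series_abs_bound(2)[OF p K a c that(1) m_def] that(2) sums_unique[OF sums[OF that(1)]]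
    by auto
  show ?thesis
    unfolding distributions_def mem_Collect_eq
  proof (intro conjI allI impI)
    show "\<exists>C m. \<forall>\<phi>\<in>test_funs. (\<forall>x. x \<notin> L \<longrightarrow> \<phi> x = 0) \<longrightarrow>
        (\<forall>B. (\<forall>is x. length is \<le> m \<longrightarrow> \<bar>iter_partial is \<phi> x\<bar> \<le> B) \<longrightarrow> \<bar>f \<phi>\<bar> \<le> C * B)" for L
      using cont by (intro exI ballI impI allI) assumption
  qed (use off add cmult in auto)
qed

lemma dist_decomp_rescale:
  assumes K: "0 < K" and A: "A \<subseteq> atom_multiples p K" and f: "dist_decomp p A f c a"
  shows "dist_decomp p (atoms p) f (\<lambda>j. K * c j) (\<lambda>j x. a j x / K)"
proof -
  have "summable (\<lambda>j. \<bar>K * c j\<bar> powr p)"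
    using f K summable_mult[of "\<lambda>j. \<bar>c j\<bar> powr p" "K powr p"]
    by (simp add: dist_decomp_iff_sums abs_mult powr_mult)
  moreover have "dist_of (\<lambda>x. a j x / K) \<phi> = dist_of (a j) \<phi> / K" for j \<phi>
    using dist_of_cmult[of "1 / K" "a j" \<phi>] by simp
  moreover have "(\<lambda>x. a j x / K) \<in> atoms p" for j
    using f A by (auto simp: dist_decomp_iff_sums atom_multiples_def)
  ultimately show ?thesis using f K by (simp add: dist_decomp_iff_sums)
qed

lemma coeff_size_cmult:
  assumes "0 < p" "0 \<le> K" "summable (\<lambda>j. \<bar>c j\<bar> powr p)"
  shows "coeff_size p (\<lambda>j. K * c j) = ennreal K * coeff_size p c"
proof -
  have "(\<Sum>j. \<bar>K * c j\<bar> powr p) = K powr p * (\<Sum>j. \<bar>c j\<bar> powr p)"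
    using assms suminf_mult[OF assms(3), of "K powr p"] by (simp add: abs_mult powr_mult)
  moreover have "0 \<le> (\<Sum>j. \<bar>c j\<bar> powr p)" using assms by (intro suminf_nonneg) auto
  ultimately show ?thesis
    using assms by (simp add: coeff_size_def powr_mult powr_powr ennreal_mult)
qed

lemma coeff_size_tail_tendsto_0:
  assumes p: "0 < p" and c: "summable (\<lambda>j. \<bar>c j\<bar> powr p)"
  shows "(\<lambda>n. coeff_size p (\<lambda>j. c (j + n))) \<longlonglongrightarrow> 0"
proof -
  have "(\<lambda>n. (\<Sum>j. \<bar>c j\<bar> powr p) - (\<Sum>j<n. \<bar>c j\<bar> powr p)) \<longlonglongrightarrow>
      (\<Sum>j. \<bar>c j\<bar> powr p) - (\<Sum>j. \<bar>c j\<bar> powr p)"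
    by (intro tendsto_intros summable_LIMSEQ c)
  moreover have "(\<lambda>n. (\<Sum>j. \<bar>c j\<bar> powr p) - (\<Sum>j<n. \<bar>c j\<bar> powr p)) = (\<lambda>n. \<Sum>j. \<bar>c (j + n)\<bar> powr p)"
  proof
    show "(\<Sum>j. \<bar>c j\<bar> powr p) - (\<Sum>j<n. \<bar>c j\<bar> powr p) = (\<Sum>j. \<bar>c (j + n)\<bar> powr p)" for n
      using suminf_split_initial_segment[OF c, of n] by simp
  qed
  ultimately have tail: "(\<lambda>n. \<Sum>j. \<bar>c (j + n)\<bar> powr p) \<longlonglongrightarrow> 0" by simp
  have nonneg: "0 \<le> (\<Sum>j. \<bar>c (j + n)\<bar> powr p)" for n
    using summable_ignore_initial_segment[OF c, of n] by (intro suminf_nonneg) auto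
  have "(\<lambda>n. (\<Sum>j. \<bar>c (j + n)\<bar> powr p) powr (1 / p)) \<longlonglongrightarrow> 0 powr (1 / p)"
    using p nonneg by (intro tendsto_powr' tail tendsto_const) auto
  then have "(\<lambda>n. ennreal ((\<Sum>j. \<bar>c (j + n)\<bar> powr p) powr (1 / p))) \<longlonglongrightarrow> ennreal (0 powr (1 / p))"
    by (rule tendsto_ennrealI)
  then show ?thesis by (simp add: coeff_size_def)
qed

text \<open>The tail of a decomposition of \<open>f\<close> is a decomposition of the difference between \<open>f\<close> and the partial
  sum. The atomic gauge of this difference is therefore at most a multiple of the size of the tail of
  the coefficients. So convergence as distributions already implies convergence in \<open>H\<^sup>p\<close>.\<close>

lemma dist_decomp_imp_atomic_decomp:
  assumes p: "0 < p" and K: "0 < K" and A: "A \<subseteq> atom_multiples p K"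
    and f: "dist_decomp p A f c a"
  shows "atomic_decomp p A f c a"
proof -
  have c: "summable (\<lambda>j. \<bar>c j\<bar> powr p)" using f by (simp add: dist_decomp_def)
  have le: "hardy_gauge p (\<lambda>\<phi>. f \<phi> - partial_sum c a n \<phi>)
      \<le> ennreal K * coeff_size p (\<lambda>j. c (j + n))" for n
  proof -
    have cn: "summable (\<lambda>j. \<bar>c (j + n)\<bar> powr p)"
      using summable_ignore_initial_segment[OF c, of n] by simp
    have "dist_decomp p A (\<lambda>\<phi>. f \<phi> - partial_sum c a n \<phi>) (\<lambda>j. c (j + n)) (\<lambda>j. a (j + n))"
      using f cn sums_split_initial_segment[of "\<lambda>j. c j * dist_of (a j) _" _ n]
      by (auto simp: dist_decomp_iff_sums partial_sum_def)
    from dist_decomp_rescale[OF K A this]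
    have "hardy_gauge p (\<lambda>\<phi>. f \<phi> - partial_sum c a n \<phi>) \<le> coeff_size p (\<lambda>j. K * c (j + n))"
      unfolding hardy_gauge_def by (intro Inf_lower) blast
    then show ?thesis using coeff_size_cmult[OF p _ cn, of K] K by simp
  qed
  have lim: "(\<lambda>n. ennreal K * coeff_size p (\<lambda>j. c (j + n))) \<longlonglongrightarrow> ennreal K * 0"
    by (intro ennreal_tendsto_cmult coeff_size_tail_tendsto_0 p c) simp
  have "(\<lambda>n. hardy_gauge p (\<lambda>\<phi>. f \<phi> - partial_sum c a n \<phi>)) \<longlonglongrightarrow> 0"
    by (rule tendsto_sandwich[OF _ _ tendsto_const]) (use le lim in auto)
  then show ?thesis using f by (simp add: atomic_decomp_def)
qed

lemma dist_decomp_imp_atomic_subspace: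
  assumes p: "0 < p" "p \<le> 1" and K: "0 < K" and A: "A \<subseteq> atom_multiples p K"
    and f: "dist_decomp p A f c a" and off: "\<And>\<phi>. \<phi> \<notin> test_funs \<Longrightarrow> f \<phi> = 0"
  shows "f \<in> hardy_space p" "f \<in> atomic_subspace p A"
proof -
  have "atomic_decomp p (atoms p) f (\<lambda>j. K * c j) (\<lambda>j x. a j x / K)"
    using dist_decomp_imp_atomic_decomp[OF p(1) zero_less_one _ dist_decomp_rescale[OF K A f]]
    by (simp add: atoms_eq_atom_multiples_1)
  then show h: "f \<in> hardy_space p"
    using dist_decomp_imp_distribution[OF p K A f off] by (auto simp: hardy_space_def)
  show "f \<in> atomic_subspace p A"
    using h dist_decomp_imp_atomic_decomp[OF p(1) K A f] by (auto simp: atomic_subspace_def)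
qed

text \<open>Each residue class modulo \<open>R\<close> carries one of the \<open>R\<close> series, and the interleaved series is the sum
  of its restrictions to these classes.\<close>

lemma sums_interleave:
  fixes x :: "nat \<Rightarrow> nat \<Rightarrow> 'a::real_normed_vector"
  assumes R: "0 < R" and x: "\<And>r. r < R \<Longrightarrow> (\<lambda>j. x j r) sums s r"
  shows "(\<lambda>n. x (n div R) (n mod R)) sums (\<Sum>r<R. s r)"
proof -
  have "(\<lambda>n. if n mod R = r then x (n div R) r else 0) sums s r" if r: "r < R" for r
  proof -
    have "strict_mono (\<lambda>j. j * R + r)" using R by (auto simp: strict_mono_def)
    moreover have "(if n mod R = r then x (n div R) r else 0) = 0"
      if "n \<notin> range (\<lambda>j. j * R + r)" for n
    proof -
      have "n \<in> range (\<lambda>j. j * R + r)" if "n mod R = r"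
        by (rule range_eqI[of _ _ "n div R"]) (use that div_mult_mod_eq[of n R] in simp)
      then have "n mod R \<noteq> r" using that by blast
      then show ?thesis by simp
    qed
    ultimately have "(\<lambda>j. if (j * R + r) mod R = r then x ((j * R + r) div R) r else 0) sums s r
        \<longleftrightarrow> (\<lambda>n. if n mod R = r then x (n div R) r else 0) sums s r"
      by (rule sums_mono_reindex)
    then show ?thesis using x[OF r] r by simp
  qed
  then have "(\<lambda>n. \<Sum>r<R. if n mod R = r then x (n div R) r else 0) sums (\<Sum>r<R. s r)"
    by (intro sums_sum) auto
  then show ?thesis using R by (simp add: sum.delta)
qed

lemma dist_decomp_interleave:
  assumes R: "0 < R"
    and f: "\<And>r. r < R \<Longrightarrow> dist_decomp p A (f r) (\<lambda>j. c j r) (\<lambda>j. a j r)"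
  shows "dist_decomp p A (\<lambda>\<phi>. \<Sum>r<R. f r \<phi>)
      (\<lambda>n. c (n div R) (n mod R)) (\<lambda>n. a (n div R) (n mod R))"
    and "(\<Sum>n. \<bar>c (n div R) (n mod R)\<bar> powr p) = (\<Sum>r<R. \<Sum>j. \<bar>c j r\<bar> powr p)"
proof -
  have "(\<lambda>n. \<bar>c (n div R) (n mod R)\<bar> powr p) sums (\<Sum>r<R. \<Sum>j. \<bar>c j r\<bar> powr p)"
    using f by (intro sums_interleave[OF R, of "\<lambda>j r. \<bar>c j r\<bar> powr p"] summable_sums)
      (auto simp: dist_decomp_iff_sums)
  then show "(\<Sum>n. \<bar>c (n div R) (n mod R)\<bar> powr p) = (\<Sum>r<R. \<Sum>j. \<bar>c j r\<bar> powr p)"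
    and "dist_decomp p A (\<lambda>\<phi>. \<Sum>r<R. f r \<phi>)
      (\<lambda>n. c (n div R) (n mod R)) (\<lambda>n. a (n div R) (n mod R))"
    using f R sums_interleave[OF R, of "\<lambda>j r. c j r * dist_of (a j r) _"]
    by (auto simp: dist_decomp_iff_sums sums_iff)
qed

section \<open>Half-open dyadic cubes\<close>

text \<open>The \<open>2\<^sup>N\<close> dyadic cubes that share a lattice point are obtained from each other by these offsets.\<close>

definition corners :: "('n::finite \<Rightarrow> int) set" where
  "corners = {\<epsilon>. \<forall>i. \<epsilon> i \<in> {0, 1}}"

text \<open>Half-open cubes are disjoint, so that functions can be cut along them by identities that hold at
  every point; the closed dyadic cubes overlap in their faces.\<close>

definition half_open_cube :: "real \<Rightarrow> ('n \<Rightarrow> int) \<Rightarrow> (real ^ 'n) set" where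
  "half_open_cube s k = {x. \<forall>i. (of_int (k i) - 1) * s \<le> x $ i \<and> x $ i < of_int (k i) * s}"

lemma finite_corners [simp]: "finite (corners :: ('n::finite \<Rightarrow> int) set)"
proof -
  have "(corners :: ('n \<Rightarrow> int) set) = UNIV \<rightarrow>\<^sub>E {0, 1}"
    by (auto simp: corners_def PiE_def Pi_def)
  moreover have "finite ((UNIV :: 'n set) \<rightarrow>\<^sub>E {0, 1 :: int})" by (intro finite_PiE) auto
  ultimately show ?thesis by (simp only:)
qed

lemma zero_in_corners: "(\<lambda>_. 0) \<in> corners"
  by (auto simp: corners_def)

lemma half_open_cube_subset_dyadic: "half_open_cube (2 powi n) k \<subseteq> dyadic_cube n k"
  by (auto simp: half_open_cube_def dyadic_cube_def mem_box_cart less_imp_le)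

lemma bounded_half_open_cube: "bounded (half_open_cube s k :: (real ^ 'n) set)"
proof (rule bounded_subset[OF bounded_cbox])
  show "half_open_cube s k \<subseteq> cbox (\<chi> i. (of_int (k i) - 1) * s) (\<chi> i. of_int (k i) * s)"
    by (auto simp: half_open_cube_def mem_box_cart less_imp_le)
qed

lemma half_open_cube_sets: "half_open_cube s k \<in> sets lebesgue"
proof -
  have "half_open_cube s k = cbox (\<chi> i. (of_int (k i) - 1) * s) (\<chi> i. of_int (k i) * s)
      \<inter> (\<Inter>i\<in>UNIV. {x. x $ i < of_int (k i) * s})"
    by (auto simp: half_open_cube_def mem_box_cart less_imp_le)
  moreover have "open (\<Inter>i\<in>(UNIV :: 'a set). {x :: real ^ 'a. x $ i < of_int (k i) * s})"
    by (intro open_INT ballI open_halfspace_component_lt_cart) auto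
  ultimately show ?thesis by (simp add: lmeasurable_open borel_open sets.Int)
qed

lemma half_open_cube_unique:
  assumes "x \<in> half_open_cube s k" "x \<in> half_open_cube s k'" "s > 0"
  shows "k = k'"
proof
  fix i
  have "(of_int (k i) - 1) * s < of_int (k' i) * s" "(of_int (k' i) - 1) * s < of_int (k i) * s"
    using assms unfolding half_open_cube_def mem_Collect_eq by (meson le_less_trans)+
  then have "of_int (k i) - 1 < (of_int (k' i) :: real)" "of_int (k' i) - 1 < (of_int (k i) :: real)"
    using assms(3) by auto
  then show "k i = k' i" by linarith
qed

lemma sum_indicator_half_open_cubes:
  fixes x :: "real ^ 'n" and g :: "('n \<Rightarrow> int) \<Rightarrow> real"
  assumes s: "s > 0" and \<epsilon>: "\<epsilon> \<in> corners" "x \<in> half_open_cube s (\<lambda>i. k i + \<epsilon> i)"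
  shows "(\<Sum>\<delta>\<in>corners. indicator (half_open_cube s (\<lambda>i. k i + \<delta> i)) x * g \<delta>) = g \<epsilon>"
proof -
  have "indicator (half_open_cube s (\<lambda>i. k i + \<delta> i)) x * g \<delta> = (if \<delta> = \<epsilon> then g \<epsilon> else 0)" for \<delta>
  proof (cases "x \<in> half_open_cube s (\<lambda>i. k i + \<delta> i)")
    case True
    from half_open_cube_unique[OF True \<epsilon>(2) s] have "\<delta> = \<epsilon>" by (auto simp: fun_eq_iff)
    then show ?thesis using True by simp
  qed (use \<epsilon> in auto)
  then show ?thesis using \<epsilon> by simp
qed

lemma dyadic_scale_exists:
  fixes l :: real
  assumes "l > 0"
  obtains n :: int where "l \<le> 2 powi n" "2 powi n < 2 * l"
proof
  let ?n = "\<lceil>log 2 l\<rceil>"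
  have e: "2 powi ?n = 2 powr ?n" by (simp add: powr_real_of_int')
  have "2 powr (log 2 l) \<le> 2 powr ?n" by (intro powr_mono) auto
  then show "l \<le> 2 powi ?n" using assms e by simp
  have "2 powr ?n < 2 powr (log 2 l + 1)" by (intro powr_less_mono) linarith+
  then show "2 powi ?n < 2 * l" using assms e by (simp add: powr_add)
qed

text \<open>The central lattice point of the block is the first one strictly above the lower corner \<open>c\<close> in each
  coordinate. The cube then extends by less than \<open>l \<le> s\<close> beyond this point.\<close>

lemma cube_in_dyadic_block:
  fixes c :: "real ^ 'n"
  assumes s: "s > 0" and l: "l \<le> s"
  obtains k where
    "\<And>x. x \<in> cbox c (\<chi> i. c $ i + l) \<Longrightarrow> \<exists>\<epsilon>\<in>corners. x \<in> half_open_cube s (\<lambda>i. k i + \<epsilon> i)"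
proof
  let ?k = "\<lambda>i. \<lfloor>c $ i / s\<rfloor> + 1"
  fix x assume x: "x \<in> cbox c (\<chi> i. c $ i + l)"
  let ?\<epsilon> = "\<lambda>i. if x $ i < of_int (?k i) * s then 0 else 1 :: int"
  have k1: "of_int (?k i) * s - s \<le> c $ i" for i
  proof -
    have "of_int (\<lfloor>c $ i / s\<rfloor>) * s \<le> (c $ i / s) * s" using s by (intro mult_right_mono) auto
    then show ?thesis using s by (simp add: algebra_simps)
  qed
  have k2: "c $ i < of_int (?k i) * s" for i
  proof -
    have "(c $ i / s) * s < (of_int (\<lfloor>c $ i / s\<rfloor>) + 1) * s" using s by (intro mult_strict_right_mono) linarith+
    then show ?thesis using s by simp
  qed
  have x': "c $ i \<le> x $ i" "x $ i \<le> c $ i + l" for i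
    using x by (auto simp: mem_box_cart)
  have "x \<in> half_open_cube s (\<lambda>i. ?k i + ?\<epsilon> i)"
    unfolding half_open_cube_def mem_Collect_eq
  proof
    fix i
    show "(of_int (?k i + ?\<epsilon> i) - 1) * s \<le> x $ i \<and> x $ i < of_int (?k i + ?\<epsilon> i) * s"
      using k1[of i] k2[of i] x'[of i] l by (auto simp: algebra_simps)
  qed
  moreover have "?\<epsilon> \<in> corners" by (auto simp: corners_def)
  ultimately show "\<exists>\<epsilon>\<in>corners. x \<in> half_open_cube s (\<lambda>i. ?k i + \<epsilon> i)"
    by (intro bexI[of _ ?\<epsilon>])
qed

section \<open>Projection onto polynomials\<close>

text \<open>The orthogonality of the remainder to all monomials on \<open>H\<close> is exactly the vanishing of its
  moments, and the Pythagorean identity bounds both parts by the norm of \<open>a\<close> on \<open>H\<close>.\<close>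

lemma polynomial_projection:
  fixes a :: "real ^ 'n \<Rightarrow> real"
  assumes a: "square_integrable lebesgue a" and H: "H \<in> sets lebesgue" "bounded H"
  obtains q where "q \<in> polys_upto m"
    and "L2_on H (\<lambda>x. indicator H x * (a x - q x))"
    and "L2_on H (\<lambda>x. indicator H x * q x)"
    and "vanishing_moments m (\<lambda>x. indicator H x * (a x - q x))"
    and "(LINT x|lebesgue. (indicator H x * (a x - q x))\<^sup>2) + (LINT x|lebesgue. (indicator H x * q x)\<^sup>2)
      = (LINT x|lebesgue. (indicator H x * a x)\<^sup>2)"
proof -
  let ?I = "multi_indices m :: ('n \<Rightarrow> nat) set"
  let ?i = "indicator H :: _ \<Rightarrow> real"
  have sqp: "square_integrable lebesgue (\<lambda>x. ?i x * r x)" if "continuous_on UNIV r" for r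
    by (rule square_integrable_continuous_indicator[OF that H])
  have sqa: "square_integrable lebesgue (\<lambda>x. ?i x * a x)"
  proof -
    have m: "(\<lambda>x. ?i x * a x) \<in> borel_measurable lebesgue"
      using square_integrableD[OF a] H by simp
    have "integrable lebesgue (\<lambda>x. (?i x * a x)\<^sup>2)"
      by (rule Bochner_Integration.integrable_bound[OF square_integrableD(2)[OF a]])
        (use m in \<open>auto simp: indicator_def\<close>)
    with m show ?thesis by (simp add: square_integrable_def)
  qed
  obtain c where c: "\<forall>\<beta>\<in>?I. (LINT x|lebesgue.
      (?i x * a x - (\<Sum>\<gamma>\<in>?I. c \<gamma> * (?i x * monomial \<gamma> x))) * (?i x * monomial \<beta> x)) = 0"
    using orthogonal_projection_exists[of ?I lebesgue "\<lambda>\<beta> x. ?i x * monomial \<beta> x" "\<lambda>x. ?i x * a x"]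
      sqp[OF continuous_on_monomial] sqa by auto
  define q where "q = (\<lambda>x. \<Sum>\<gamma>\<in>?I. c \<gamma> * monomial \<gamma> x)"
  have q: "q \<in> polys_upto m" unfolding q_def polys_upto_def by blast
  have sqq: "square_integrable lebesgue (\<lambda>x. ?i x * q x)"
    by (intro sqp continuous_on_polys_upto[OF q])
  have Lq: "L2_on H (\<lambda>x. ?i x * q x)" using sqq by (simp add: L2_on_iff)
  have Ld: "L2_on H (\<lambda>x. ?i x * (a x - q x))"
    using square_integrable_diff[OF sqa sqq] by (simp add: L2_on_iff right_diff_distrib)
  have pull: "(?i x * a x - (\<Sum>\<gamma>\<in>?I. c \<gamma> * (?i x * monomial \<gamma> x))) = ?i x * (a x - q x)" for x
    by (simp add: q_def right_diff_distrib sum_distrib_left mult_ac)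
  have van: "vanishing_moments m (\<lambda>x. ?i x * (a x - q x))"
    unfolding vanishing_moments_def
  proof
    fix \<beta> assume "\<beta> \<in> ?I"
    with c have "(LINT x|lebesgue. ?i x * (a x - q x) * (?i x * monomial \<beta> x)) = 0"
      by (simp add: pull)
    moreover have "?i x * (a x - q x) * (?i x * monomial \<beta> x) = ?i x * (a x - q x) * monomial \<beta> x" for x
      by (auto simp: indicator_def)
    ultimately show "(LINT x|lebesgue. ?i x * (a x - q x) * monomial \<beta> x) = 0" by simp
  qed
  then have "(LINT x|lebesgue. ?i x * (a x - q x) * q x) = 0"
    using vanishing_moments_iff_polys[OF Ld H(2)] q by blast
  moreover have "?i x * (a x - q x) * (?i x * q x) = ?i x * (a x - q x) * q x" for x
    by (auto simp: indicator_def)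
  ultimately have orth: "(LINT x|lebesgue. ?i x * (a x - q x) * (?i x * q x)) = 0"
    by (simp only:)
  have ints: "integrable lebesgue (\<lambda>x. (?i x * (a x - q x))\<^sup>2)"
    "integrable lebesgue (\<lambda>x. (?i x * q x)\<^sup>2)"
    "integrable lebesgue (\<lambda>x. ?i x * (a x - q x) * (?i x * q x))"
    using Ld Lq by (auto intro!: square_integrableD(2) square_integrable_mult simp: L2_on_iff)
  have "(LINT x|lebesgue. (?i x * a x)\<^sup>2) = (LINT x|lebesgue.
      (?i x * (a x - q x))\<^sup>2 + (?i x * q x)\<^sup>2 + 2 * (?i x * (a x - q x) * (?i x * q x)))"
    by (intro Bochner_Integration.integral_cong) (auto simp: indicator_def power2_eq_square algebra_simps)
  also have "\<dots> = (LINT x|lebesgue. (?i x * (a x - q x))\<^sup>2) + (LINT x|lebesgue. (?i x * q x)\<^sup>2)"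
    using ints orth by simp
  finally show ?thesis using that[OF q Ld Lq van] by simp
qed

section \<open>Special atoms\<close>

lemma AE_affine:
  fixes t :: "'a::euclidean_space"
  assumes s: "s \<noteq> 0" and ae: "AE x in lebesgue. Q x"
  shows "AE x in lebesgue. Q (s *\<^sub>R x + t)"
proof -
  let ?T = "\<lambda>x::'a. s *\<^sub>R x + t"
  have "AE x in density (distr lebesgue lebesgue ?T) (\<lambda>_. ennreal (\<bar>s\<bar> ^ DIM('a))). Q x"
    using ae arg_cong[OF affine_lebesgue_density[OF s, of t], of "\<lambda>\<nu>. AE x in \<nu>. Q x"] by blast
  then have "AE x in distr lebesgue lebesgue ?T. Q x"
    using s by (subst (asm) AE_density) auto
  then show ?thesis
    by (rule AE_distrD[OF affine_lebesgue_measurable[OF s, of t]])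
qed

lemma vanishing_moments_affine:
  fixes h :: "real ^ 'n \<Rightarrow> real"
  assumes s: "s \<noteq> 0" and h: "L2_on Q h" "bounded Q" and v: "vanishing_moments m h"
  shows "vanishing_moments m (\<lambda>x. h (s *\<^sub>R x + t))"
  unfolding vanishing_moments_def
proof
  fix \<beta> :: "'n \<Rightarrow> nat" assume \<beta>: "\<beta> \<in> multi_indices m"
  define r where "r = (\<lambda>x. monomial \<beta> ((1 / s) *\<^sub>R x + (- (1 / s)) *\<^sub>R t))"
  have r: "r \<in> polys_upto m" unfolding r_def by (rule monomial_affine_mem_polys_upto[OF \<beta>])
  have rT: "r (s *\<^sub>R x + t) = monomial \<beta> x" for x
    using s by (simp add: r_def algebra_simps)
  have int: "integrable lebesgue (\<lambda>x. h x * r x)"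
    by (intro L2_on_mult_continuous_integrable[OF h] continuous_on_polys_upto[OF r])
  have "0 = (LINT x|lebesgue. h x * r x)"
    using v vanishing_moments_iff_polys[OF h] r by simp
  also have "\<dots> = \<bar>s\<bar> ^ CARD('n) * (LINT x|lebesgue. h (s *\<^sub>R x + t) * monomial \<beta> x)"
    using integral_affine[OF s, of "\<lambda>x. h x * r x" t] int by (simp add: rT)
  finally show "(LINT x|lebesgue. h (s *\<^sub>R x + t) * monomial \<beta> x) = 0" using s by simp
qed

lemma special_atom_eq:
  "special_atom \<alpha> q n k x =
    2 powr (of_int n * (real CARD('n) + \<alpha>)) * q (2 powi n *\<^sub>R x + (\<chi> i. of_int (k i)))"
  for x :: "real ^ 'n"
proof -
  have "(\<chi> i. 2 powi n * x $ i + of_int (k i)) = 2 powi n *\<^sub>R x + (\<chi> i. of_int (k i))"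
    by (simp add: vec_eq_iff)
  then show ?thesis by (simp add: special_atom_def)
qed

lemma Q0_affine_preimage:
  fixes t :: "real ^ 'n"
  assumes "s > 0"
  defines "c \<equiv> \<chi> i. (- 1 - t $ i) / s"
  shows "s *\<^sub>R x + t \<in> Q0 \<longleftrightarrow> x \<in> cbox c (\<chi> i. c $ i + 2 / s)"
  using assms by (auto simp: Q0_def mem_box_cart field_simps)

text \<open>The factor \<open>2 powr (n * (N + \<alpha>))\<close> of a special atom, squared, times the factor \<open>2 powr (- n * N)\<close> by which
  the dilation changes the integral of the square, is the power of the dilation that the size condition
  of an atom prescribes. Hence the constant does not depend on \<open>n\<close>; it accounts for the side 2 of \<open>Q0\<close>.\<close>

lemma special_atoms_subset_atom_multiples:
  fixes P :: "nat \<Rightarrow> real ^ 'n \<Rightarrow> real"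
  assumes p: "0 < p" "p \<le> 1" and \<alpha>: "\<alpha> = real CARD('n) * (1 / p - 1)"
    and P: "orthonormal_basis (piecewise_polys (nat \<lfloor>\<alpha>\<rfloor>)) M P"
  shows "special_atoms \<alpha> M P \<subseteq> atom_multiples p (2 powr (real CARD('n) * (1 / p - 1 / 2)))"
proof
  fix a assume "a \<in> special_atoms \<alpha> M P"
  then obtain L n k where L: "L \<in> {1..M}" and a: "a = special_atom \<alpha> (P L) n k"
    by (auto simp: special_atoms_def)
  let ?N = "real CARD('n)"
  define K where "K = 2 powr (?N * (1 / p - 1 / 2))"
  define s :: real where "s = 2 powi n"
  define t :: "real ^ 'n" where "t = (\<chi> i. of_int (k i))"
  define c where "c = (\<chi> i. (- 1 - t $ i) / s)"
  define u where "u = s powr (?N + \<alpha>) / K"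
  have s: "s > 0" by (simp add: s_def)
  have s_powr: "2 powr (of_int n * x) = s powr x" for x
    unfolding s_def by (simp add: powr_powr flip: powr_real_of_int')
  have K: "K > 0" by (simp add: K_def)
  have aK: "a x / K = u * P L (s *\<^sub>R x + t)" for x
    by (simp add: a special_atom_eq s_powr u_def flip: s_def t_def)
  have PL: "L2_on Q0 (P L)" "vanishing_moments (nat \<lfloor>\<alpha>\<rfloor>) (P L)"
    and norm: "(LINT x:Q0|lebesgue. P L x * P L x) = 1"
    using P L by (auto simp: orthonormal_basis_def piecewise_polys_def)
  have bQ0: "bounded Q0" by (simp add: Q0_def)
  have sq: "square_integrable lebesgue (P L)" by (rule L2_on_imp_square_integrable[OF PL(1)])
  have "(LINT x:Q0|lebesgue. P L x * P L x) = (LINT x|lebesgue. (P L x)\<^sup>2)"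
    unfolding set_lebesgue_integral_def using PL(1)
    by (intro Bochner_Integration.integral_cong) (auto simp: L2_on_def indicator_def power2_eq_square)
  with norm have norm': "(LINT x|lebesgue. (P L x)\<^sup>2) = 1" by simp
  have "1 = s ^ CARD('n) * (LINT x|lebesgue. (P L (s *\<^sub>R x + t))\<^sup>2)"
    using integral_affine[of s "\<lambda>x. (P L x)\<^sup>2" t] square_integrableD[OF sq] s norm' by simp
  then have size0: "(LINT x|lebesgue. (P L (s *\<^sub>R x + t))\<^sup>2) = s powr (- ?N)"
    using s by (simp add: powr_minus powr_realpow field_simps)
  let ?Q = "cbox c (\<chi> i. c $ i + 2 / s)"
  have "is_atom p ?Q (\<lambda>x. a x / K)"
    unfolding is_atom_iff aK
  proof (intro conjI)
    show "is_cube ?Q" using s by (auto simp: is_cube_def intro!: exI[of _ c] exI[of _ "2 / s"])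
    show "L2_on ?Q (\<lambda>x. u * P L (s *\<^sub>R x + t))"
      unfolding L2_on_iff
    proof (intro conjI allI impI)
      show "square_integrable lebesgue (\<lambda>x. u * P L (s *\<^sub>R x + t))"
        using s by (intro square_integrable_cmult square_integrable_affine sq) auto
      show "u * P L (s *\<^sub>R x + t) = 0" if "x \<notin> ?Q" for x
        using that Q0_affine_preimage[OF s, of x t] PL(1) by (auto simp: L2_on_def c_def)
    qed
    show "vanishing_moments (nat \<lfloor>?N * (1 / p - 1)\<rfloor>) (\<lambda>x. u * P L (s *\<^sub>R x + t))"
      using PL(2) s unfolding \<alpha>
      by (intro vanishing_moments_cmult vanishing_moments_affine[OF _ PL(1) bQ0]) auto
    have "(LINT x|lebesgue. (u * P L (s *\<^sub>R x + t))\<^sup>2) = u\<^sup>2 * s powr (- ?N)"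
      by (simp add: power_mult_distrib size0)
    also have "u\<^sup>2 = s powr (2 * (?N + \<alpha>)) / K\<^sup>2"
      using s by (simp add: u_def power_divide powr_power mult.commute)
    also have "\<dots> * s powr (- ?N) = s powr (2 * (?N + \<alpha>) - ?N) / K\<^sup>2"
    proof -
      have "s powr (2 * (?N + \<alpha>)) * s powr (- ?N) = s powr (2 * (?N + \<alpha>) - ?N)"
        by (simp flip: powr_add)
      then show ?thesis by (metis times_divide_eq_left)
    qed
    also have "2 * (?N + \<alpha>) - ?N = - (?N * (1 - 2 / p))"
      using p by (simp add: \<alpha> field_simps)
    also have "K\<^sup>2 = 2 powr (- (?N * (1 - 2 / p)))"
    proof -
      have "K\<^sup>2 = 2 powr (2 * (?N * (1 / p - 1 / 2)))"
        by (simp add: K_def powr_power mult.commute)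
      also have "2 * (?N * (1 / p - 1 / 2)) = - (?N * (1 - 2 / p))"
        using p by (simp add: field_simps)
      finally show ?thesis .
    qed
    also have "s powr (- (?N * (1 - 2 / p))) / 2 powr (- (?N * (1 - 2 / p))) = (2 / s) powr (?N * (1 - 2 / p))"
    proof -
      have "s powr (- e) / 2 powr (- e) = (2 / s) powr e" for e
        using s by (simp add: powr_divide powr_minus field_simps)
      then show ?thesis .
    qed
    also have "\<dots> = measure lebesgue ?Q powr (1 - 2 / p)"
      using s by (simp add: measure_cube powr_powr flip: powr_realpow)
    finally show "(LINT x|lebesgue. (u * P L (s *\<^sub>R x + t))\<^sup>2) \<le> measure lebesgue ?Q powr (1 - 2 / p)"
      by simp
  qed
  then show "a \<in> atom_multiples p (2 powr (?N * (1 / p - 1 / 2)))"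
    unfolding atom_multiples_def atoms_def K_def by blast
qed

section \<open>Non-triviality of the space of special atoms\<close>

lemma continuous_AE_zero_imp_zero:
  fixes f :: "'a::euclidean_space \<Rightarrow> real"
  assumes f: "continuous_on UNIV f" and S: "open S" and ae: "AE x in lebesgue. x \<in> S \<longrightarrow> f x = 0"
    and x: "x \<in> S"
  shows "f x = 0"
proof (rule ccontr)
  assume "f x \<noteq> 0"
  define U where "U = S \<inter> {x. f x \<noteq> 0}"
  have "open {x. f x \<noteq> 0}" using f by (intro open_Collect_neq) auto
  then have U: "open U" using S by (auto simp: U_def)
  have "AE x in lebesgue. x \<notin> U" using ae by eventually_elim (auto simp: U_def)
  moreover have "U \<in> sets lebesgue" using U by (simp add: borel_open)
  ultimately have "negligible U"
    by (simp add: AE_iff_null_sets negligible_iff_null_sets)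
  then have "U = {}" using U open_not_negligible by blast
  then show False using x \<open>f x \<noteq> 0\<close> by (auto simp: U_def)
qed

lemma AE_dyadic_cube_interior:
  fixes k :: "'n::finite \<Rightarrow> int"
  shows "AE x in lebesgue. x \<in> dyadic_cube 0 k \<longrightarrow> x \<in> half_open_cube 1 k"
proof -
  let ?a = "\<chi> i. (of_int (k i) - 1 :: real)" and ?b = "\<chi> i. (of_int (k i) :: real)"
  have "negligible (cbox ?a ?b - box ?a ?b)" by (rule negligible_frontier_interval)
  then have "AE x in lebesgue. x \<notin> cbox ?a ?b - box ?a ?b"
    by (intro AE_not_in) (simp add: negligible_iff_null_sets)
  then show ?thesis
    by eventually_elim
      (auto simp: dyadic_cube_def half_open_cube_def mem_box_cart less_imp_le)
qed

lemma bounded_Q0: "bounded Q0" and sets_Q0: "Q0 \<in> sets lebesgue"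
  by (auto simp: Q0_def)

lemma half_open_cube_corner_subset_Q0:
  assumes "\<epsilon> \<in> corners"
  shows "half_open_cube 1 \<epsilon> \<subseteq> Q0"
proof
  fix x assume x: "x \<in> half_open_cube 1 \<epsilon>"
  have "- 1 \<le> x $ i \<and> x $ i \<le> 1" for i
  proof -
    have "\<epsilon> i = 0 \<or> \<epsilon> i = 1" using assms by (auto simp: corners_def)
    then show ?thesis using x by (auto simp: half_open_cube_def dest!: spec[of _ i])
  qed
  then show "x \<in> Q0" by (simp add: Q0_def mem_box_cart)
qed

text \<open>The indicator of one of the dyadic subcubes of \<open>Q0\<close>, minus its projection \<open>q\<close> onto the polynomials
  on \<open>Q0\<close>. If the difference vanished almost everywhere, then \<open>q\<close> would be 1 on this subcube and 0 on
  the opposite one; but both meet the diagonal, where \<open>q\<close> is a polynomial in one variable.\<close>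

lemma piecewise_polys_nontrivial:
  obtains w :: "real ^ 'n \<Rightarrow> real" where "w \<in> piecewise_polys d" "\<not> (AE x in lebesgue. w x = 0)"
proof -
  let ?H = "half_open_cube 1 (\<lambda>_. 0) :: (real ^ 'n) set"
  let ?u = "indicator ?H :: real ^ 'n \<Rightarrow> real"
  have u: "square_integrable lebesgue ?u"
    using square_integrable_continuous_indicator[of "\<lambda>_. 1" ?H]
    by (simp add: half_open_cube_sets bounded_half_open_cube)
  obtain q where q: "q \<in> polys_upto d"
    and L: "L2_on Q0 (\<lambda>x. indicator Q0 x * (?u x - q x))"
    and v: "vanishing_moments d (\<lambda>x. indicator Q0 x * (?u x - q x))"
    by (rule polynomial_projection[OF u sets_Q0 bounded_Q0])
  let ?w = "\<lambda>x. indicator Q0 x * (?u x - q x)"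
  have w: "AE x in lebesgue. x \<in> dyadic_cube 0 k \<longrightarrow> ?w x = (if k = (\<lambda>_. 0) then 1 else 0) + (-1) * q x"
    if "\<forall>i. k i \<in> {0, 1}" for k
    using AE_dyadic_cube_interior[of k]
  proof eventually_elim
    case (elim x)
    have k: "k \<in> corners" using that by (simp add: corners_def)
    show ?case
    proof
      assume "x \<in> dyadic_cube 0 k"
      with elim have x: "x \<in> half_open_cube 1 k" by blast
      then have "x \<in> Q0" using half_open_cube_corner_subset_Q0[OF k] by blast
      moreover have "x \<in> ?H \<longleftrightarrow> k = (\<lambda>_. 0)"
        using half_open_cube_unique[OF x _ zero_less_one] x by blast
      ultimately show "?w x = (if k = (\<lambda>_. 0) then 1 else 0) + (-1) * q x" by simp
    qed
  qed
  have const: "(\<lambda>x. c + (-1) * q x) \<in> polys_upto d" for c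
    using polys_upto_add[OF polys_upto_cmult[OF one_mem_polys_upto, of c] polys_upto_cmult[OF q, of "-1"]]
    by simp
  have "?w \<in> piecewise_polys d"
    unfolding piecewise_polys_def mem_Collect_eq
  proof (intro conjI allI impI L v)
    fix k :: "'n \<Rightarrow> int" assume "\<forall>i. k i \<in> {0, 1}"
    from w[OF this] show "\<exists>r\<in>polys_upto d. AE x in lebesgue. x \<in> dyadic_cube 0 k \<longrightarrow> ?w x = r x"
      by (rule bexI[OF _ const])
  qed
  moreover have "\<not> (AE x in lebesgue. ?w x = 0)"
  proof
    assume ae: "AE x in lebesgue. ?w x = 0"
    have cont: "continuous_on UNIV q" "continuous_on UNIV (\<lambda>x. 1 + (-1) * q x)"
      by (auto intro!: continuous_intros continuous_on_polys_upto[OF q])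
    have "AE x in lebesgue. x \<in> box (\<chi> i. 0) (\<chi> i. 1) \<longrightarrow> q x = 0"
      using ae w[of "\<lambda>_. 1", simplified]
      by eventually_elim (auto simp: fun_eq_iff dyadic_cube_def mem_box_cart less_imp_le)
    then have q0: "q x = 0" if "x \<in> box (\<chi> i. 0) (\<chi> i. 1)" for x
      using continuous_AE_zero_imp_zero[OF cont(1) open_box] that by blast
    have "AE x in lebesgue. x \<in> box (\<chi> i. -1) (\<chi> i. 0) \<longrightarrow> 1 + (-1) * q x = 0"
      using ae w[of "\<lambda>_. 0", simplified]
      by eventually_elim (auto simp: dyadic_cube_def mem_box_cart less_imp_le)
    then have q1: "1 + (-1) * q x = 0" if "x \<in> box (\<chi> i. -1) (\<chi> i. 0)" for x
      using continuous_AE_zero_imp_zero[OF cont(2) open_box] that by blast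
    have "q (\<chi> i. - 1 / 2) = 0"
      by (rule polys_upto_zero_on_diagonal[OF q]) (rule q0, simp add: mem_box_cart)
    moreover have "1 + (-1) * q (\<chi> i. - 1 / 2) = 0" by (rule q1) (simp add: mem_box_cart)
    ultimately show False by simp
  qed
  ultimately show ?thesis by (rule that)
qed

text \<open>Decompositions are infinite series, padded with zero coefficients if necessary. Without any special
  atom there would be no decomposition at all, not even of zero.\<close>

lemma orthonormal_basis_nonempty:
  fixes P :: "nat \<Rightarrow> real ^ 'n \<Rightarrow> real"
  assumes "orthonormal_basis (piecewise_polys d) M P"
  shows "0 < M"
proof (rule ccontr)
  assume "\<not> 0 < M"
  then have "AE x in lebesgue. h x = 0" if "h \<in> piecewise_polys d"
    for h :: "real ^ 'n \<Rightarrow> real"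
    using assms that by (auto simp: orthonormal_basis_def)
  then show False by (rule_tac piecewise_polys_nontrivial[where d = d and 'n = 'n]) blast
qed

section \<open>Splitting an atom\<close>

text \<open>The coefficient is the inner product with \<open>P L\<close>, a function of norm one.\<close>

lemma orthonormal_expansion_coeff_bound:
  assumes P: "orthonormal_basis (piecewise_polys d) M P" and h: "h \<in> piecewise_polys d"
    and c: "AE x in lebesgue. h x = (\<Sum>L=1..M. c L * P L x)" and L: "L \<in> {1..M}"
  shows "(c L)\<^sup>2 \<le> (LINT x|lebesgue. (h x)\<^sup>2)"
proof -
  have PL: "L2_on Q0 (P K)" if "K \<in> {1..M}" for K
    using P that by (auto simp: orthonormal_basis_def piecewise_polys_def)
  have h2: "L2_on Q0 h" using h by (simp add: piecewise_polys_def)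
  note sq = L2_on_imp_square_integrable
  have on: "(LINT x|lebesgue. P K x * P L x) = (if K = L then 1 else 0)" if "K \<in> {1..M}" for K
  proof -
    have "(LINT x:Q0|lebesgue. P K x * P L x) = (LINT x|lebesgue. P K x * P L x)"
      unfolding set_lebesgue_integral_def using PL[OF L]
      by (intro Bochner_Integration.integral_cong) (auto simp: L2_on_def indicator_def)
    then show ?thesis using P that L by (simp add: orthonormal_basis_def)
  qed
  have meas: "(\<lambda>x. h x * P L x) \<in> borel_measurable lebesgue"
      "(\<lambda>x. \<Sum>K=1..M. c K * (P K x * P L x)) \<in> borel_measurable lebesgue"
    using square_integrable_mult[OF sq[OF h2] sq[OF PL[OF L]]]
      square_integrable_mult[OF sq[OF PL] sq[OF PL[OF L]]]
    by (auto intro!: borel_measurable_sum borel_measurable_times)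
  have "(LINT x|lebesgue. h x * P L x) = (LINT x|lebesgue. (\<Sum>K=1..M. c K * (P K x * P L x)))"
  proof (rule integral_cong_AE[OF meas])
    show "AE x in lebesgue. h x * P L x = (\<Sum>K=1..M. c K * (P K x * P L x))"
      using c by eventually_elim (simp add: sum_distrib_right mult.assoc)
  qed
  also have "\<dots> = (\<Sum>K=1..M. c K * (LINT x|lebesgue. P K x * P L x))"
    using square_integrable_mult[OF sq[OF PL] sq[OF PL[OF L]]]
    by (subst Bochner_Integration.integral_sum) auto
  also have "\<dots> = (\<Sum>K=1..M. if K = L then c K else 0)"
    using on by (intro sum.cong) auto
  also have "\<dots> = c L" using L by simp
  finally have cL: "c L = (LINT x|lebesgue. h x * P L x)" ..
  have "(c L)\<^sup>2 \<le> (LINT x|lebesgue. (h x)\<^sup>2) * (LINT x|lebesgue. (P L x)\<^sup>2)"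
    unfolding cL by (rule integral_Cauchy_Schwarz[OF sq[OF h2] sq[OF PL[OF L]]])
  then show ?thesis using on[OF L] by (simp add: power2_eq_square)
qed

lemma half_open_cube_affine:
  fixes y :: "real ^ 'n"
  assumes "s > 0"
  shows "s *\<^sub>R y + s *\<^sub>R (\<chi> i. of_int (k i)) \<in> half_open_cube s (\<lambda>i. k i + \<epsilon> i)
    \<longleftrightarrow> y \<in> half_open_cube 1 \<epsilon>"
proof -
  have "(of_int (k i + \<epsilon> i) - 1) * s \<le> s * y $ i + s * of_int (k i) \<longleftrightarrow> of_int (\<epsilon> i) - 1 \<le> y $ i"
    "s * y $ i + s * of_int (k i) < of_int (k i + \<epsilon> i) * s \<longleftrightarrow> y $ i < of_int (\<epsilon> i)" for i
  proof -
    have "(of_int (k i + \<epsilon> i) - 1) * s \<le> s * y $ i + s * of_int (k i)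
        \<longleftrightarrow> s * (of_int (\<epsilon> i) - 1) \<le> s * y $ i"
      "s * y $ i + s * of_int (k i) < of_int (k i + \<epsilon> i) * s \<longleftrightarrow> s * y $ i < s * of_int (\<epsilon> i)"
      by (auto simp: algebra_simps)
    then show "(of_int (k i + \<epsilon> i) - 1) * s \<le> s * y $ i + s * of_int (k i) \<longleftrightarrow> of_int (\<epsilon> i) - 1 \<le> y $ i"
      "s * y $ i + s * of_int (k i) < of_int (k i + \<epsilon> i) * s \<longleftrightarrow> y $ i < of_int (\<epsilon> i)"
      using assms by (auto simp only: mult_le_cancel_left_pos mult_less_cancel_left_pos)
  qed
  then show ?thesis by (simp add: half_open_cube_def)
qed

text \<open>The splitting of an atom \<open>a\<close> along the dyadic block that contains its cube: \<open>q \<epsilon>\<close> is the projection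
  of \<open>a\<close> to polynomials on the cube with offset \<open>\<epsilon>\<close>, and \<open>h\<close> is the resulting piecewise polynomial.
  The moments of \<open>h\<close> vanish since those of \<open>a\<close> and of all remainders do.\<close>

lemma atom_dyadic_pieces:
  fixes a :: "real ^ 'n \<Rightarrow> real"
  assumes p: "0 < p" "p \<le> 1" and a: "a \<in> atoms p"
    and m: "m = nat \<lfloor>real CARD('n) * (1 / p - 1)\<rfloor>"
    and K: "K = 2 powr (real CARD('n) * (1 / p - 1 / 2))"
  obtains n :: int and k :: "'n \<Rightarrow> int" and q :: "('n \<Rightarrow> int) \<Rightarrow> real ^ 'n \<Rightarrow> real" and h
  where "\<forall>\<epsilon>\<in>corners. q \<epsilon> \<in> polys_upto m"
    and "h = (\<lambda>x. \<Sum>\<epsilon>\<in>corners. indicator (half_open_cube (2 powi n) (\<lambda>i. k i + \<epsilon> i)) x * q \<epsilon> x)"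
    and "\<forall>\<epsilon>\<in>corners.
      (\<lambda>x. indicator (half_open_cube (2 powi n) (\<lambda>i. k i + \<epsilon> i)) x * (a x - q \<epsilon> x) / K) \<in> dyadic_atoms p"
    and "\<forall>x. a x = (\<Sum>\<epsilon>\<in>corners. indicator (half_open_cube (2 powi n) (\<lambda>i. k i + \<epsilon> i)) x * (a x - q \<epsilon> x)) + h x"
    and "square_integrable lebesgue h" "vanishing_moments m h"
    and "(LINT x|lebesgue. (h x)\<^sup>2) \<le> K\<^sup>2 * (2 powi n) powr (real CARD('n) * (1 - 2 / p))"
proof -
  let ?N = "real CARD('n)"
  obtain c l where l: "l > 0" and aL: "L2_on (cbox c (\<chi> i. c $ i + l)) a" and av: "vanishing_moments m a"
    and size: "(LINT x|lebesgue. (a x)\<^sup>2) \<le> l powr (?N * (1 - 2 / p))"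
  proof -
    obtain Q where Q: "is_atom p Q a" using a by (auto simp: atoms_def)
    then obtain c l where "l > 0" "Q = cbox c (\<chi> i. c $ i + l)" by (auto simp: is_atom_def is_cube_def)
    then show ?thesis
      using Q that[of l c] unfolding is_atom_iff m
      by (auto simp: measure_cube powr_powr simp flip: powr_realpow)
  qed
  let ?Q = "cbox c (\<chi> i. c $ i + l)"
  obtain n :: int where n: "l \<le> 2 powi n" "2 powi n < 2 * l" using dyadic_scale_exists[OF l] by blast
  define s :: real where "s = 2 powi n"
  have s: "s > 0" "l \<le> s" "s < 2 * l" using n by (auto simp: s_def)
  obtain k where k: "\<And>x. x \<in> ?Q \<Longrightarrow> \<exists>\<epsilon>\<in>corners. x \<in> half_open_cube s (\<lambda>i. k i + \<epsilon> i)"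
    using cube_in_dyadic_block[OF s(1,2)] by blast
  let ?H = "\<lambda>\<epsilon>. half_open_cube s (\<lambda>i. k i + \<epsilon> i)"
  have sqa: "square_integrable lebesgue a" by (rule L2_on_imp_square_integrable[OF aL])
  define good where "good = (\<lambda>\<epsilon> q. q \<in> polys_upto m
    \<and> L2_on (?H \<epsilon>) (\<lambda>x. indicator (?H \<epsilon>) x * (a x - q x))
    \<and> L2_on (?H \<epsilon>) (\<lambda>x. indicator (?H \<epsilon>) x * q x)
    \<and> vanishing_moments m (\<lambda>x. indicator (?H \<epsilon>) x * (a x - q x))
    \<and> (LINT x|lebesgue. (indicator (?H \<epsilon>) x * (a x - q x))\<^sup>2) + (LINT x|lebesgue. (indicator (?H \<epsilon>) x * q x)\<^sup>2)
      = (LINT x|lebesgue. (indicator (?H \<epsilon>) x * a x)\<^sup>2))"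
  have "\<exists>q. good \<epsilon> q" for \<epsilon>
    unfolding good_def
    by (rule polynomial_projection[OF sqa half_open_cube_sets bounded_half_open_cube, of m s "\<lambda>i. k i + \<epsilon> i"])
      blast
  then have "\<exists>q. \<forall>\<epsilon>. good \<epsilon> (q \<epsilon>)" by (intro choice allI)
  then obtain q where "\<And>\<epsilon>. good \<epsilon> (q \<epsilon>)" by blast
  then have q: "q \<epsilon> \<in> polys_upto m"
    and Ld: "L2_on (?H \<epsilon>) (\<lambda>x. indicator (?H \<epsilon>) x * (a x - q \<epsilon> x))"
    and Lq: "L2_on (?H \<epsilon>) (\<lambda>x. indicator (?H \<epsilon>) x * q \<epsilon> x)"
    and van: "vanishing_moments m (\<lambda>x. indicator (?H \<epsilon>) x * (a x - q \<epsilon> x))"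
    and pyth: "(LINT x|lebesgue. (indicator (?H \<epsilon>) x * (a x - q \<epsilon> x))\<^sup>2)
      + (LINT x|lebesgue. (indicator (?H \<epsilon>) x * q \<epsilon> x)\<^sup>2)
      = (LINT x|lebesgue. (indicator (?H \<epsilon>) x * a x)\<^sup>2)" for \<epsilon>
    unfolding good_def by blast+
  define h where "h = (\<lambda>x. \<Sum>\<epsilon>\<in>corners. indicator (?H \<epsilon>) x * q \<epsilon> x)"
  have sum_a: "(\<Sum>\<epsilon>\<in>corners. indicator (?H \<epsilon>) x * a x) = a x" for x
  proof (cases "x \<in> ?Q")
    case True
    then obtain \<epsilon> where \<epsilon>: "\<epsilon> \<in> corners" "x \<in> ?H \<epsilon>" using k by blast
    show ?thesis by (rule sum_indicator_half_open_cubes[OF s(1) \<epsilon>])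
  next
    case False
    then show ?thesis using aL by (simp add: L2_on_def)
  qed
  have sum_a2: "(\<Sum>\<epsilon>\<in>corners. (indicator (?H \<epsilon>) x * a x)\<^sup>2) = (a x)\<^sup>2" for x
  proof (cases "x \<in> ?Q")
    case True
    then obtain \<epsilon> where \<epsilon>: "\<epsilon> \<in> corners" "x \<in> ?H \<epsilon>" using k by blast
    have "(indicator (?H \<delta>) x * a x)\<^sup>2 = indicator (?H \<delta>) x * (a x)\<^sup>2" for \<delta>
      by (auto simp: indicator_def)
    then show ?thesis using sum_indicator_half_open_cubes[OF s(1) \<epsilon>, of "\<lambda>_. (a x)\<^sup>2"] by simp
  next
    case False
    then show ?thesis using aL by (simp add: L2_on_def)
  qed
  have h2: "(h x)\<^sup>2 = (\<Sum>\<epsilon>\<in>corners. (indicator (?H \<epsilon>) x * q \<epsilon> x)\<^sup>2)" for x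
  proof (cases "\<exists>\<epsilon>\<in>corners. x \<in> ?H \<epsilon>")
    case True
    then obtain \<epsilon> where \<epsilon>: "\<epsilon> \<in> corners" "x \<in> ?H \<epsilon>" by blast
    have "(indicator (?H \<delta>) x * q \<delta> x)\<^sup>2 = indicator (?H \<delta>) x * (q \<delta> x)\<^sup>2" for \<delta>
      by (auto simp: indicator_def)
    then show ?thesis
      using sum_indicator_half_open_cubes[OF s(1) \<epsilon>, of "\<lambda>\<delta>. (q \<delta> x)\<^sup>2"]
        sum_indicator_half_open_cubes[OF s(1) \<epsilon>, of "\<lambda>\<delta>. q \<delta> x"] by (simp add: h_def)
  next
    case False
    then have "indicator (?H \<epsilon>) x * q \<epsilon> x = 0" if "\<epsilon> \<in> corners" for \<epsilon> using that by simp
    then have "h x = 0" "(\<Sum>\<epsilon>\<in>corners. (indicator (?H \<epsilon>) x * q \<epsilon> x)\<^sup>2) = 0"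
      unfolding h_def by (intro sum.neutral ballI; simp only: zero_power2)+
    then show ?thesis by (simp only: zero_power2)
  qed
  have split: "a x = (\<Sum>\<epsilon>\<in>corners. indicator (?H \<epsilon>) x * (a x - q \<epsilon> x)) + h x" for x
    using sum_a[of x] by (simp add: h_def right_diff_distrib sum_subtractf)
  have sqh: "square_integrable lebesgue h"
    unfolding h_def by (intro square_integrable_sum L2_on_imp_square_integrable[OF Lq])
  have intd: "integrable lebesgue (\<lambda>x. (indicator (?H \<epsilon>) x * (a x - q \<epsilon> x))\<^sup>2)"
    "integrable lebesgue (\<lambda>x. (indicator (?H \<epsilon>) x * q \<epsilon> x)\<^sup>2)" for \<epsilon>
    using Ld Lq by (auto simp: L2_on_def)
  have inta: "integrable lebesgue (\<lambda>x. (indicator (?H \<epsilon>) x * a x)\<^sup>2)" for \<epsilon>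
  proof -
    have "square_integrable lebesgue (\<lambda>x. indicator (?H \<epsilon>) x * (a x - q \<epsilon> x) + indicator (?H \<epsilon>) x * q \<epsilon> x)"
      by (intro square_integrable_add L2_on_imp_square_integrable[OF Ld] L2_on_imp_square_integrable[OF Lq])
    then show ?thesis by (simp add: right_diff_distrib square_integrable_def)
  qed
  have piece_le: "(LINT x|lebesgue. (indicator (?H \<epsilon>) x * a x)\<^sup>2) \<le> l powr (?N * (1 - 2 / p))" for \<epsilon>
  proof -
    have "(LINT x|lebesgue. (indicator (?H \<epsilon>) x * a x)\<^sup>2) \<le> (LINT x|lebesgue. (a x)\<^sup>2)"
      by (rule integral_mono[OF inta square_integrableD(2)[OF sqa]]) (auto simp: indicator_def)
    with size show ?thesis by simp
  qed
  \<comment> \<open>The exponent is negative, so that the passage from side \<open>l\<close> to the larger side \<open>s\<close> costs a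
    constant; \<open>s < 2 l\<close> keeps it below \<open>K\<^sup>2\<close>.\<close>
  have scale: "l powr (?N * (1 - 2 / p)) \<le> K\<^sup>2 * s powr (?N * (1 - 2 / p))"
  proof -
    have K2: "K\<^sup>2 = 2 powr (- (?N * (1 - 2 / p)))"
    proof -
      have "K\<^sup>2 = 2 powr (2 * (?N * (1 / p - 1 / 2)))" by (simp add: K powr_power mult.commute)
      also have "2 * (?N * (1 / p - 1 / 2)) = - (?N * (1 - 2 / p))" using p by (simp add: field_simps)
      finally show ?thesis .
    qed
    have e: "?N * (1 - 2 / p) \<le> 0" using p by (intro mult_nonneg_nonpos) (auto simp: field_simps)
    have "(2 * l) powr (?N * (1 - 2 / p)) \<le> s powr (?N * (1 - 2 / p))"
      using e s l by (intro powr_mono2') auto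
    moreover have "l powr (?N * (1 - 2 / p)) = K\<^sup>2 * (2 * l) powr (?N * (1 - 2 / p))"
    proof -
      have "l powr e = 2 powr (- e) * (2 * l) powr e" for e
        using l by (simp add: powr_mult powr_minus)
      then show ?thesis unfolding K2 .
    qed
    ultimately show ?thesis by (simp add: mult_left_mono)
  qed
  have Kpos: "K > 0" by (simp add: K)
  have sq_nonneg: "0 \<le> (LINT x|lebesgue. (f x)\<^sup>2)" for f :: "real ^ 'n \<Rightarrow> real" by simp
  have dy: "(\<lambda>x. indicator (?H \<epsilon>) x * (a x - q \<epsilon> x) / K) \<in> dyadic_atoms p" for \<epsilon>
  proof -
    let ?k = "\<lambda>i. k i + \<epsilon> i"
    let ?d = "\<lambda>x. indicator (?H \<epsilon>) x * (a x - q \<epsilon> x)"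
    have cube: "dyadic_cube n ?k = cbox (\<chi> i. (of_int (?k i) - 1) * s)
        (\<chi> i. (\<chi> i. (of_int (?k i) - 1) * s) $ i + s)"
      unfolding dyadic_cube_def s_def[symmetric] by (simp add: algebra_simps)
    have "is_atom p (dyadic_cube n ?k) (\<lambda>x. ?d x / K)"
      unfolding is_atom_iff
    proof (intro conjI)
      show "is_cube (dyadic_cube n ?k)" unfolding is_cube_def cube using s(1) by blast
      have "L2_on (?H \<epsilon>) (\<lambda>x. (1 / K) * ?d x)"
        using Ld[of \<epsilon>] square_integrable_cmult[of lebesgue ?d "1 / K"] by (simp add: L2_on_iff)
      then show "L2_on (dyadic_cube n ?k) (\<lambda>x. ?d x / K)"
        using half_open_cube_subset_dyadic[of n ?k] L2_on_subset unfolding s_def by fastforce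
      show "vanishing_moments (nat \<lfloor>?N * (1 / p - 1)\<rfloor>) (\<lambda>x. ?d x / K)"
        using vanishing_moments_cmult[OF van[of \<epsilon>], of "1 / K"] by (simp add: m)
      have "(LINT x|lebesgue. (?d x)\<^sup>2) \<le> l powr (?N * (1 - 2 / p))"
        using pyth[of \<epsilon>] piece_le[of \<epsilon>] sq_nonneg[of "\<lambda>x. indicator (?H \<epsilon>) x * q \<epsilon> x"] by linarith
      then have "(LINT x|lebesgue. (?d x)\<^sup>2) / K\<^sup>2 \<le> s powr (?N * (1 - 2 / p))"
        using scale Kpos by (simp add: divide_le_eq mult.commute)
      also have "s powr (?N * (1 - 2 / p)) = measure lebesgue (dyadic_cube n ?k) powr (1 - 2 / p)"
        unfolding cube using s(1) measure_cube[OF s(1), of "\<chi> i. (of_int (?k i) - 1) * s"]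
        by (simp add: powr_powr flip: powr_realpow)
      finally show "(LINT x|lebesgue. (?d x / K)\<^sup>2) \<le> measure lebesgue (dyadic_cube n ?k) powr (1 - 2 / p)"
        by (simp add: power_divide)
    qed
    then show ?thesis unfolding dyadic_atoms_def by blast
  qed
  have vh: "vanishing_moments m h"
    unfolding vanishing_moments_def
  proof
    fix \<beta> :: "'n \<Rightarrow> nat" assume \<beta>: "\<beta> \<in> multi_indices m"
    have i1: "integrable lebesgue (\<lambda>x. a x * monomial \<beta> x)"
      by (intro L2_on_mult_continuous_integrable[OF aL] continuous_on_monomial) simp
    have i2: "integrable lebesgue (\<lambda>x. indicator (?H \<epsilon>) x * (a x - q \<epsilon> x) * monomial \<beta> x)" for \<epsilon>
      by (intro L2_on_mult_continuous_integrable[OF Ld] continuous_on_monomial bounded_half_open_cube)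
    have "(LINT x|lebesgue. h x * monomial \<beta> x) = (LINT x|lebesgue. a x * monomial \<beta> x
        - (\<Sum>\<epsilon>\<in>corners. indicator (?H \<epsilon>) x * (a x - q \<epsilon> x) * monomial \<beta> x))"
    proof (intro Bochner_Integration.integral_cong refl)
      fix x
      have "h x = a x - (\<Sum>\<epsilon>\<in>corners. indicator (?H \<epsilon>) x * (a x - q \<epsilon> x))" using split[of x] by linarith
      then show "h x * monomial \<beta> x = a x * monomial \<beta> x
        - (\<Sum>\<epsilon>\<in>corners. indicator (?H \<epsilon>) x * (a x - q \<epsilon> x) * monomial \<beta> x)"
        by (simp only: left_diff_distrib sum_distrib_right)
    qed
    also have "\<dots> = (LINT x|lebesgue. a x * monomial \<beta> x)
        - (\<Sum>\<epsilon>\<in>corners. LINT x|lebesgue. indicator (?H \<epsilon>) x * (a x - q \<epsilon> x) * monomial \<beta> x)"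
      using i1 i2 by (subst Bochner_Integration.integral_diff) (auto simp: Bochner_Integration.integral_sum)
    also have "\<dots> = 0"
      using av van \<beta> by (simp add: vanishing_moments_def)
    finally show "(LINT x|lebesgue. h x * monomial \<beta> x) = 0" .
  qed
  have "(LINT x|lebesgue. (h x)\<^sup>2) = (\<Sum>\<epsilon>\<in>corners. LINT x|lebesgue. (indicator (?H \<epsilon>) x * q \<epsilon> x)\<^sup>2)"
    unfolding h2 using intd by (intro Bochner_Integration.integral_sum)
  also have "\<dots> \<le> (\<Sum>\<epsilon>\<in>corners. LINT x|lebesgue. (indicator (?H \<epsilon>) x * a x)\<^sup>2)"
  proof (rule sum_mono)
    show "(LINT x|lebesgue. (indicator (?H \<epsilon>) x * q \<epsilon> x)\<^sup>2) \<le> (LINT x|lebesgue. (indicator (?H \<epsilon>) x * a x)\<^sup>2)" for \<epsilon>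
      using pyth[of \<epsilon>] sq_nonneg[of "\<lambda>x. indicator (?H \<epsilon>) x * (a x - q \<epsilon> x)"] by linarith
  qed
  also have "\<dots> = (LINT x|lebesgue. (a x)\<^sup>2)"
    unfolding sum_a2[symmetric] using inta by (intro Bochner_Integration.integral_sum[symmetric])
  also have "\<dots> \<le> K\<^sup>2 * s powr (?N * (1 - 2 / p))" using size scale by simp
  finally show ?thesis
    using that[of q h n k] q h_def dy split sqh vh unfolding s_def by blast
qed

text \<open>The function \<open>g\<close>, a copy of \<open>h\<close> moved to \<open>Q0\<close>, is expanded in the basis, and the expansion is moved
  back. The powers of the scale cancel in the estimate of the coefficients: the dilation contributes
  \<open>- N\<close>, the size of \<open>h\<close> contributes \<open>N (1 - 2 / p)\<close> and the normalisation of the special atoms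
  contributes \<open>2 (N + \<alpha>)\<close> to the exponent of the square.\<close>

lemma piecewise_poly_special_expansion:
  fixes P :: "nat \<Rightarrow> real ^ 'n \<Rightarrow> real" and h :: "real ^ 'n \<Rightarrow> real"
  assumes p: "0 < p" "p \<le> 1" and \<alpha>: "\<alpha> = real CARD('n) * (1 / p - 1)"
    and P: "orthonormal_basis (piecewise_polys (nat \<lfloor>\<alpha>\<rfloor>)) M P"
    and K: "0 \<le> K"
    and q: "\<And>\<epsilon>. \<epsilon> \<in> corners \<Longrightarrow> q \<epsilon> \<in> polys_upto (nat \<lfloor>\<alpha>\<rfloor>)"
    and h: "h = (\<lambda>x. \<Sum>\<epsilon>\<in>corners. indicator (half_open_cube (2 powi n) (\<lambda>i. k i + \<epsilon> i)) x * q \<epsilon> x)"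
    and sqh: "square_integrable lebesgue h" and vh: "vanishing_moments (nat \<lfloor>\<alpha>\<rfloor>) h"
    and size: "(LINT x|lebesgue. (h x)\<^sup>2) \<le> K\<^sup>2 * (2 powi n) powr (real CARD('n) * (1 - 2 / p))"
  obtains e where "\<forall>L\<in>{1..M}. \<bar>e L\<bar> \<le> K"
    and "AE x in lebesgue. h x = (\<Sum>L=1..M. e L * special_atom \<alpha> (P L) (- n) (\<lambda>i. - k i) x)"
proof -
  let ?N = "real CARD('n)" and ?m = "nat \<lfloor>\<alpha>\<rfloor>"
  define s :: real where "s = 2 powi n"
  have s: "s > 0" by (simp add: s_def)
  define t :: "real ^ 'n" where "t = s *\<^sub>R (\<chi> i. of_int (k i))"
  define g where "g = (\<lambda>y. h (s *\<^sub>R y + t))"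
  have hH: "h = (\<lambda>x. \<Sum>\<epsilon>\<in>corners. indicator (half_open_cube s (\<lambda>i. k i + \<epsilon> i)) x * q \<epsilon> x)"
    by (simp only: h s_def)
  have gH: "g y = (\<Sum>\<epsilon>\<in>corners. indicator (half_open_cube 1 \<epsilon>) y * q \<epsilon> (s *\<^sub>R y + t))" for y
  proof -
    have "indicator (half_open_cube s (\<lambda>i. k i + \<epsilon> i)) (s *\<^sub>R y + t) = (indicator (half_open_cube 1 \<epsilon>) y :: real)" for \<epsilon>
      using half_open_cube_affine[OF s, of y k \<epsilon>] by (simp only: t_def indicator_def)
    then show ?thesis by (simp only: g_def hH)
  qed
  have g_on: "g y = q \<epsilon> (s *\<^sub>R y + t)" if "\<epsilon> \<in> corners" "y \<in> half_open_cube 1 \<epsilon>" for y \<epsilon>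
    unfolding gH
    using sum_indicator_half_open_cubes[OF zero_less_one that(1), of y "\<lambda>_. 0" "\<lambda>\<epsilon>. q \<epsilon> (s *\<^sub>R y + t)"] that(2)
    by (simp only: add_0)
  have g_off: "g y = 0" if "y \<notin> Q0" for y
  proof -
    have "indicator (half_open_cube 1 \<epsilon>) y * q \<epsilon> (s *\<^sub>R y + t) = 0" if "\<epsilon> \<in> corners" for \<epsilon>
      using half_open_cube_corner_subset_Q0[OF that] \<open>y \<notin> Q0\<close> by (auto simp: indicator_def)
    then show ?thesis unfolding gH by (intro sum.neutral) auto
  qed
  have Lg: "L2_on Q0 g"
    using square_integrable_affine[OF _ sqh, of s t] s g_off by (auto simp: L2_on_iff g_def)
  have Lh: "L2_on (\<Union>\<epsilon>\<in>corners. half_open_cube s (\<lambda>i. k i + \<epsilon> i)) h"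
  proof -
    have "h x = 0" if "x \<notin> (\<Union>\<epsilon>\<in>corners. half_open_cube s (\<lambda>i. k i + \<epsilon> i))" for x
      unfolding hH using that by (intro sum.neutral) auto
    then show ?thesis using sqh by (auto simp: L2_on_iff)
  qed
  have bh: "bounded (\<Union>\<epsilon>\<in>corners. half_open_cube s (\<lambda>i. k i + \<epsilon> i))"
    by (intro bounded_UN finite_corners ballI bounded_half_open_cube)
  have vg: "vanishing_moments ?m g"
    unfolding g_def using s by (intro vanishing_moments_affine[OF _ Lh bh vh]) simp
  have g_mem: "g \<in> piecewise_polys ?m"
    unfolding piecewise_polys_def mem_Collect_eq
  proof (intro conjI allI impI Lg vg)
    fix \<epsilon> :: "'n \<Rightarrow> int" assume "\<forall>i. \<epsilon> i \<in> {0, 1}"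
    then have \<epsilon>: "\<epsilon> \<in> corners" by (simp add: corners_def)
    show "\<exists>r\<in>polys_upto ?m. AE x in lebesgue. x \<in> dyadic_cube 0 \<epsilon> \<longrightarrow> g x = r x"
    proof (rule bexI[OF _ polys_upto_affine[OF q[OF \<epsilon>]]])
      show "AE x in lebesgue. x \<in> dyadic_cube 0 \<epsilon> \<longrightarrow> g x = q \<epsilon> (s *\<^sub>R x + t)"
        using AE_dyadic_cube_interior[of \<epsilon>] by eventually_elim (use g_on[OF \<epsilon>] in blast)
    qed
  qed
  obtain c where c: "AE x in lebesgue. g x = (\<Sum>L=1..M. c L * P L x)"
    using P g_mem unfolding orthonormal_basis_def by blast
  define e where "e = (\<lambda>L. c L * s powr (?N + \<alpha>))"
  have size_g: "(LINT x|lebesgue. (g x)\<^sup>2) \<le> K\<^sup>2 * s powr (- ?N + ?N * (1 - 2 / p))"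
  proof -
    have "(LINT x|lebesgue. (h x)\<^sup>2) = s ^ CARD('n) * (LINT x|lebesgue. (g x)\<^sup>2)"
      using integral_affine[of s "\<lambda>x. (h x)\<^sup>2" t] s square_integrableD[OF sqh] by (simp add: g_def)
    then have "s powr ?N * (LINT x|lebesgue. (g x)\<^sup>2) \<le> K\<^sup>2 * s powr (?N * (1 - 2 / p))"
      using size s by (simp add: s_def[symmetric] powr_realpow)
    then have "s powr (- ?N) * (s powr ?N * (LINT x|lebesgue. (g x)\<^sup>2))
        \<le> s powr (- ?N) * (K\<^sup>2 * s powr (?N * (1 - 2 / p)))"
      by (intro mult_left_mono) auto
    also have "s powr (- ?N) * (s powr ?N * (LINT x|lebesgue. (g x)\<^sup>2)) = (LINT x|lebesgue. (g x)\<^sup>2)"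
      using s by (simp add: mult.assoc[symmetric] powr_add[symmetric])
    also have "s powr (- ?N) * (K\<^sup>2 * s powr (?N * (1 - 2 / p))) = K\<^sup>2 * s powr (- ?N + ?N * (1 - 2 / p))"
      by (subst powr_add) (simp only: mult_ac)
    finally show ?thesis .
  qed
  have e_le: "\<bar>e L\<bar> \<le> K" if L: "L \<in> {1..M}" for L
  proof -
    have "(e L)\<^sup>2 = (c L)\<^sup>2 * s powr (2 * (?N + \<alpha>))"
      using s by (simp add: e_def power_mult_distrib powr_power mult.commute)
    also have "\<dots> \<le> K\<^sup>2 * s powr (- ?N + ?N * (1 - 2 / p)) * s powr (2 * (?N + \<alpha>))"
      using orthonormal_expansion_coeff_bound[OF P g_mem c L] size_g by (intro mult_right_mono) auto
    also have "\<dots> = K\<^sup>2 * s powr ((- ?N + ?N * (1 - 2 / p)) + 2 * (?N + \<alpha>))"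
      by (subst (2) powr_add) (simp only: mult.assoc)
    also have "(- ?N + ?N * (1 - 2 / p)) + 2 * (?N + \<alpha>) = 0"
      using p by (simp add: \<alpha> field_simps)
    finally show ?thesis using K s abs_le_square_iff[of "e L" K] by simp
  qed
  have "AE x in lebesgue. g ((1 / s) *\<^sub>R x + (\<chi> i. of_int (- k i)))
      = (\<Sum>L=1..M. c L * P L ((1 / s) *\<^sub>R x + (\<chi> i. of_int (- k i))))"
    using s by (intro AE_affine[OF _ c]) simp
  moreover have "g ((1 / s) *\<^sub>R x + (\<chi> i. of_int (- k i))) = h x" for x
  proof -
    have "s *\<^sub>R ((1 / s) *\<^sub>R x + (\<chi> i. of_int (- k i))) + t = x"
      using s by (simp add: t_def vec_eq_iff algebra_simps)
    then show ?thesis by (simp add: g_def)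
  qed
  moreover have "c L * P L ((1 / s) *\<^sub>R x + (\<chi> i. of_int (- k i)))
      = e L * special_atom \<alpha> (P L) (- n) (\<lambda>i. - k i) x" for L x
  proof -
    have "2 powr (of_int (- n) * u) = s powr (- u)" for u
      unfolding s_def by (simp add: powr_powr flip: powr_real_of_int')
    then have "2 powr (of_int (- n) * (?N + \<alpha>)) = s powr (- (?N + \<alpha>))" .
    moreover have "2 powi (- n) = 1 / s" by (simp add: s_def power_int_minus divide_inverse)
    moreover have "s powr (?N + \<alpha>) * s powr (- (?N + \<alpha>)) = 1"
      using s by (simp flip: powr_add)
    ultimately show ?thesis unfolding special_atom_eq e_def by (simp add: algebra_simps)
  qed
  ultimately have "AE x in lebesgue. h x = (\<Sum>L=1..M. e L * special_atom \<alpha> (P L) (- n) (\<lambda>i. - k i) x)"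
    by simp
  then show ?thesis using that e_le by blast
qed

lemma dyadic_atoms_subset_atoms: "dyadic_atoms p \<subseteq> atoms p"
  by (auto simp: dyadic_atoms_def atoms_def)

text \<open>The number of dyadic and special atoms needed, and the bound \<open>K\<close> for their coefficients, are
  the same for all atoms. The polynomial part agrees with its expansion only almost everywhere, so the
  splitting is an identity of distributions.\<close>

lemma atom_split:
  fixes P :: "nat \<Rightarrow> real ^ 'n \<Rightarrow> real"
  assumes p: "0 < p" "p \<le> 1" and \<alpha>: "\<alpha> = real CARD('n) * (1 / p - 1)"
    and P: "orthonormal_basis (piecewise_polys (nat \<lfloor>\<alpha>\<rfloor>)) M P"
    and K: "K = 2 powr (real CARD('n) * (1 / p - 1 / 2))"
    and a: "a \<in> atoms p"
  obtains d e b where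
    "\<forall>r<card (corners :: ('n \<Rightarrow> int) set). d r \<in> dyadic_atoms p"
    "\<forall>L<M. \<bar>e L\<bar> \<le> K" "\<forall>L<M. b L \<in> special_atoms \<alpha> M P"
    "\<forall>\<phi>\<in>test_funs. dist_of a \<phi> =
      (\<Sum>r<card (corners :: ('n \<Rightarrow> int) set). K * dist_of (d r) \<phi>) + (\<Sum>L<M. e L * dist_of (b L) \<phi>)"
proof -
  let ?R = "card (corners :: ('n \<Rightarrow> int) set)"
  have m: "nat \<lfloor>\<alpha>\<rfloor> = nat \<lfloor>real CARD('n) * (1 / p - 1)\<rfloor>" by (simp add: \<alpha>)
  have Kpos: "K > 0" by (simp add: K)
  obtain n k q h where q: "\<forall>\<epsilon>\<in>corners. q \<epsilon> \<in> polys_upto (nat \<lfloor>\<alpha>\<rfloor>)"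
    and h: "h = (\<lambda>x. \<Sum>\<epsilon>\<in>corners. indicator (half_open_cube (2 powi n) (\<lambda>i. k i + \<epsilon> i)) x * q \<epsilon> x)"
    and dy: "\<forall>\<epsilon>\<in>corners.
      (\<lambda>x. indicator (half_open_cube (2 powi n) (\<lambda>i. k i + \<epsilon> i)) x * (a x - q \<epsilon> x) / K) \<in> dyadic_atoms p"
    and split: "\<forall>x. a x = (\<Sum>\<epsilon>\<in>corners. indicator (half_open_cube (2 powi n) (\<lambda>i. k i + \<epsilon> i)) x * (a x - q \<epsilon> x)) + h x"
    and sqh: "square_integrable lebesgue h" and vh: "vanishing_moments (nat \<lfloor>\<alpha>\<rfloor>) h"
    and size: "(LINT x|lebesgue. (h x)\<^sup>2) \<le> K\<^sup>2 * (2 powi n) powr (real CARD('n) * (1 - 2 / p))"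
    by (rule atom_dyadic_pieces[OF p a m K])
  obtain e where e: "\<forall>L\<in>{1..M}. \<bar>e L\<bar> \<le> K"
    and he: "AE x in lebesgue. h x = (\<Sum>L=1..M. e L * special_atom \<alpha> (P L) (- n) (\<lambda>i. - k i) x)"
    by (rule piecewise_poly_special_expansion[OF p \<alpha> P less_imp_le[OF Kpos] bspec[OF q] h sqh vh size])
  define D where "D = (\<lambda>\<epsilon> x. indicator (half_open_cube (2 powi n) (\<lambda>i. k i + \<epsilon> i)) x * (a x - q \<epsilon> x) / K)"
  define S where "S = (\<lambda>L. special_atom \<alpha> (P L) (- n) (\<lambda>i. - k i))"
  have D: "D \<epsilon> \<in> dyadic_atoms p" if "\<epsilon> \<in> corners" for \<epsilon> unfolding D_def by (rule bspec[OF dy that])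
  have S: "S L \<in> special_atoms \<alpha> M P" if "L \<in> {1..M}" for L
    using that unfolding S_def special_atoms_def by blast
  have pair: "dist_of a \<phi> = (\<Sum>\<epsilon>\<in>corners. K * dist_of (D \<epsilon>) \<phi>) + (\<Sum>L=1..M. e L * dist_of (S L) \<phi>)"
    if \<phi>: "\<phi> \<in> test_funs" for \<phi>
  proof -
    have iD: "integrable lebesgue (\<lambda>x. K * D \<epsilon> x * \<phi> x)" if "\<epsilon> \<in> corners" for \<epsilon>
    proof -
      have "D \<epsilon> \<in> atom_multiples p 1"
        using D[OF that] dyadic_atoms_subset_atoms atoms_eq_atom_multiples_1 by blast
      from atom_multiples_mult_test_integrable[OF zero_less_one this \<phi>] show ?thesis
        by (simp add: mult.assoc)
    qed
    have iS: "integrable lebesgue (\<lambda>x. e L * S L x * \<phi> x)" if "L \<in> {1..M}" for L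
    proof -
      have "S L \<in> atom_multiples p K"
        using S[OF that] special_atoms_subset_atom_multiples[OF p \<alpha> P] K by blast
      from atom_multiples_mult_test_integrable[OF Kpos this \<phi>] show ?thesis
        by (simp add: mult.assoc)
    qed
    let ?u = "\<lambda>x. \<Sum>\<epsilon>\<in>corners. K * D \<epsilon> x" and ?v = "\<lambda>x. \<Sum>L=1..M. e L * S L x"
    have iu: "integrable lebesgue (\<lambda>x. ?u x * \<phi> x)" and iv: "integrable lebesgue (\<lambda>x. ?v x * \<phi> x)"
      unfolding sum_distrib_right by (intro Bochner_Integration.integrable_sum iD iS; assumption)+
    have "a \<in> atom_multiples p 1" using a atoms_eq_atom_multiples_1 by blast
    from atom_multiples_mult_test_integrable[OF zero_less_one this \<phi>]
    have ia: "integrable lebesgue (\<lambda>x. a x * \<phi> x)" .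
    have KD: "K * D \<epsilon> x = indicator (half_open_cube (2 powi n) (\<lambda>i. k i + \<epsilon> i)) x * (a x - q \<epsilon> x)" for \<epsilon> x
      using Kpos by (simp add: D_def)
    have "AE x in lebesgue. a x = ?u x + ?v x"
      using he
    proof eventually_elim
      case (elim x)
      then show ?case using spec[OF split, of x] by (simp only: KD S_def)
    qed
    then have "dist_of a \<phi> = dist_of (\<lambda>x. ?u x + ?v x) \<phi>"
      using iu iv by (intro dist_of_cong_AE ia) (auto simp: distrib_right)
    also have "\<dots> = dist_of ?u \<phi> + dist_of ?v \<phi>"
      using iu iv by (simp add: dist_of_def distrib_right)
    also have "dist_of ?u \<phi> = (\<Sum>\<epsilon>\<in>corners. dist_of (\<lambda>x. K * D \<epsilon> x) \<phi>)"
      using iD by (intro dist_of_sum)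
    also have "dist_of ?v \<phi> = (\<Sum>L=1..M. dist_of (\<lambda>x. e L * S L x) \<phi>)"
      using iS by (intro dist_of_sum)
    finally show ?thesis by (simp only: dist_of_cmult)
  qed
  obtain f where f: "bij_betw f {0..<?R} (corners :: ('n \<Rightarrow> int) set)"
    using ex_bij_betw_nat_finite[OF finite_corners] by blast
  have "dist_of a \<phi> = (\<Sum>r<?R. K * dist_of (D (f r)) \<phi>) + (\<Sum>L<M. e (Suc L) * dist_of (S (Suc L)) \<phi>)"
    if "\<phi> \<in> test_funs" for \<phi>
  proof -
    have "(\<Sum>\<epsilon>\<in>corners. K * dist_of (D \<epsilon>) \<phi>) = (\<Sum>r<?R. K * dist_of (D (f r)) \<phi>)"
      using sum.reindex_bij_betw[OF f, of "\<lambda>\<epsilon>. K * dist_of (D \<epsilon>) \<phi>"] by (simp add: atLeast0LessThan)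
    moreover have "(\<Sum>L=1..M. e L * dist_of (S L) \<phi>) = (\<Sum>L<M. e (Suc L) * dist_of (S (Suc L)) \<phi>)"
      by (simp add: sum.atLeast1_atMost_eq)
    ultimately show ?thesis using pair[OF that] by simp
  qed
  moreover have "\<forall>r<?R. D (f r) \<in> dyadic_atoms p"
    using D bij_betwE[OF f] by auto
  moreover have "\<forall>L<M. \<bar>e (Suc L)\<bar> \<le> K" "\<forall>L<M. S (Suc L) \<in> special_atoms \<alpha> M P"
    using e S by auto
  ultimately show ?thesis
    by (intro that[of "\<lambda>r. D (f r)" "\<lambda>L. e (Suc L)" "\<lambda>L. S (Suc L)"]) blast+
qed

section \<open>Equality of the spaces and equivalence of the quasinorms\<close>

text \<open>Compared with \<open>c\<close>, the sum of the \<open>p\<close>-th powers grows at most by the factor \<open>R * K powr p\<close>.\<close>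

lemma coeff_size_interleave_le:
  assumes p: "0 < p" and R: "0 < R" and K: "0 \<le> K" and c: "summable (\<lambda>j. \<bar>c j\<bar> powr p)"
    and f: "\<And>r. r < R \<Longrightarrow> dist_decomp p A (f r) (\<lambda>j. c j * e j r) (\<lambda>j. a j r)"
    and e: "\<And>j r. r < R \<Longrightarrow> \<bar>e j r\<bar> \<le> K"
  shows "coeff_size p (\<lambda>n. c (n div R) * e (n div R) (n mod R))
    \<le> ennreal (real R powr (1 / p) * K) * coeff_size p c"
proof -
  let ?S = "\<Sum>j. \<bar>c j\<bar> powr p"
  have S0: "0 \<le> ?S" using c by (intro suminf_nonneg) auto
  have "(\<Sum>n. \<bar>c (n div R) * e (n div R) (n mod R)\<bar> powr p) = (\<Sum>r<R. \<Sum>j. \<bar>c j * e j r\<bar> powr p)"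
    by (rule dist_decomp_interleave(2)[OF R f])
  also have "\<dots> \<le> (\<Sum>r<R. K powr p * ?S)"
  proof (rule sum_mono)
    fix r assume "r \<in> {..<R}"
    then have r: "r < R" by simp
    have "\<bar>c j * e j r\<bar> powr p \<le> K powr p * \<bar>c j\<bar> powr p" for j
    proof -
      have "\<bar>e j r\<bar> powr p \<le> K powr p" using e[OF r] p by (intro powr_mono2) auto
      then have "\<bar>c j\<bar> powr p * \<bar>e j r\<bar> powr p \<le> \<bar>c j\<bar> powr p * K powr p"
        by (rule mult_left_mono) simp
      then show ?thesis by (simp add: abs_mult powr_mult mult.commute)
    qed
    then have "(\<Sum>j. \<bar>c j * e j r\<bar> powr p) \<le> (\<Sum>j. K powr p * \<bar>c j\<bar> powr p)"
      using f[OF r] c by (intro suminf_le summable_mult) (auto simp: dist_decomp_iff_sums)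
    then show "(\<Sum>j. \<bar>c j * e j r\<bar> powr p) \<le> K powr p * ?S"
      using suminf_mult[OF c, of "K powr p"] by simp
  qed
  also have "\<dots> = real R * (K powr p * ?S)" by simp
  finally have le: "(\<Sum>n. \<bar>c (n div R) * e (n div R) (n mod R)\<bar> powr p) \<le> real R * (K powr p * ?S)" .
  have nonneg: "0 \<le> (\<Sum>n. \<bar>c (n div R) * e (n div R) (n mod R)\<bar> powr p)"
    using dist_decomp_interleave(1)[of R p A f "\<lambda>j r. c j * e j r" a, OF R f] by (intro suminf_nonneg) (auto simp: dist_decomp_iff_sums)
  have "(\<Sum>n. \<bar>c (n div R) * e (n div R) (n mod R)\<bar> powr p) powr (1 / p)
      \<le> (real R * (K powr p * ?S)) powr (1 / p)"
    using le nonneg p by (intro powr_mono2) auto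
  also have "\<dots> = (real R powr (1 / p) * K) * ?S powr (1 / p)"
    using p K S0 by (simp add: powr_mult powr_powr)
  finally show ?thesis
    unfolding coeff_size_def using K by (simp add: ennreal_mult[symmetric] ennreal_leI)
qed

text \<open>Each atom of the decomposition is split into \<open>R\<close> dyadic and \<open>M\<close> special atoms. The \<open>r\<close>-th dyadic
  pieces of all the atoms form a series \<open>gr r\<close>, the \<open>L\<close>-th special pieces form a series \<open>hL L\<close>, and
  finitely many series of the same kind are interleaved into one.\<close>

lemma hardy_decomp_split:
  fixes P :: "nat \<Rightarrow> real ^ 'n \<Rightarrow> real" and f :: "'n functional"
  assumes p: "0 < p" "p \<le> 1" and \<alpha>: "\<alpha> = real CARD('n) * (1 / p - 1)"
    and P: "orthonormal_basis (piecewise_polys (nat \<lfloor>\<alpha>\<rfloor>)) M P"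
    and K: "K = 2 powr (real CARD('n) * (1 / p - 1 / 2))"
    and R: "R = card (corners :: ('n \<Rightarrow> int) set)"
    and f: "dist_decomp p (atoms p) f c a" and off: "\<And>\<phi>. \<phi> \<notin> test_funs \<Longrightarrow> f \<phi> = 0"
  obtains g h where "g \<in> atomic_subspace p (dyadic_atoms p)"
    "h \<in> atomic_subspace p (special_atoms \<alpha> M P)" "f = (\<lambda>\<phi>. g \<phi> + h \<phi>)"
    "atomic_qnorm p (dyadic_atoms p) g \<le> ennreal (real R powr (1 / p) * K) * coeff_size p c"
    "atomic_qnorm p (special_atoms \<alpha> M P) h \<le> ennreal (real M powr (1 / p) * K) * coeff_size p c"
proof -
  have Kpos: "0 < K" by (simp add: K)
  have R0: "0 < R" unfolding R using zero_in_corners by (auto simp: card_gt_0_iff)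
  have M0: "0 < M" by (rule orthonormal_basis_nonempty[OF P])
  have aj: "a j \<in> atoms p" for j using f by (simp add: dist_decomp_iff_sums)
  have c: "summable (\<lambda>j. \<bar>c j\<bar> powr p)" using f by (simp add: dist_decomp_iff_sums)
  have D1: "dyadic_atoms p \<subseteq> (atom_multiples p 1 :: (real ^ 'n \<Rightarrow> real) set)"
    using dyadic_atoms_subset_atoms by (simp add: atoms_eq_atom_multiples_1)
  have SK: "special_atoms \<alpha> M P \<subseteq> atom_multiples p K"
    using special_atoms_subset_atom_multiples[OF p \<alpha> P] K by simp
  have "\<forall>j. \<exists>d e b. (\<forall>r<R. d r \<in> dyadic_atoms p) \<and> (\<forall>L<M. \<bar>e L\<bar> \<le> K)
      \<and> (\<forall>L<M. b L \<in> special_atoms \<alpha> M P)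
      \<and> (\<forall>\<phi>\<in>test_funs. dist_of (a j) \<phi> =
          (\<Sum>r<R. K * dist_of (d r) \<phi>) + (\<Sum>L<M. e L * dist_of (b L) \<phi>))"
  proof
    show "\<exists>d e b. (\<forall>r<R. d r \<in> dyadic_atoms p) \<and> (\<forall>L<M. \<bar>e L\<bar> \<le> K)
      \<and> (\<forall>L<M. b L \<in> special_atoms \<alpha> M P)
      \<and> (\<forall>\<phi>\<in>test_funs. dist_of (a j) \<phi> =
          (\<Sum>r<R. K * dist_of (d r) \<phi>) + (\<Sum>L<M. e L * dist_of (b L) \<phi>))" for j
      unfolding R by (rule atom_split[OF p \<alpha> P K aj[of j]]) (intro exI conjI)
  qed
  then obtain d e b where pieces: "\<forall>j. (\<forall>r<R. d j r \<in> dyadic_atoms p) \<and> (\<forall>L<M. \<bar>e j L\<bar> \<le> K)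
      \<and> (\<forall>L<M. b j L \<in> special_atoms \<alpha> M P)
      \<and> (\<forall>\<phi>\<in>test_funs. dist_of (a j) \<phi> =
          (\<Sum>r<R. K * dist_of (d j r) \<phi>) + (\<Sum>L<M. e j L * dist_of (b j L) \<phi>))"
    unfolding choice_iff by (elim exE)
  have d: "d j r \<in> dyadic_atoms p" if "r < R" for j r using pieces that by blast
  have e: "\<bar>e j L\<bar> \<le> K" if "L < M" for j L using pieces that by blast
  have b: "b j L \<in> special_atoms \<alpha> M P" if "L < M" for j L using pieces that by blast
  have split: "dist_of (a j) \<phi> =
      (\<Sum>r<R. K * dist_of (d j r) \<phi>) + (\<Sum>L<M. e j L * dist_of (b j L) \<phi>)"
    if "\<phi> \<in> test_funs" for j \<phi> using pieces that by blast
  have sums: "dist_decomp p A (\<lambda>\<phi>. if \<phi> \<in> test_funs then \<Sum>j. c j * u j * dist_of (v j) \<phi> else 0)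
      (\<lambda>j. c j * u j) v"
    if v: "\<And>j. v j \<in> A" and A: "A \<subseteq> atom_multiples p B" and B: "0 < B" and u: "\<And>j. \<bar>u j\<bar> \<le> K"
    for A v u B
  proof -
    have s: "summable (\<lambda>j. \<bar>c j * u j\<bar> powr p)"
    proof (rule summable_comparison_test'[OF summable_mult[OF c, of "K powr p"]])
      fix j
      have "\<bar>u j\<bar> powr p \<le> K powr p" using u[of j] p by (intro powr_mono2) auto
      then have "\<bar>c j\<bar> powr p * \<bar>u j\<bar> powr p \<le> \<bar>c j\<bar> powr p * K powr p"
        by (rule mult_left_mono) simp
      then show "norm (\<bar>c j * u j\<bar> powr p) \<le> K powr p * \<bar>c j\<bar> powr p"
        by (simp add: abs_mult powr_mult mult.commute)
    qed
    then show ?thesis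
      unfolding dist_decomp_iff_sums using v atom_series_sums[OF p B subsetD[OF A v] s] by simp
  qed
  define gr where "gr = (\<lambda>r \<phi>. if \<phi> \<in> test_funs then \<Sum>j. c j * K * dist_of (d j r) \<phi> else 0)"
  define hL where "hL = (\<lambda>L \<phi>. if \<phi> \<in> test_funs then \<Sum>j. c j * e j L * dist_of (b j L) \<phi> else 0)"
  have gr: "dist_decomp p (dyadic_atoms p) (gr r) (\<lambda>j. c j * K) (\<lambda>j. d j r)" if "r < R" for r
    unfolding gr_def using d[OF that] Kpos by (intro sums[OF _ D1]) auto
  have hL: "dist_decomp p (special_atoms \<alpha> M P) (hL L) (\<lambda>j. c j * e j L) (\<lambda>j. b j L)" if "L < M" for L
    unfolding hL_def using b[OF that] e[OF that] Kpos by (intro sums[OF _ SK]) auto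
  define g where "g = (\<lambda>\<phi>. \<Sum>r<R. gr r \<phi>)"
  define h where "h = (\<lambda>\<phi>. \<Sum>L<M. hL L \<phi>)"
  have g: "dist_decomp p (dyadic_atoms p) g (\<lambda>n. c (n div R) * K) (\<lambda>n. d (n div R) (n mod R))"
    unfolding g_def by (rule dist_decomp_interleave(1)[of R p _ gr "\<lambda>j r. c j * K" d, OF R0 gr])
  have h: "dist_decomp p (special_atoms \<alpha> M P) h (\<lambda>n. c (n div M) * e (n div M) (n mod M))
      (\<lambda>n. b (n div M) (n mod M))"
    unfolding h_def by (rule dist_decomp_interleave(1)[of M p _ hL "\<lambda>j L. c j * e j L" b, OF M0 hL])
  have off': "g \<phi> = 0" "h \<phi> = 0" if "\<phi> \<notin> test_funs" for \<phi>
    using that by (simp_all add: g_def gr_def h_def hL_def)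
  show ?thesis
  proof (rule that[of g h])
    show "g \<in> atomic_subspace p (dyadic_atoms p)"
      by (rule dist_decomp_imp_atomic_subspace(2)[OF p zero_less_one D1 g off'(1)])
    show "h \<in> atomic_subspace p (special_atoms \<alpha> M P)"
      by (rule dist_decomp_imp_atomic_subspace(2)[OF p Kpos SK h off'(2)])
    show "f = (\<lambda>\<phi>. g \<phi> + h \<phi>)"
    proof
      fix \<phi>
      show "f \<phi> = g \<phi> + h \<phi>"
      proof (cases "\<phi> \<in> test_funs")
        case True
        have "(\<lambda>j. \<Sum>r<R. c j * K * dist_of (d j r) \<phi>) sums g \<phi>"
          unfolding g_def using gr True by (intro sums_sum) (auto simp: dist_decomp_iff_sums)
        moreover have "(\<lambda>j. \<Sum>L<M. c j * e j L * dist_of (b j L) \<phi>) sums h \<phi>"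
          unfolding h_def using hL True by (intro sums_sum) (auto simp: dist_decomp_iff_sums)
        ultimately have "(\<lambda>j. (\<Sum>r<R. c j * K * dist_of (d j r) \<phi>)
            + (\<Sum>L<M. c j * e j L * dist_of (b j L) \<phi>)) sums (g \<phi> + h \<phi>)"
          by (rule sums_add)
        moreover have "(\<Sum>r<R. c j * K * dist_of (d j r) \<phi>)
            + (\<Sum>L<M. c j * e j L * dist_of (b j L) \<phi>) = c j * dist_of (a j) \<phi>" for j
          unfolding split[OF True] by (simp only: distrib_left sum_distrib_left mult.assoc)
        ultimately have "(\<lambda>j. c j * dist_of (a j) \<phi>) sums (g \<phi> + h \<phi>)" by simp
        moreover have "(\<lambda>j. c j * dist_of (a j) \<phi>) sums f \<phi>"
          using f True by (simp add: dist_decomp_iff_sums)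
        ultimately show ?thesis by (rule sums_unique2[rotated])
      qed (simp add: off off')
    qed
    have "atomic_qnorm p (dyadic_atoms p) g \<le> coeff_size p (\<lambda>n. c (n div R) * K)"
      unfolding atomic_qnorm_def
      using dist_decomp_imp_atomic_decomp[OF p(1) zero_less_one D1 g] by (intro Inf_lower) blast
    also have "\<dots> \<le> ennreal (real R powr (1 / p) * K) * coeff_size p c"
      by (rule coeff_size_interleave_le[OF p(1) R0 less_imp_le[OF Kpos] c, where e = "\<lambda>_ _. K", OF gr])
        (use Kpos in auto)
    finally show "atomic_qnorm p (dyadic_atoms p) g \<le> ennreal (real R powr (1 / p) * K) * coeff_size p c" .
    have "atomic_qnorm p (special_atoms \<alpha> M P) h
        \<le> coeff_size p (\<lambda>n. c (n div M) * e (n div M) (n mod M))"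
      unfolding atomic_qnorm_def
      using dist_decomp_imp_atomic_decomp[OF p(1) Kpos SK h] by (intro Inf_lower) blast
    also have "\<dots> \<le> ennreal (real M powr (1 / p) * K) * coeff_size p c"
      by (rule coeff_size_interleave_le[OF p(1) M0 less_imp_le[OF Kpos] c hL e])
    finally show "atomic_qnorm p (special_atoms \<alpha> M P) h \<le> ennreal (real M powr (1 / p) * K) * coeff_size p c" .
  qed
qed

text \<open>The \<open>p\<close>-th powers of the coefficients add up, and \<open>(G + H) powr (1 / p)\<close> is at most
  \<open>(2 max G H) powr (1 / p)\<close>, which explains the constant.\<close>

lemma sum_of_decomps:
  assumes p: "0 < p" and K: "0 < K"
    and A: "A \<subseteq> atom_multiples p K" and B: "B \<subseteq> atom_multiples p K"
    and g: "dist_decomp p A g c a" and h: "dist_decomp p B h c' a'"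
  obtains u v where "dist_decomp p (atoms p) (\<lambda>\<phi>. g \<phi> + h \<phi>) u v"
    "coeff_size p u \<le> ennreal (2 powr (1 / p) * K) * (coeff_size p c + coeff_size p c')"
proof -
  let ?G = "\<Sum>j. \<bar>c j\<bar> powr p" and ?H = "\<Sum>j. \<bar>c' j\<bar> powr p"
  have cs: "summable (\<lambda>j. \<bar>c j\<bar> powr p)" "summable (\<lambda>j. \<bar>c' j\<bar> powr p)"
    using g h by (auto simp: dist_decomp_iff_sums)
  have G0: "0 \<le> ?G" "0 \<le> ?H" using cs by (auto intro!: suminf_nonneg)
  \<comment> \<open>The two decompositions are interleaved as series number 0 and 1.\<close>
  define x where "x = (\<lambda>j r::nat. if r = 0 then c j else c' j)"
  define y where "y = (\<lambda>j r::nat. if r = 0 then a j else a' j)"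
  have xy: "dist_decomp p (A \<union> B) (if r = 0 then g else h) (\<lambda>j. x j r) (\<lambda>j. y j r)" if "r < 2" for r
    using g h by (auto simp: x_def y_def dist_decomp_iff_sums)
  let ?x = "\<lambda>n. x (n div 2) (n mod 2)"
  have two: "(\<Sum>r<2. F r) = F 0 + F 1" for F :: "nat \<Rightarrow> real" by (simp add: numeral_2_eq_2)
  have gh: "dist_decomp p (A \<union> B) (\<lambda>\<phi>. g \<phi> + h \<phi>) ?x (\<lambda>n. y (n div 2) (n mod 2))"
    using dist_decomp_interleave(1)[of 2 p "A \<union> B" "\<lambda>r. if r = 0 then g else h" x y, OF _ xy]
    by (simp add: two)
  have sz: "(\<Sum>n. \<bar>?x n\<bar> powr p) = ?G + ?H"
    using dist_decomp_interleave(2)[of 2 p "A \<union> B" "\<lambda>r. if r = 0 then g else h" x y, OF _ xy]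
    by (simp add: two x_def)
  have AB: "A \<union> B \<subseteq> atom_multiples p K" using A B by blast
  show ?thesis
  proof (rule that)
    show "dist_decomp p (atoms p) (\<lambda>\<phi>. g \<phi> + h \<phi>) (\<lambda>n. K * ?x n) (\<lambda>n z. y (n div 2) (n mod 2) z / K)"
      by (rule dist_decomp_rescale[OF K AB gh])
    have "(?G + ?H) powr (1 / p) \<le> (2 * max ?G ?H) powr (1 / p)"
      using G0 p by (intro powr_mono2) auto
    also have "\<dots> = 2 powr (1 / p) * max ?G ?H powr (1 / p)"
      using G0 by (simp add: powr_mult)
    also have "max ?G ?H powr (1 / p) \<le> ?G powr (1 / p) + ?H powr (1 / p)"
      by (simp add: max_def)
    finally have "(?G + ?H) powr (1 / p) \<le> 2 powr (1 / p) * (?G powr (1 / p) + ?H powr (1 / p))"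
      by simp
    then have "coeff_size p ?x \<le> ennreal (2 powr (1 / p)) * (coeff_size p c + coeff_size p c')"
      unfolding coeff_size_def sz by (simp add: ennreal_mult[symmetric] ennreal_plus[symmetric] ennreal_leI del: ennreal_plus)
    then have "ennreal K * coeff_size p ?x
        \<le> ennreal K * (ennreal (2 powr (1 / p)) * (coeff_size p c + coeff_size p c'))"
      by (rule mult_left_mono) simp
    moreover have "coeff_size p (\<lambda>n. K * ?x n) = ennreal K * coeff_size p ?x"
      using gh K by (intro coeff_size_cmult p) (auto simp: dist_decomp_def)
    moreover have "ennreal (2 powr (1 / p) * K) = ennreal K * ennreal (2 powr (1 / p))"
      using K by (simp add: ennreal_mult mult.commute)
    ultimately show "coeff_size p (\<lambda>n. K * ?x n)
        \<le> ennreal (2 powr (1 / p) * K) * (coeff_size p c + coeff_size p c')"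
      by (simp only: mult.assoc)
  qed
qed

text \<open>Bounds against the infima that define the quasinorms are proved by moving the constant to the other
  side, where it does not interfere with the infimum.\<close>

lemma ennreal_le_mult_iff:
  fixes x y :: ennreal
  assumes "0 < C"
  shows "x \<le> ennreal C * y \<longleftrightarrow> ennreal (1 / C) * x \<le> y"
proof -
  have inv: "ennreal (1 / C) * (ennreal C * z) = z" "ennreal C * (ennreal (1 / C) * z) = z" for z
    using assms by (simp_all add: mult.assoc[symmetric] ennreal_mult[symmetric])
  show ?thesis
  proof
    assume "x \<le> ennreal C * y"
    then have "ennreal (1 / C) * x \<le> ennreal (1 / C) * (ennreal C * y)" by (rule mult_left_mono) simp
    then show "ennreal (1 / C) * x \<le> y" by (simp only: inv)
  next
    assume "ennreal (1 / C) * x \<le> y"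
    then have "ennreal C * (ennreal (1 / C) * x) \<le> ennreal C * y" by (rule mult_left_mono) simp
    then show "x \<le> ennreal C * y" by (simp only: inv)
  qed
qed

lemma ennreal_le_Inf_add_Inf:
  fixes x :: ennreal
  assumes le: "\<And>s t. s \<in> S \<Longrightarrow> t \<in> T \<Longrightarrow> x \<le> s + t"
  shows "x \<le> Inf S + Inf T"
proof (rule ennreal_le_epsilon)
  fix \<epsilon> :: real assume fin: "Inf S + Inf T < top" and \<epsilon>: "0 < \<epsilon>"
  have step: "y < y + ennreal e" if "y < top" "0 < e" for y :: ennreal and e :: real
    using that by (cases y) (auto simp: ennreal_less_iff simp flip: ennreal_plus)
  have "Inf S < top" "Inf T < top" using fin by auto
  then have "Inf S < Inf S + ennreal (\<epsilon> / 2)" "Inf T < Inf T + ennreal (\<epsilon> / 2)"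
    using \<epsilon> by (intro step; simp)+
  then obtain s t where st: "s \<in> S" "s < Inf S + ennreal (\<epsilon> / 2)" "t \<in> T" "t < Inf T + ennreal (\<epsilon> / 2)"
    unfolding Inf_less_iff by blast
  have "x \<le> s + t" using le st by blast
  also have "\<dots> \<le> (Inf S + ennreal (\<epsilon> / 2)) + (Inf T + ennreal (\<epsilon> / 2))"
    using st by (intro add_mono) auto
  also have "\<dots> = Inf S + Inf T + (ennreal (\<epsilon> / 2) + ennreal (\<epsilon> / 2))" by (simp only: ac_simps)
  also have "ennreal (\<epsilon> / 2) + ennreal (\<epsilon> / 2) = ennreal \<epsilon>"
    using \<epsilon> by (simp flip: ennreal_plus)
  finally show "x \<le> Inf S + Inf T + ennreal \<epsilon>" .
qed

lemma hardy_qnorm_sum_le: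
  assumes p: "0 < p" and K: "0 < K"
    and A: "A \<subseteq> atom_multiples p K" and B: "B \<subseteq> atom_multiples p K"
  shows "hardy_qnorm p (\<lambda>\<phi>. g \<phi> + h \<phi>)
    \<le> ennreal (2 powr (1 / p) * K) * (atomic_qnorm p A g + atomic_qnorm p B h)"
proof -
  let ?C = "2 powr (1 / p) * K" and ?q = "hardy_qnorm p (\<lambda>\<phi>. g \<phi> + h \<phi>)"
  have C: "0 < ?C" using K by simp
  have "ennreal (1 / ?C) * ?q \<le> coeff_size p c + coeff_size p c'"
    if "atomic_decomp p A g c a" "atomic_decomp p B h c' a'" for c a c' a'
  proof -
    have "dist_decomp p A g c a" "dist_decomp p B h c' a'" using that by (auto simp: atomic_decomp_def)
    from sum_of_decomps[OF p K A B this] obtain u v where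
      uv: "dist_decomp p (atoms p) (\<lambda>\<phi>. g \<phi> + h \<phi>) u v"
      and le: "coeff_size p u \<le> ennreal ?C * (coeff_size p c + coeff_size p c')" .
    have "atomic_decomp p (atoms p) (\<lambda>\<phi>. g \<phi> + h \<phi>) u v"
      by (rule dist_decomp_imp_atomic_decomp[OF p zero_less_one _ uv]) (simp add: atoms_eq_atom_multiples_1)
    then have "?q \<le> coeff_size p u"
      unfolding hardy_qnorm_def atomic_qnorm_def by (intro Inf_lower) blast
    then have "?q \<le> ennreal ?C * (coeff_size p c + coeff_size p c')" using le by (rule order_trans)
    then show ?thesis by (simp only: ennreal_le_mult_iff[OF C])
  qed
  then have "ennreal (1 / ?C) * ?q \<le> atomic_qnorm p A g + atomic_qnorm p B h"
    unfolding atomic_qnorm_def by (intro ennreal_le_Inf_add_Inf) blast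
  then show ?thesis by (simp only: ennreal_le_mult_iff[OF C])
qed

theorem theoremB:
  fixes p \<alpha> :: real and M :: nat and P :: "nat \<Rightarrow> real ^ 'n \<Rightarrow> real"
  assumes "0 < p" and "p \<le> 1"
    and "\<alpha> = real CARD('n) * (1 / p - 1)"
    and "orthonormal_basis (piecewise_polys (nat \<lfloor>\<alpha>\<rfloor>)) M P"
  shows "hardy_space p = sum_space p (dyadic_atoms p) (special_atoms \<alpha> M P)
    \<and> (\<exists>c C :: real. c > 0 \<and> C > 0 \<and> (\<forall>f \<in> (hardy_space p :: 'n functional set).
          ennreal c * hardy_qnorm p f
            \<le> sum_qnorm p (dyadic_atoms p) (special_atoms \<alpha> M P) f
          \<and> sum_qnorm p (dyadic_atoms p) (special_atoms \<alpha> M P) f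
            \<le> ennreal C * hardy_qnorm p f))"
proof -
  let ?D = "dyadic_atoms p :: (real ^ 'n \<Rightarrow> real) set" and ?S = "special_atoms \<alpha> M P"
  define K :: real where "K = 2 powr (real CARD('n) * (1 / p - 1 / 2))"
  define R where "R = card (corners :: ('n \<Rightarrow> int) set)"
  define C where "C = real R powr (1 / p) * K + real M powr (1 / p) * K"
  have K: "0 < K" by (simp add: K_def)
  have p: "0 < p" "p \<le> 1" by fact+
  have R0: "0 < R" unfolding R_def using zero_in_corners by (auto simp: card_gt_0_iff)
  have C: "0 < C" using R0 K by (simp add: C_def add_pos_nonneg)
  have S: "?S \<subseteq> atom_multiples p K"
    using special_atoms_subset_atom_multiples[OF assms] by (simp add: K_def)
  have K1: "1 \<le> K" using p by (auto simp: K_def field_simps intro!: ge_one_powr_ge_zero)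
  \<comment> \<open>Dyadic atoms are atoms, and \<open>K \<ge> 1\<close> only relaxes the size condition.\<close>
  have D: "?D \<subseteq> atom_multiples p K"
    using atom_multiples_mono[OF zero_less_one K1] dyadic_atoms_subset_atoms
    by (auto simp: atoms_eq_atom_multiples_1)
  have split: "\<exists>g h. g \<in> atomic_subspace p ?D \<and> h \<in> atomic_subspace p ?S \<and> f = (\<lambda>\<phi>. g \<phi> + h \<phi>)
      \<and> atomic_qnorm p ?D g + atomic_qnorm p ?S h \<le> ennreal C * coeff_size p c"
    if f: "f \<in> hardy_space p" and fd: "atomic_decomp p (atoms p) f c a" for f c a
  proof -
    have dd: "dist_decomp p (atoms p) f c a" using fd by (simp add: atomic_decomp_def)
    have off: "f \<phi> = 0" if "\<phi> \<notin> test_funs" for \<phi>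
      using f that by (simp add: hardy_space_def distributions_def)
    obtain g h where gh: "g \<in> atomic_subspace p ?D" "h \<in> atomic_subspace p ?S" "f = (\<lambda>\<phi>. g \<phi> + h \<phi>)"
      and le: "atomic_qnorm p ?D g \<le> ennreal (real R powr (1 / p) * K) * coeff_size p c"
      "atomic_qnorm p ?S h \<le> ennreal (real M powr (1 / p) * K) * coeff_size p c"
      by (rule hardy_decomp_split[OF assms K_def R_def dd off])
    have "atomic_qnorm p ?D g + atomic_qnorm p ?S h
        \<le> ennreal (real R powr (1 / p) * K) * coeff_size p c + ennreal (real M powr (1 / p) * K) * coeff_size p c"
      using le by (rule add_mono)
    also have "\<dots> = ennreal C * coeff_size p c"
      using K by (simp add: C_def distrib_right ennreal_plus)
    finally show ?thesis using gh by blast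
  qed
  have space: "hardy_space p = sum_space p ?D ?S"
  proof
    show "hardy_space p \<subseteq> sum_space p ?D ?S"
    proof
      fix f :: "'n functional" assume f: "f \<in> hardy_space p"
      then obtain c a where "atomic_decomp p (atoms p) f c a" by (auto simp: hardy_space_def)
      from split[OF f this] show "f \<in> sum_space p ?D ?S" unfolding sum_space_def by blast
    qed
    show "sum_space p ?D ?S \<subseteq> hardy_space p"
    proof
      fix f assume "f \<in> sum_space p ?D ?S"
      then obtain g h where gh: "g \<in> atomic_subspace p ?D" "h \<in> atomic_subspace p ?S"
        and f: "f = (\<lambda>\<phi>. g \<phi> + h \<phi>)" by (auto simp: sum_space_def)
      obtain c a c' a' where "dist_decomp p ?D g c a" "dist_decomp p ?S h c' a'"
        using gh by (auto simp: atomic_subspace_def atomic_decomp_def)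
      from sum_of_decomps[OF p(1) K D S this] obtain u v where
        uv: "dist_decomp p (atoms p) f u v" unfolding f by metis
      have "f \<phi> = 0" if "\<phi> \<notin> test_funs" for \<phi>
        using gh that by (simp add: f atomic_subspace_def hardy_space_def distributions_def)
      from dist_decomp_imp_atomic_subspace(1)[OF p zero_less_one _ uv this]
      show "f \<in> hardy_space p" by (simp add: atoms_eq_atom_multiples_1)
    qed
  qed
  have lower: "ennreal (1 / (2 powr (1 / p) * K)) * hardy_qnorm p f \<le> sum_qnorm p ?D ?S f" for f
    unfolding sum_qnorm_def
  proof (rule Inf_greatest, clarify)
    fix g h
    show "ennreal (1 / (2 powr (1 / p) * K)) * hardy_qnorm p (\<lambda>\<phi>. g \<phi> + h \<phi>)
        \<le> atomic_qnorm p ?D g + atomic_qnorm p ?S h"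
      using hardy_qnorm_sum_le[OF p(1) K D S, of g h] K by (subst (asm) ennreal_le_mult_iff) auto
  qed
  have upper: "sum_qnorm p ?D ?S f \<le> ennreal C * hardy_qnorm p f" if f: "f \<in> hardy_space p" for f
  proof -
    have "ennreal (1 / C) * sum_qnorm p ?D ?S f \<le> hardy_qnorm p f"
      unfolding hardy_qnorm_def atomic_qnorm_def
    proof (rule Inf_greatest, clarify)
      fix c a assume "atomic_decomp p (atoms p) f c a"
      from split[OF f this] obtain g h where gh: "g \<in> atomic_subspace p ?D" "h \<in> atomic_subspace p ?S"
        "f = (\<lambda>\<phi>. g \<phi> + h \<phi>)"
        and le: "atomic_qnorm p ?D g + atomic_qnorm p ?S h \<le> ennreal C * coeff_size p c" by blast
      have "sum_qnorm p ?D ?S f \<le> atomic_qnorm p ?D g + atomic_qnorm p ?S h"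
        unfolding sum_qnorm_def using gh by (intro Inf_lower) blast
      then have "sum_qnorm p ?D ?S f \<le> ennreal C * coeff_size p c" using le by (rule order_trans)
      then show "ennreal (1 / C) * sum_qnorm p ?D ?S f \<le> coeff_size p c"
        by (simp only: ennreal_le_mult_iff[OF C])
    qed
    then show ?thesis by (simp only: ennreal_le_mult_iff[OF C])
  qed
  show ?thesis
    using space lower upper C K by (intro conjI exI[of _ "1 / (2 powr (1 / p) * K)"] exI[of _ C]) auto
qed

end
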